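(* The functor $\mathbf R$ from (discrete) abelian $G$-groups to $\mathscr F$-$G$-spaces is lax symmetric monoidal.
   Context: $G$ is a finite group. An abelian $G$-group is a discrete abelian group $A$ with an action of $G$ by automorphisms; these form a symmetric monoidal category under $\otimes=\otimes_{\mathbb Z}$ with diagonal action and unit $\mathbb Z$ with trivial action. $\mathscr F$ is the category of based sets $\mathbf n=\{0,1,\dots,n\}$ (basepoint $0$) and based functions, permutative under $\wedge$ with $\mathbf m\wedge\mathbf n=\mathbf{mn}$ via lexicographic ordering. An $\mathscr F$-$G$-space is a functor $X$ from $\mathscr F$ to nondegenerately based (compactly generated weak Hausdorff) $G$-spaces and based $G$-maps with $X(\mathbf 0)=*$. $\mathscr F$-$G$-spaces form a symmetric monoidal category under Day convolution: $X\wedge Y$ is the left Kan extension (enriched in based spaces) along $\wedge\colon\mathscr F\times\mathscr F\to\mathscr F$ of $(\mathbf m,\mathbf n)\mapsto X(\mathbf m)\wedge Y(\mathbf n)$, with unit $\mathbf I(\mathbf n)=\mathbf n\cong\mathscr F(\mathbf 1,\mathbf n)$. For an abelian $G$-group $A$, $\mathbf RA$ is the $\mathscr F$-$G$-space $(\mathbf RA)(\mathbf n)=A^n$ with basepoint $0$; a based function $\phi\colon\mathbf m\to\mathbf n$ induces $A^m\to A^n$, $(a_i)_i\mapsto\big(\sum_{\phi(i)=j}a_i\big)_{1\le j\le n}$. *)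

theory Defs
  imports
    "HOL-Analysis.Analysis"
    "HOL-Algebra.Bij"
    "HOL-Algebra.Group_Action"
    "HOL-Algebra.Generated_Groups"
    "HOL-Algebra.Free_Abelian_Groups"
begin

section \<open>Lax symmetric monoidal functors\<close>

text \<open>
  The structure carried by a symmetric monoidal category. \<open>Comp C X g f\<close> is \<open>g\<close> after \<open>f\<close>, where
  \<open>X\<close> is the domain of \<open>f\<close>; \<open>TensorHom C X X' Y Y' f g\<close> is the tensor product of
  \<open>f : X \<rightarrow> X'\<close> and \<open>g : Y \<rightarrow> Y'\<close>. The constraints have the directions
  \<open>Assoc : (X \<otimes> Y) \<otimes> Z \<rightarrow> X \<otimes> (Y \<otimes> Z)\<close>, \<open>LUnit : I \<otimes> X \<rightarrow> X\<close>,
  \<open>RUnit : X \<otimes> I \<rightarrow> X\<close> and \<open>Braid : X \<otimes> Y \<rightarrow> Y \<otimes> X\<close>.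
\<close>

record ('o, 'm) monoidal_structure =
  Obj :: "'o set"
  Hom :: "'o \<Rightarrow> 'o \<Rightarrow> 'm set"
  Ident :: "'o \<Rightarrow> 'm"
  Comp :: "'o \<Rightarrow> 'm \<Rightarrow> 'm \<Rightarrow> 'm"
  Tensor :: "'o \<Rightarrow> 'o \<Rightarrow> 'o"
  TensorHom :: "'o \<Rightarrow> 'o \<Rightarrow> 'o \<Rightarrow> 'o \<Rightarrow> 'm \<Rightarrow> 'm \<Rightarrow> 'm"
  Unit :: "'o"
  Assoc :: "'o \<Rightarrow> 'o \<Rightarrow> 'o \<Rightarrow> 'm"
  LUnit :: "'o \<Rightarrow> 'm"
  RUnit :: "'o \<Rightarrow> 'm"
  Braid :: "'o \<Rightarrow> 'o \<Rightarrow> 'm"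

text \<open>\<open>F1 X Y f\<close> is the value of the functor on \<open>f : X \<rightarrow> Y\<close>.\<close>

locale functor_between =
  fixes C :: "('o, 'm) monoidal_structure"
    and D :: "('p, 'n) monoidal_structure"
    and F0 :: "'o \<Rightarrow> 'p"
    and F1 :: "'o \<Rightarrow> 'o \<Rightarrow> 'm \<Rightarrow> 'n"
  assumes F_obj: "X \<in> Obj C \<Longrightarrow> F0 X \<in> Obj D"
    and F_hom: "\<lbrakk>X \<in> Obj C; Y \<in> Obj C; f \<in> Hom C X Y\<rbrakk> \<Longrightarrow> F1 X Y f \<in> Hom D (F0 X) (F0 Y)"
    and F_id: "X \<in> Obj C \<Longrightarrow> F1 X X (Ident C X) = Ident D (F0 X)"
    and F_comp: "\<lbrakk>X \<in> Obj C; Y \<in> Obj C; Z \<in> Obj C; f \<in> Hom C X Y; g \<in> Hom C Y Z\<rbrakk>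
      \<Longrightarrow> F1 X Z (Comp C X g f) = Comp D (F0 X) (F1 Y Z g) (F1 X Y f)"

locale lax_symmetric_monoidal_functor = functor_between C D F0 F1
  for C :: "('o, 'm) monoidal_structure"
    and D :: "('p, 'n) monoidal_structure"
    and F0 :: "'o \<Rightarrow> 'p"
    and F1 :: "'o \<Rightarrow> 'o \<Rightarrow> 'm \<Rightarrow> 'n" +
  fixes \<mu> :: "'o \<Rightarrow> 'o \<Rightarrow> 'n"
    and \<epsilon> :: "'n"
  assumes unit_hom: "\<epsilon> \<in> Hom D (Unit D) (F0 (Unit C))"
    and mult_hom: "\<lbrakk>A \<in> Obj C; B \<in> Obj C\<rbrakk>
      \<Longrightarrow> \<mu> A B \<in> Hom D (Tensor D (F0 A) (F0 B)) (F0 (Tensor C A B))"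
    and mult_natural:
      "\<lbrakk>A \<in> Obj C; A' \<in> Obj C; B \<in> Obj C; B' \<in> Obj C; f \<in> Hom C A A'; g \<in> Hom C B B'\<rbrakk>
      \<Longrightarrow> Comp D (Tensor D (F0 A) (F0 B))
            (\<mu> A' B')
            (TensorHom D (F0 A) (F0 A') (F0 B) (F0 B') (F1 A A' f) (F1 B B' g))
        = Comp D (Tensor D (F0 A) (F0 B))
            (F1 (Tensor C A B) (Tensor C A' B') (TensorHom C A A' B B' f g))
            (\<mu> A B)"
    and associativity:
      "\<lbrakk>A \<in> Obj C; B \<in> Obj C; E \<in> Obj C;
        P = Tensor D (Tensor D (F0 A) (F0 B)) (F0 E)\<rbrakk>
      \<Longrightarrow> Comp D P
            (\<mu> A (Tensor C B E))
            (Comp D P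
              (TensorHom D (F0 A) (F0 A) (Tensor D (F0 B) (F0 E)) (F0 (Tensor C B E))
                 (Ident D (F0 A)) (\<mu> B E))
              (Assoc D (F0 A) (F0 B) (F0 E)))
        = Comp D P
            (F1 (Tensor C (Tensor C A B) E) (Tensor C A (Tensor C B E)) (Assoc C A B E))
            (Comp D P
              (\<mu> (Tensor C A B) E)
              (TensorHom D (Tensor D (F0 A) (F0 B)) (F0 (Tensor C A B)) (F0 E) (F0 E)
                 (\<mu> A B) (Ident D (F0 E))))"
    and left_unitality:
      "\<lbrakk>A \<in> Obj C; P = Tensor D (Unit D) (F0 A)\<rbrakk>
      \<Longrightarrow> LUnit D (F0 A)
        = Comp D P
            (F1 (Tensor C (Unit C) A) A (LUnit C A))
            (Comp D P
              (\<mu> (Unit C) A)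
              (TensorHom D (Unit D) (F0 (Unit C)) (F0 A) (F0 A) \<epsilon> (Ident D (F0 A))))"
    and right_unitality:
      "\<lbrakk>A \<in> Obj C; P = Tensor D (F0 A) (Unit D)\<rbrakk>
      \<Longrightarrow> RUnit D (F0 A)
        = Comp D P
            (F1 (Tensor C A (Unit C)) A (RUnit C A))
            (Comp D P
              (\<mu> A (Unit C))
              (TensorHom D (F0 A) (F0 A) (Unit D) (F0 (Unit C)) (Ident D (F0 A)) \<epsilon>))"
    and symmetry:
      "\<lbrakk>A \<in> Obj C; B \<in> Obj C; P = Tensor D (F0 A) (F0 B)\<rbrakk>
      \<Longrightarrow> Comp D P (\<mu> B A) (Braid D (F0 A) (F0 B))
        = Comp D P (F1 (Tensor C A B) (Tensor C B A) (Braid C A B)) (\<mu> A B)"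


section \<open>A universe of elements\<close>

text \<open>
  Groups and spaces have their elements in the type \<open>'a univ\<close>, which contains an arbitrary type
  \<open>'a\<close> and is large enough to be closed under the constructions below: it contains the integers
  and finite tuples, and quotients are realised in it by choosing one representative in each
  class. The constructor \<open>Sum\<close> serves the tensor product of groups and \<open>Pt\<close> the Day
  convolution.
\<close>

datatype 'a univ =
    Atom 'a
  | Z (the_Z: int)
  | Tup (entries: "'a univ list")
  | Sum (summands: "(int \<times> 'a univ \<times> 'a univ) list")
  | Pt nat nat "nat \<Rightarrow> nat" "'a univ" "'a univ"


section \<open>Abelian G-groups\<close>

text \<open>Groups are written multiplicatively, as always in \<open>HOL-Algebra\<close>.\<close>

record ('g, 'u) G_group = "'u monoid" +
  gact :: "'g \<Rightarrow> 'u \<Rightarrow> 'u"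

definition abelian_G_group :: "('g, 'x) monoid_scheme \<Rightarrow> ('g, 'u) G_group \<Rightarrow> bool" where
  "abelian_G_group G A \<longleftrightarrow> comm_group A \<and> group_hom G (AutoGroup A) (gact A)"

definition G_homs :: "('g, 'x) monoid_scheme \<Rightarrow> ('g, 'u) G_group \<Rightarrow> ('g, 'u) G_group \<Rightarrow> ('u \<Rightarrow> 'u) set"
  where "G_homs G A B = {f \<in> hom A B \<inter> extensional (carrier A).
    \<forall>g\<in>carrier G. \<forall>a\<in>carrier A. f (gact A g a) = gact B g (f a)}"

subsection \<open>Tensor products\<close>

definition tensor_relators ::
    "('u, 'x) monoid_scheme \<Rightarrow> ('u, 'y) monoid_scheme \<Rightarrow> ('u \<times> 'u \<Rightarrow>\<^sub>0 int) set" where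
  "tensor_relators A B =
     {frag_of (a \<otimes>\<^bsub>A\<^esub> a', b) - frag_of (a, b) - frag_of (a', b) | a a' b.
        a \<in> carrier A \<and> a' \<in> carrier A \<and> b \<in> carrier B} \<union>
     {frag_of (a, b \<otimes>\<^bsub>B\<^esub> b') - frag_of (a, b) - frag_of (a, b') | a b b'.
        a \<in> carrier A \<and> b \<in> carrier B \<and> b' \<in> carrier B}"

definition tensor_subgroup ::
    "('u, 'x) monoid_scheme \<Rightarrow> ('u, 'y) monoid_scheme \<Rightarrow> ('u \<times> 'u \<Rightarrow>\<^sub>0 int) set" where
  "tensor_subgroup A B =
     generate (free_Abelian_group (carrier A \<times> carrier B)) (tensor_relators A B)"

definition tensor_quotient ::
    "('u, 'x) monoid_scheme \<Rightarrow> ('u, 'y) monoid_scheme \<Rightarrow> ('u \<times> 'u \<Rightarrow>\<^sub>0 int) set monoid" where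
  "tensor_quotient A B = free_Abelian_group (carrier A \<times> carrier B) Mod tensor_subgroup A B"

definition frag_of_list :: "(int \<times> 'u \<times> 'u) list \<Rightarrow> ('u \<times> 'u \<Rightarrow>\<^sub>0 int)" where
  "frag_of_list l = (\<Sum>(k, ab)\<leftarrow>l. frag_cmul k (frag_of ab))"

definition tensor_code :: "('a univ \<times> 'a univ \<Rightarrow>\<^sub>0 int) set \<Rightarrow> 'a univ" where
  "tensor_code c = Sum (SOME l. frag_of_list l \<in> c)"

text \<open>The tensor product over the integers, transported along the injection \<open>tensor_code\<close>.\<close>

definition tensor_group ::
    "('a univ, 'x) monoid_scheme \<Rightarrow> ('a univ, 'y) monoid_scheme \<Rightarrow> 'a univ monoid" where
  "tensor_group A B = (let Q = tensor_quotient A B; dec = inv_into (carrier Q) tensor_code in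
     \<lparr>carrier = tensor_code ` carrier Q,
      mult = \<lambda>s t. tensor_code (dec s \<otimes>\<^bsub>Q\<^esub> dec t),
      one = tensor_code \<one>\<^bsub>Q\<^esub>\<rparr>)"

definition pure_tensor ::
    "('a univ, 'x) monoid_scheme \<Rightarrow> ('a univ, 'y) monoid_scheme \<Rightarrow> 'a univ \<Rightarrow> 'a univ \<Rightarrow> 'a univ" where
  "pure_tensor A B a b = tensor_code
     (tensor_subgroup A B #>\<^bsub>free_Abelian_group (carrier A \<times> carrier B)\<^esub> frag_of (a, b))"

text \<open>The homomorphism out of the tensor product determined by a bilinear map \<open>f\<close>.\<close>

definition tensor_lift ::
    "('a univ, 'x) monoid_scheme \<Rightarrow> ('a univ, 'y) monoid_scheme \<Rightarrow> ('a univ, 'z) monoid_scheme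
     \<Rightarrow> ('a univ \<Rightarrow> 'a univ \<Rightarrow> 'a univ) \<Rightarrow> 'a univ \<Rightarrow> 'a univ" where
  "tensor_lift A B C f = (THE h.
     h \<in> hom (tensor_group A B) C \<inter> extensional (carrier (tensor_group A B)) \<and>
     (\<forall>a\<in>carrier A. \<forall>b\<in>carrier B. h (pure_tensor A B a b) = f a b))"

definition tensor_G :: "('g, 'a univ) G_group \<Rightarrow> ('g, 'a univ) G_group \<Rightarrow> ('g, 'a univ) G_group" where
  "tensor_G A B = \<lparr>carrier = carrier (tensor_group A B),
     mult = mult (tensor_group A B),
     one = one (tensor_group A B),
     gact = \<lambda>g. tensor_lift A B (tensor_group A B) (\<lambda>a b. pure_tensor A B (gact A g a) (gact B g b))\<rparr>"

definition integers_G :: "('g, 'a univ) G_group" where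
  "integers_G = \<lparr>carrier = range Z,
     mult = \<lambda>s t. Z (the_Z s + the_Z t),
     one = Z 0,
     gact = \<lambda>g. \<lambda>z\<in>range Z. z\<rparr>"

definition tensor_assoc ::
    "('g, 'a univ) G_group \<Rightarrow> ('g, 'a univ) G_group \<Rightarrow> ('g, 'a univ) G_group \<Rightarrow> 'a univ \<Rightarrow> 'a univ" where
  "tensor_assoc A B C = (THE h.
     h \<in> hom (tensor_G (tensor_G A B) C) (tensor_G A (tensor_G B C))
         \<inter> extensional (carrier (tensor_G (tensor_G A B) C)) \<and>
     (\<forall>a\<in>carrier A. \<forall>b\<in>carrier B. \<forall>c\<in>carrier C.
        h (pure_tensor (tensor_G A B) C (pure_tensor A B a b) c)
        = pure_tensor A (tensor_G B C) a (pure_tensor B C b c)))"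

definition abelian_G_groups ::
    "('g, 'x) monoid_scheme \<Rightarrow> (('g, 'a univ) G_group, 'a univ \<Rightarrow> 'a univ) monoidal_structure" where
  "abelian_G_groups G = \<lparr>
     Obj = {A. abelian_G_group G A},
     Hom = \<lambda>A B. {f \<in> G_homs G A B. abelian_G_group G A \<and> abelian_G_group G B},
     Ident = \<lambda>A. \<lambda>a\<in>carrier A. a,
     Comp = \<lambda>A. compose (carrier A),
     Tensor = tensor_G,
     TensorHom = \<lambda>A A' B B' f g. tensor_lift A B (tensor_G A' B') (\<lambda>a b. pure_tensor A' B' (f a) (g b)),
     Unit = integers_G,
     Assoc = tensor_assoc,
     LUnit = \<lambda>A. tensor_lift (integers_G :: ('g, 'a univ) G_group) A A (\<lambda>z a. a [^]\<^bsub>A\<^esub> the_Z z),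
     RUnit = \<lambda>A. tensor_lift A (integers_G :: ('g, 'a univ) G_group) A (\<lambda>a z. a [^]\<^bsub>A\<^esub> the_Z z),
     Braid = \<lambda>A B. tensor_lift A B (tensor_G B A) (\<lambda>a b. pure_tensor B A b a)\<rparr>"


section \<open>Nondegenerately based G-spaces\<close>

subsection \<open>Compactly generated weak Hausdorff spaces\<close>

text \<open>
  A space is weak Hausdorff if every continuous image of a compact Hausdorff space is closed. It
  suffices to test this on compact Hausdorff spaces with points in \<open>'a set set\<close>: if
  \<open>u : K \<rightarrow> X\<close> is continuous and \<open>D \<subseteq> K\<close> contains one point of each nonempty fibre,
  then the closure of \<open>D\<close> has the same image as \<open>K\<close> and, having a dense subset of size at most
  that of \<open>'a\<close>, it has at most as many points as \<open>'a set set\<close>.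
\<close>

definition weak_Hausdorff_space :: "'a topology \<Rightarrow> bool" where
  "weak_Hausdorff_space X \<longleftrightarrow>
     (\<forall>(K :: 'a set set topology) u. compact_space K \<and> Hausdorff_space K \<and> continuous_map K X u
        \<longrightarrow> closedin X (u ` topspace K))"

text \<open>
  For a weak Hausdorff space, the compactly generated topology is the one determined by the
  compact Hausdorff subspaces, since their underlying sets are exactly the continuous images of compact
  Hausdorff spaces. The library's \<open>kification\<close> and \<open>k_space\<close> test against all quasi-compact
  subspaces instead, which is different: the one-point compactification of the rational numbers
  is compactly generated and weak Hausdorff but not Hausdorff, so its square in the category of
  such spaces is strictly finer than the (quasi-compact) product topology.
\<close>

definition cg_open :: "'a topology \<Rightarrow> 'a set \<Rightarrow> bool" where
  "cg_open X U \<longleftrightarrow> U \<subseteq> topspace X \<and>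
     (\<forall>K. compactin X K \<and> Hausdorff_space (subtopology X K) \<longrightarrow> openin (subtopology X K) (K \<inter> U))"

definition cg_topology :: "'a topology \<Rightarrow> 'a topology" where
  "cg_topology X = topology (cg_open X)"

lemma istopology_cg_open: "istopology (cg_open X)"
  unfolding istopology_def
proof (intro conjI strip)
  show "cg_open X (S \<inter> T)" if "cg_open X S" and "cg_open X T" for S T
  proof -
    have "K \<inter> (S \<inter> T) = (K \<inter> S) \<inter> (K \<inter> T)" for K by blast
    then show ?thesis
      using that unfolding cg_open_def by auto
  qed
  show "cg_open X (\<Union> \<K>)" if "\<forall>K\<in>\<K>. cg_open X K" for \<K>
    using that unfolding cg_open_def Int_Union by blast
qed

lemma openin_cg_topology: "openin (cg_topology X) U \<longleftrightarrow> cg_open X U"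
  by (simp add: cg_topology_def istopology_cg_open)

definition cgwh_space :: "'a topology \<Rightarrow> bool" where
  "cgwh_space X \<longleftrightarrow> weak_Hausdorff_space X \<and> cg_topology X = X"

text \<open>The product in the category of compactly generated weak Hausdorff spaces.\<close>

definition cg_prod :: "'a topology \<Rightarrow> 'b topology \<Rightarrow> ('a \<times> 'b) topology" where
  "cg_prod X Y = cg_topology (prod_topology X Y)"

subsection \<open>Based G-spaces\<close>

record ('g, 'u) G_space =
  topo :: "'u topology"
  pt :: "'u"
  act :: "'g \<Rightarrow> 'u \<Rightarrow> 'u"

abbreviation points :: "('g, 'u, 'x) G_space_scheme \<Rightarrow> 'u set" where
  "points X \<equiv> topspace (topo X)"

text \<open>The group is discrete, so an action is continuous if each element acts continuously.\<close>

definition based_G_space :: "('g, 'x) monoid_scheme \<Rightarrow> ('g, 'u) G_space \<Rightarrow> bool" where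
  "based_G_space G X \<longleftrightarrow>
     cgwh_space (topo X) \<and> pt X \<in> points X \<and> group_action G (points X) (act X) \<and>
     (\<forall>g\<in>carrier G. continuous_map (topo X) (topo X) (act X g) \<and> act X g (pt X) = pt X)"

text \<open>The basepoint is nondegenerate if \<open>(X, pt)\<close> is a \<open>G\<close>-NDR pair.\<close>

definition nondegenerate :: "('g, 'x) monoid_scheme \<Rightarrow> ('g, 'u) G_space \<Rightarrow> bool" where
  "nondegenerate G X \<longleftrightarrow>
     (\<exists>(u :: 'u \<Rightarrow> real) (h :: 'u \<times> real \<Rightarrow> 'u).
        continuous_map (topo X) (top_of_set {0..1}) u \<and>
        continuous_map (prod_topology (topo X) (top_of_set {0..1})) (topo X) h \<and>
        (\<forall>x\<in>points X. u x = 0 \<longleftrightarrow> x = pt X) \<and>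
        (\<forall>x\<in>points X. h (x, 0) = x) \<and>
        (\<forall>t\<in>{0..1}. h (pt X, t) = pt X) \<and>
        (\<forall>x\<in>points X. u x < 1 \<longrightarrow> h (x, 1) = pt X) \<and>
        (\<forall>g\<in>carrier G. \<forall>x\<in>points X. u (act X g x) = u x \<and>
           (\<forall>t\<in>{0..1}. h (act X g x, t) = act X g (h (x, t)))))"

definition G_maps :: "('g, 'x) monoid_scheme \<Rightarrow> ('g, 'u) G_space \<Rightarrow> ('g, 'u) G_space \<Rightarrow> ('u \<Rightarrow> 'u) set"
  where "G_maps G X Y = {f \<in> extensional (points X).
    continuous_map (topo X) (topo Y) f \<and> f (pt X) = pt Y \<and>
    (\<forall>g\<in>carrier G. \<forall>x\<in>points X. f (act X g x) = act Y g (f x))}"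


section \<open>F-G-spaces\<close>

subsection \<open>The category F of finite based sets\<close>

definition F_maps :: "nat \<Rightarrow> nat \<Rightarrow> (nat \<Rightarrow> nat) set" where
  "F_maps m n = {\<phi> \<in> {..m} \<rightarrow>\<^sub>E {..n}. \<phi> 0 = 0}"

text \<open>
  The identification of the smash product of \<open>m\<close> and \<open>n\<close> with \<open>m * n\<close>: \<open>lex_pos n i j\<close> is the position of
  \<open>(i, j)\<close>, \<open>1 \<le> i \<le> m\<close>, \<open>1 \<le> j \<le> n\<close>, in the lexicographic order, and \<open>lex_row n\<close> and
  \<open>lex_col n\<close> recover the coordinates of a nonzero element.
\<close>

definition lex_pos :: "nat \<Rightarrow> nat \<Rightarrow> nat \<Rightarrow> nat" where
  "lex_pos n i j = (if i = 0 \<or> j = 0 then 0 else (i - 1) * n + j)"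

definition lex_row :: "nat \<Rightarrow> nat \<Rightarrow> nat" where
  "lex_row n k = (k - 1) div n + 1"

definition lex_col :: "nat \<Rightarrow> nat \<Rightarrow> nat" where
  "lex_col n k = (k - 1) mod n + 1"

text \<open>The smash product of \<open>\<phi> : m \<rightarrow> m'\<close> and \<open>\<psi> : n \<rightarrow> n'\<close>.\<close>

definition F_smash :: "nat \<Rightarrow> nat \<Rightarrow> nat \<Rightarrow> (nat \<Rightarrow> nat) \<Rightarrow> (nat \<Rightarrow> nat) \<Rightarrow> nat \<Rightarrow> nat" where
  "F_smash m n n' \<phi> \<psi> = (\<lambda>k\<in>{..m * n}. if k = 0 then 0 else lex_pos n' (\<phi> (lex_row n k)) (\<psi> (lex_col n k)))"

definition F_twist :: "nat \<Rightarrow> nat \<Rightarrow> nat \<Rightarrow> nat" where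
  "F_twist m n = (\<lambda>k\<in>{..m * n}. if k = 0 then 0 else lex_pos m (lex_col n k) (lex_row n k))"

subsection \<open>F-G-spaces and their maps\<close>

record ('g, 'u) FG_space =
  sp :: "nat \<Rightarrow> ('g, 'u) G_space"
  ind :: "nat \<Rightarrow> nat \<Rightarrow> (nat \<Rightarrow> nat) \<Rightarrow> 'u \<Rightarrow> 'u"

definition is_FG_space :: "('g, 'x) monoid_scheme \<Rightarrow> ('g, 'u) FG_space \<Rightarrow> bool" where
  "is_FG_space G X \<longleftrightarrow>
     (\<forall>n. based_G_space G (sp X n) \<and> nondegenerate G (sp X n)) \<and>
     points (sp X 0) = {pt (sp X 0)} \<and>
     (\<forall>m n. \<forall>\<phi>\<in>F_maps m n. ind X m n \<phi> \<in> G_maps G (sp X m) (sp X n)) \<and>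
     (\<forall>n. ind X n n (\<lambda>i\<in>{..n}. i) = (\<lambda>x\<in>points (sp X n). x)) \<and>
     (\<forall>m n p. \<forall>\<phi>\<in>F_maps m n. \<forall>\<psi>\<in>F_maps n p.
        ind X m p (compose {..m} \<psi> \<phi>) = compose (points (sp X m)) (ind X n p \<psi>) (ind X m n \<phi>))"

definition FG_maps ::
    "('g, 'x) monoid_scheme \<Rightarrow> ('g, 'u) FG_space \<Rightarrow> ('g, 'u) FG_space \<Rightarrow> (nat \<Rightarrow> 'u \<Rightarrow> 'u) set" where
  "FG_maps G X Y = {\<theta>. (\<forall>n. \<theta> n \<in> G_maps G (sp X n) (sp Y n)) \<and>
     (\<forall>m n. \<forall>\<phi>\<in>F_maps m n. \<forall>x\<in>points (sp X m).
        \<theta> n (ind X m n \<phi> x) = ind Y m n \<phi> (\<theta> m x))}"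

subsection \<open>Day convolution\<close>

text \<open>
  The enriched left Kan extension of \<open>(m, n) \<mapsto> X(m) \<and> Y(n)\<close> along the smash product of F is,
  at \<open>p\<close>, the coend over \<open>(m, n)\<close> of the based spaces \<open>F(m * n, p) \<and> X(m) \<and> Y(n)\<close>. As a
  colimit of compactly generated weak Hausdorff spaces it is obtained from the disjoint union of
  the products \<open>X(m) \<times> Y(n)\<close>, one for each \<open>\<phi> : m * n \<rightarrow> p\<close>, by dividing out the smallest
  closed equivalence relation containing \<open>day_relators\<close>. The second set of relators collapses the
  points of \<open>X(m) \<or> Y(n)\<close>; the points with \<open>\<phi> = 0\<close> are then collapsed by the first set,
  because the zero map factors through the set \<open>0\<close>.
\<close>

type_synonym 'u day_point = "(nat \<times> nat \<times> (nat \<Rightarrow> nat)) \<times> ('u \<times> 'u)"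

definition day_presum :: "('g, 'u) FG_space \<Rightarrow> ('g, 'u) FG_space \<Rightarrow> nat \<Rightarrow> 'u day_point topology" where
  "day_presum X Y p =
     sum_topology (\<lambda>(m, n, \<phi>). cg_prod (topo (sp X m)) (topo (sp Y n)))
       {(m, n, \<phi>). \<phi> \<in> F_maps (m * n) p}"

definition day_relators :: "('g, 'u) FG_space \<Rightarrow> ('g, 'u) FG_space \<Rightarrow> nat \<Rightarrow> ('u day_point \<times> 'u day_point) set"
  where "day_relators X Y p =
     {(((m', n', \<phi>), (ind X m m' f x, ind Y n n' g y)),
       ((m, n, compose {..m * n} \<phi> (F_smash m n n' f g)), (x, y))) | m n m' n' f g \<phi> x y.
        f \<in> F_maps m m' \<and> g \<in> F_maps n n' \<and> \<phi> \<in> F_maps (m' * n') p \<and>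
        x \<in> points (sp X m) \<and> y \<in> points (sp Y n)} \<union>
     {(((m, n, \<phi>), (x, y)), ((m', n', \<phi>'), (x', y'))) | m n \<phi> x y m' n' \<phi>' x' y'.
        ((m, n, \<phi>), (x, y)) \<in> topspace (day_presum X Y p) \<and>
        ((m', n', \<phi>'), (x', y')) \<in> topspace (day_presum X Y p) \<and>
        (x = pt (sp X m) \<or> y = pt (sp Y n)) \<and> (x' = pt (sp X m') \<or> y' = pt (sp Y n'))}"

definition closed_equiv_hull :: "'b topology \<Rightarrow> ('b \<times> 'b) set \<Rightarrow> ('b \<times> 'b) set" where
  "closed_equiv_hull S R0 = \<Inter>{R. equiv (topspace S) R \<and> R0 \<subseteq> R \<and> closedin (cg_prod S S) R}"

definition quotient_topology :: "'b topology \<Rightarrow> ('b \<Rightarrow> 'c) \<Rightarrow> 'c topology" where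
  "quotient_topology S q =
     topology (\<lambda>U. U \<subseteq> q ` topspace S \<and> openin S {t \<in> topspace S. q t \<in> U})"

lemma openin_quotient_topology:
  "openin (quotient_topology S q) U \<longleftrightarrow> U \<subseteq> q ` topspace S \<and> openin S {t \<in> topspace S. q t \<in> U}"
proof -
  have "istopology (\<lambda>U. U \<subseteq> q ` topspace S \<and> openin S {t \<in> topspace S. q t \<in> U})"
    unfolding istopology_def
  proof (intro conjI allI impI)
    fix U V
    assume U: "U \<subseteq> q ` topspace S \<and> openin S {t \<in> topspace S. q t \<in> U}"
      and V: "V \<subseteq> q ` topspace S \<and> openin S {t \<in> topspace S. q t \<in> V}"
    have "{t \<in> topspace S. q t \<in> U \<inter> V} = {t \<in> topspace S. q t \<in> U} \<inter> {t \<in> topspace S. q t \<in> V}"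
      by blast
    then show "openin S {t \<in> topspace S. q t \<in> U \<inter> V}"
      using U V by (simp only:) (rule openin_Int, blast+)
    show "U \<inter> V \<subseteq> q ` topspace S" using U by blast
  next
    fix \<K>
    assume K: "\<forall>U\<in>\<K>. U \<subseteq> q ` topspace S \<and> openin S {t \<in> topspace S. q t \<in> U}"
    have "{t \<in> topspace S. q t \<in> \<Union>\<K>} = \<Union>((\<lambda>U. {t \<in> topspace S. q t \<in> U}) ` \<K>)"
      by blast
    then show "openin S {t \<in> topspace S. q t \<in> \<Union>\<K>}"
      using K by (simp only:) (rule openin_Union, blast)
    show "\<Union>\<K> \<subseteq> q ` topspace S" using K by blast
  qed
  then show ?thesis
    unfolding quotient_topology_def by (rule topology_inverse'[THEN fun_cong])
qed

text \<open>The class of a point of \<open>day_presum X Y p\<close>, coded by a representative.\<close>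

definition day_class ::
    "('g, 'a univ) FG_space \<Rightarrow> ('g, 'a univ) FG_space \<Rightarrow> nat \<Rightarrow> 'a univ day_point \<Rightarrow> 'a univ" where
  "day_class X Y p t =
     (case SOME t'. (t, t') \<in> closed_equiv_hull (day_presum X Y p) (day_relators X Y p) of
        ((m, n, \<phi>), (x, y)) \<Rightarrow> Pt m n \<phi> x y)"

definition day :: "('g, 'a univ) FG_space \<Rightarrow> ('g, 'a univ) FG_space \<Rightarrow> ('g, 'a univ) FG_space" where
  "day X Y = \<lparr>
     sp = \<lambda>p. \<lparr>
       topo = quotient_topology (day_presum X Y p) (day_class X Y p),
       pt = day_class X Y p ((0, 0, \<lambda>i\<in>{..0}. 0), (pt (sp X 0), pt (sp Y 0))),
       act = \<lambda>g. \<lambda>w\<in>day_class X Y p ` topspace (day_presum X Y p).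
         case w of Pt m n \<phi> x y \<Rightarrow>
           day_class X Y p ((m, n, \<phi>), (act (sp X m) g x, act (sp Y n) g y))\<rparr>,
     ind = \<lambda>p q \<psi>. \<lambda>w\<in>day_class X Y p ` topspace (day_presum X Y p).
       case w of Pt m n \<phi> x y \<Rightarrow> day_class X Y q ((m, n, compose {..m * n} \<psi> \<phi>), (x, y))\<rparr>"

text \<open>The universal maps \<open>X(m) \<and> Y(n) \<rightarrow> (X \<and> Y)(m * n)\<close>.\<close>

definition day_pair ::
    "('g, 'a univ) FG_space \<Rightarrow> ('g, 'a univ) FG_space \<Rightarrow> nat \<Rightarrow> nat \<Rightarrow> 'a univ \<Rightarrow> 'a univ \<Rightarrow> 'a univ" where
  "day_pair X Y m n x y = day_class X Y (m * n) ((m, n, \<lambda>k\<in>{..m * n}. k), (x, y))"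

text \<open>
  The map \<open>X \<and> Y \<rightarrow> W\<close> determined by a natural family \<open>f m n : X(m) \<and> Y(n) \<rightarrow> W(m * n)\<close>.
\<close>

definition day_lift ::
    "('g, 'x) monoid_scheme \<Rightarrow> ('g, 'a univ) FG_space \<Rightarrow> ('g, 'a univ) FG_space \<Rightarrow> ('g, 'a univ) FG_space
     \<Rightarrow> (nat \<Rightarrow> nat \<Rightarrow> 'a univ \<Rightarrow> 'a univ \<Rightarrow> 'a univ) \<Rightarrow> nat \<Rightarrow> 'a univ \<Rightarrow> 'a univ" where
  "day_lift G X Y W f = (THE \<theta>. \<theta> \<in> FG_maps G (day X Y) W \<and>
     (\<forall>m n. \<forall>x\<in>points (sp X m). \<forall>y\<in>points (sp Y n).
        \<theta> (m * n) (day_pair X Y m n x y) = f m n x y))"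

definition day_unit :: "('g, 'a univ) FG_space" where
  "day_unit = \<lparr>
     sp = \<lambda>n. \<lparr>topo = discrete_topology ((\<lambda>i. Z (int i)) ` {..n}),
       pt = Z 0,
       act = \<lambda>g. \<lambda>z\<in>(\<lambda>i. Z (int i)) ` {..n}. z\<rparr>,
     ind = \<lambda>m n \<phi>. \<lambda>z\<in>(\<lambda>i. Z (int i)) ` {..m}. Z (int (\<phi> (nat (the_Z z))))\<rparr>"

definition day_assoc ::
    "('g, 'x) monoid_scheme \<Rightarrow> ('g, 'a univ) FG_space \<Rightarrow> ('g, 'a univ) FG_space \<Rightarrow> ('g, 'a univ) FG_space
     \<Rightarrow> nat \<Rightarrow> 'a univ \<Rightarrow> 'a univ" where
  "day_assoc G X Y W = (THE \<theta>. \<theta> \<in> FG_maps G (day (day X Y) W) (day X (day Y W)) \<and>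
     (\<forall>m n p. \<forall>x\<in>points (sp X m). \<forall>y\<in>points (sp Y n). \<forall>w\<in>points (sp W p).
        \<theta> (m * n * p) (day_pair (day X Y) W (m * n) p (day_pair X Y m n x y) w)
        = day_pair X (day Y W) m (n * p) x (day_pair Y W n p y w)))"

text \<open>
  The unit constraints are induced by the maps \<open>n = 1 \<and> n \<rightarrow> m \<and> n\<close> and
  \<open>m = m \<and> 1 \<rightarrow> m \<and> n\<close> determined by elements of \<open>m\<close> and \<open>n\<close>.
\<close>

definition FG_spaces ::
    "('g, 'x) monoid_scheme \<Rightarrow> (('g, 'a univ) FG_space, nat \<Rightarrow> 'a univ \<Rightarrow> 'a univ) monoidal_structure" where
  "FG_spaces G = \<lparr>
     Obj = {X. is_FG_space G X},
     Hom = \<lambda>X Y. {\<theta> \<in> FG_maps G X Y. is_FG_space G X \<and> is_FG_space G Y},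
     Ident = \<lambda>X n. \<lambda>x\<in>points (sp X n). x,
     Comp = \<lambda>X \<theta> \<xi> n. compose (points (sp X n)) (\<theta> n) (\<xi> n),
     Tensor = day,
     TensorHom = \<lambda>X X' Y Y' \<theta> \<xi>.
       day_lift G X Y (day X' Y') (\<lambda>m n x y. day_pair X' Y' m n (\<theta> m x) (\<xi> n y)),
     Unit = day_unit,
     Assoc = day_assoc G,
     LUnit = \<lambda>X. day_lift G day_unit X X
       (\<lambda>m n i x. ind X n (m * n) (\<lambda>j\<in>{..n}. lex_pos n (nat (the_Z i)) j) x),
     RUnit = \<lambda>X. day_lift G X day_unit X
       (\<lambda>m n x j. ind X m (m * n) (\<lambda>i\<in>{..m}. lex_pos n i (nat (the_Z j))) x),
     Braid = \<lambda>X Y. day_lift G X Y (day Y X)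
       (\<lambda>m n x y. ind (day Y X) (n * m) (m * n) (F_twist n m) (day_pair Y X n m y x))\<rparr>"


section \<open>The functor R\<close>

definition powers :: "('g, 'a univ) G_group \<Rightarrow> nat \<Rightarrow> 'a univ set" where
  "powers A n = {Tup as | as. length as = n \<and> set as \<subseteq> carrier A}"

text \<open>The coordinates \<open>a\<^sub>1, \<dots>, a\<^sub>n\<close> of an element of \<open>A\<^sup>n\<close> are the list entries \<open>0, \<dots>, n - 1\<close>.\<close>

definition R_obj :: "('g, 'a univ) G_group \<Rightarrow> ('g, 'a univ) FG_space" where
  "R_obj A = \<lparr>
     sp = \<lambda>n. \<lparr>topo = discrete_topology (powers A n),
       pt = Tup (replicate n \<one>\<^bsub>A\<^esub>),
       act = \<lambda>g. \<lambda>a\<in>powers A n. Tup (map (gact A g) (entries a))\<rparr>,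
     ind = \<lambda>m n \<phi>. \<lambda>a\<in>powers A m.
       Tup (map (\<lambda>j. \<Otimes>\<^bsub>A\<^esub>i\<in>{i \<in> {1..m}. \<phi> i = j}. entries a ! (i - 1)) [1..<n + 1])\<rparr>"

definition R_hom ::
    "('g, 'a univ) G_group \<Rightarrow> ('g, 'a univ) G_group \<Rightarrow> ('a univ \<Rightarrow> 'a univ) \<Rightarrow> nat \<Rightarrow> 'a univ \<Rightarrow> 'a univ" where
  "R_hom A B f = (\<lambda>n. \<lambda>a\<in>powers A n. Tup (map f (entries a)))"

end

theory Submission
  imports Defs
begin

text \<open>
  All spaces in sight are discrete, so an \<open>F\<close>-\<open>G\<close>-space is here a functor from \<open>F\<close> to based
  \<open>G\<close>-sets, and the closed equivalence relation in the Day convolution is the generated one. By the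
  universal property of the Day convolution, a map \<open>RA \<and> RB \<rightarrow> R(A \<otimes> B)\<close> is a natural family of maps
  \<open>A\<^sup>m \<times> B\<^sup>n \<rightarrow> (A \<otimes> B)\<^sup>m\<^sup>n\<close>; it is given by \<open>(a\<^sub>i), (b\<^sub>j) \<mapsto> (a\<^sub>i \<otimes> b\<^sub>j)\<close> in lexicographic order, and
  bilinearity of \<open>\<otimes>\<close> gives naturality. The unit sends \<open>i \<in> n\<close> to the \<open>i\<close>-th standard basis vector
  of \<open>\<int>\<^sup>n\<close>. All coherence conditions can be checked on the generators \<open>x \<and> y\<close> and, coordinatewise, on
  pure tensors, where they are evident.
\<close>

section \<open>The category of finite based sets\<close>

text \<open>Every constraint and every tensor product of maps is a definite description over coded
  representatives, so none of them can be evaluated before existence and uniqueness are shown. For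
  the Day convolution this is done in two layers. \<open>F_set\<close> forgets the group and carries
  the whole universal property, because currying in the associativity constraint holds a point of
  \<open>W(p)\<close> that \<open>G\<close> need not fix; \<open>FG_set\<close> adds the action
  afterwards. Uniqueness on the generators \<open>day_pair\<close> then turns each coherence diagram
  into an identity of tuples, and existence evaluates both sides. What remains is combinatorics in
  F: a coordinate of an induced tuple is a product over a fibre, and the fibres met in the diagrams
  are products of two fibres, single points or empty. Groups being multiplicative, the sums in
  \<open>R\<close> appear as \<open>finprod\<close> and integer multiples as powers.\<close>

lemma F_maps_zero: "\<phi> \<in> F_maps m n \<Longrightarrow> \<phi> 0 = 0"
  by (simp add: F_maps_def)

lemma F_maps_le: "\<phi> \<in> F_maps m n \<Longrightarrow> i \<le> m \<Longrightarrow> \<phi> i \<le> n"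
  by (auto simp: F_maps_def)

lemma F_maps_eqI:
  assumes "\<phi> \<in> F_maps m n" "\<psi> \<in> F_maps m n'" "\<And>i. 0 < i \<Longrightarrow> i \<le> m \<Longrightarrow> \<phi> i = \<psi> i"
  shows "\<phi> = \<psi>"
proof (rule extensionalityI)
  show "\<phi> \<in> extensional {..m}" "\<psi> \<in> extensional {..m}"
    using assms by (auto simp: F_maps_def PiE_iff)
  show "\<phi> i = \<psi> i" if "i \<in> {..m}" for i
    using assms that F_maps_zero[OF assms(1)] F_maps_zero[OF assms(2)] by (cases "i = 0") auto
qed

lemma F_maps_id [simp]: "(\<lambda>i\<in>{..n}. i) \<in> F_maps n n"
  by (auto simp: F_maps_def)

lemma F_maps_null [simp]: "(\<lambda>i\<in>{..m}. 0) \<in> F_maps m n"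
  by (auto simp: F_maps_def)

lemma F_maps_null_zero [simp]: "(\<lambda>i\<in>{0}. 0) \<in> F_maps 0 n"
  using F_maps_null[of 0 n] by simp

lemma F_maps_compose:
  "\<phi> \<in> F_maps m n \<Longrightarrow> \<psi> \<in> F_maps n p \<Longrightarrow> compose {..m} \<psi> \<phi> \<in> F_maps m p"
  by (auto simp: F_maps_def compose_def PiE_iff)

text \<open>The set \<open>0\<close> is terminal in F, and by the next lemma also initial; every
  argument about basepoints rests on this.\<close>

lemma F_maps_to_zero: "\<phi> \<in> F_maps m 0 \<Longrightarrow> \<phi> = (\<lambda>i\<in>{..m}. 0)"
  by (rule F_maps_eqI[of _ m 0 _ 0]) (auto dest: F_maps_le)

lemma F_maps_from_zero: "\<phi> \<in> F_maps 0 n \<Longrightarrow> \<phi> = (\<lambda>i\<in>{..0}. 0)"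
  by (erule F_maps_eqI[OF _ F_maps_null]) auto

lemma compose_id_F_maps: "\<phi> \<in> F_maps m n \<Longrightarrow> compose {..m} (\<lambda>i\<in>{..n}. i) \<phi> = \<phi>"
  by (rule F_maps_eqI[OF F_maps_compose[OF _ F_maps_id]]) (auto simp: compose_def dest: F_maps_le)

lemma F_maps_compose_id: "\<phi> \<in> F_maps m n \<Longrightarrow> compose {..m} \<phi> (\<lambda>i\<in>{..m}. i) = \<phi>"
  by (rule F_maps_eqI[OF F_maps_compose[OF F_maps_id]]) (auto simp: compose_def)

lemma F_maps_compose_assoc:
  "\<phi> \<in> F_maps m n \<Longrightarrow> compose {..m} \<rho> (compose {..m} \<psi> \<phi>) = compose {..m} (compose {..n} \<rho> \<psi>) \<phi>"
  by (rule compose_assoc) (auto simp: F_maps_def)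

subsection \<open>The lexicographic order\<close>

lemma lex_pos_zero [simp]: "lex_pos n 0 j = 0" "lex_pos n i 0 = 0"
  by (simp_all add: lex_pos_def)

lemma lex_pos_le:
  assumes "i \<le> m" "j \<le> n"
  shows "lex_pos n i j \<le> m * n"
proof (cases "i = 0 \<or> j = 0")
  case False
  then have "(i - 1) * n + j \<le> (i - 1) * n + n" using assms by simp
  also have "\<dots> = i * n" using False by (cases i) auto
  also have "\<dots> \<le> m * n" using assms by simp
  finally show ?thesis using False by (simp add: lex_pos_def)
qed auto

lemma lex_row_pos: "0 < i \<Longrightarrow> 0 < j \<Longrightarrow> j \<le> n \<Longrightarrow> lex_row n (lex_pos n i j) = i"
  by (cases j; cases i) (auto simp: lex_row_def lex_pos_def div_add1_eq)

lemma lex_col_pos: "0 < i \<Longrightarrow> 0 < j \<Longrightarrow> j \<le> n \<Longrightarrow> lex_col n (lex_pos n i j) = j"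
  by (cases j; cases i) (auto simp: lex_col_def lex_pos_def)

lemma lex_pos_eq_zero_iff [simp]: "lex_pos n i j = 0 \<longleftrightarrow> i = 0 \<or> j = 0"
  by (auto simp: lex_pos_def)

lemma lex_pos_pos_iff [simp]: "0 < lex_pos n i j \<longleftrightarrow> 0 < i \<and> 0 < j"
  using lex_pos_eq_zero_iff[of n i j] by linarith

lemma lex_row_bounds: "0 < k \<Longrightarrow> k \<le> m * n \<Longrightarrow> 0 < lex_row n k \<and> lex_row n k \<le> m"
  by (cases k) (auto simp: lex_row_def less_mult_imp_div_less Suc_le_eq)

lemma lex_col_bounds: "0 < k \<Longrightarrow> k \<le> m * n \<Longrightarrow> 0 < lex_col n k \<and> lex_col n k \<le> n"
  by (cases n) (auto simp: lex_col_def Suc_le_eq)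

lemma lex_pos_row_col: "0 < k \<Longrightarrow> lex_pos n (lex_row n k) (lex_col n k) = k"
  by (cases k) (auto simp: lex_row_def lex_col_def lex_pos_def)

text \<open>The position on the left is nonzero, so equality forces \<open>i'\<close> and
  \<open>j'\<close> to be nonzero too, and \<open>lex_row\<close> and \<open>lex_col\<close> then
  read back the coordinates of both sides.\<close>

lemma lex_pos_eq_iff:
  assumes "0 < i" "0 < j" "j \<le> n" "j' \<le> n"
  shows "lex_pos n i j = lex_pos n i' j' \<longleftrightarrow> i = i' \<and> j = j'"
  using assms lex_row_pos[of i j n] lex_row_pos[of i' j' n] lex_col_pos[of i j n] lex_col_pos[of i' j' n]
  by (metis lex_pos_eq_zero_iff neq0_conv)

text \<open>The smash product of F is strictly associative: both bracketings give a triple the same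
  lexicographic position. For this reason the associativity constraints below involve no reindexing
  map, only \<open>mult.assoc\<close>.\<close>

lemma lex_pos_assoc:
  assumes "j \<le> n" "k \<le> p"
  shows "lex_pos p (lex_pos n i j) k = lex_pos (n * p) i (lex_pos p j k)"
proof (cases "i = 0 \<or> j = 0 \<or> k = 0")
  case False
  then obtain i' j' k' where "i = Suc i'" "j = Suc j'" "k = Suc k'"
    by (metis not0_implies_Suc)
  then show ?thesis by (simp add: lex_pos_def algebra_simps)
qed auto

text \<open>Every nonzero element of a smash product is the position of a pair of nonzero
  coordinates, so based maps out of it are tested on such pairs.\<close>

lemma F_maps_lex_eqI:
  assumes "\<phi> \<in> F_maps (m * n) p" "\<psi> \<in> F_maps (m * n) p'"
    and "\<And>i j. 0 < i \<Longrightarrow> i \<le> m \<Longrightarrow> 0 < j \<Longrightarrow> j \<le> n \<Longrightarrow> \<phi> (lex_pos n i j) = \<psi> (lex_pos n i j)"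
  shows "\<phi> = \<psi>"
  using assms(1,2)
proof (rule F_maps_eqI)
  fix k assume "0 < k" "k \<le> m * n"
  then show "\<phi> k = \<psi> k"
    using assms(3)[of "lex_row n k" "lex_col n k"]
    by (simp add: lex_row_bounds lex_col_bounds lex_pos_row_col)
qed

section \<open>Smash products of based maps\<close>

lemma F_smash_lex_pos:
  assumes "\<phi> \<in> F_maps m m'" "\<psi> \<in> F_maps n n'" "i \<le> m" "j \<le> n"
  shows "F_smash m n n' \<phi> \<psi> (lex_pos n i j) = lex_pos n' (\<phi> i) (\<psi> j)"
  using assms F_maps_zero[OF assms(1)] F_maps_zero[OF assms(2)]
  by (auto simp: F_smash_def lex_pos_le lex_row_pos lex_col_pos)

lemma F_smash_F_maps:
  assumes "\<phi> \<in> F_maps m m'" "\<psi> \<in> F_maps n n'"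
  shows "F_smash m n n' \<phi> \<psi> \<in> F_maps (m * n) (m' * n')"
  using assms unfolding F_smash_def
  by (auto simp: F_maps_def[of "m * n"] F_maps_le lex_row_bounds lex_col_bounds intro!: lex_pos_le)

lemma F_smash_id: "F_smash m n n (\<lambda>i\<in>{..m}. i) (\<lambda>i\<in>{..n}. i) = (\<lambda>k\<in>{..m * n}. k)"
  by (rule F_maps_lex_eqI[OF F_smash_F_maps[OF F_maps_id F_maps_id] F_maps_id])
    (simp add: F_smash_lex_pos[OF F_maps_id F_maps_id] lex_pos_le)

lemma F_smash_compose:
  assumes "\<phi> \<in> F_maps m m'" "\<psi> \<in> F_maps n n'" "\<phi>' \<in> F_maps m' m''" "\<psi>' \<in> F_maps n' n''"
  shows "compose {..m * n} (F_smash m' n' n'' \<phi>' \<psi>') (F_smash m n n' \<phi> \<psi>)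
       = F_smash m n n'' (compose {..m} \<phi>' \<phi>) (compose {..n} \<psi>' \<psi>)"
proof (rule F_maps_lex_eqI[OF F_maps_compose F_smash_F_maps])
  show "F_smash m n n' \<phi> \<psi> \<in> F_maps (m * n) (m' * n')"
    "F_smash m' n' n'' \<phi>' \<psi>' \<in> F_maps (m' * n') (m'' * n'')"
    "compose {..m} \<phi>' \<phi> \<in> F_maps m m''" "compose {..n} \<psi>' \<psi> \<in> F_maps n n''"
    using assms by (auto intro: F_smash_F_maps F_maps_compose)
  fix i j assume ij: "0 < i" "i \<le> m" "0 < j" "j \<le> n"
  then have le: "\<phi> i \<le> m'" "\<psi> j \<le> n'"
    using assms by (auto dest: F_maps_le)
  have c: "compose {..m} \<phi>' \<phi> \<in> F_maps m m''" "compose {..n} \<psi>' \<psi> \<in> F_maps n n''"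
    using assms by (auto intro: F_maps_compose)
  show "compose {..m * n} (F_smash m' n' n'' \<phi>' \<psi>') (F_smash m n n' \<phi> \<psi>) (lex_pos n i j)
      = F_smash m n n'' (compose {..m} \<phi>' \<phi>) (compose {..n} \<psi>' \<psi>) (lex_pos n i j)"
    using ij le lex_pos_le[of i m j n]
    by (simp add: compose_eq F_smash_lex_pos[OF assms(1,2)] F_smash_lex_pos[OF assms(3,4)] F_smash_lex_pos[OF c])
qed

lemma F_smash_assoc:
  assumes "\<phi> \<in> F_maps m m'" "\<psi> \<in> F_maps n n'" "\<rho> \<in> F_maps p p'"
  shows "F_smash (m * n) p p' (F_smash m n n' \<phi> \<psi>) \<rho> = F_smash m (n * p) (n' * p') \<phi> (F_smash n p p' \<psi> \<rho>)"
proof (rule F_maps_lex_eqI[OF F_smash_F_maps])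
  have s: "F_smash m n n' \<phi> \<psi> \<in> F_maps (m * n) (m' * n')" "F_smash n p p' \<psi> \<rho> \<in> F_maps (n * p) (n' * p')"
    using assms by (auto intro: F_smash_F_maps)
  then show "F_smash m n n' \<phi> \<psi> \<in> F_maps (m * n) (m' * n')" by simp
  show "\<rho> \<in> F_maps p p'" by fact
  show "F_smash m (n * p) (n' * p') \<phi> (F_smash n p p' \<psi> \<rho>) \<in> F_maps (m * n * p) (m' * (n' * p'))"
    using F_smash_F_maps[OF assms(1) s(2)] by (simp add: mult.assoc)
  fix l k assume l: "0 < l" "l \<le> m * n" and k: "0 < k" "k \<le> p"
  define i j where "i = lex_row n l" and "j = lex_col n l"
  have ij: "i \<le> m" "j \<le> n" and l_eq: "l = lex_pos n i j"
    using l by (auto simp: i_def j_def lex_row_bounds lex_col_bounds lex_pos_row_col)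
  have "F_smash (m * n) p p' (F_smash m n n' \<phi> \<psi>) \<rho> (lex_pos p l k) = lex_pos p' (lex_pos n' (\<phi> i) (\<psi> j)) (\<rho> k)"
    using ij l k by (simp add: F_smash_lex_pos[OF s(1) assms(3)])
      (simp add: l_eq F_smash_lex_pos[OF assms(1,2)])
  also have "\<dots> = lex_pos (n' * p') (\<phi> i) (lex_pos p' (\<psi> j) (\<rho> k))"
    using assms ij k by (intro lex_pos_assoc) (auto dest: F_maps_le)
  also have "\<dots> = F_smash m (n * p) (n' * p') \<phi> (F_smash n p p' \<psi> \<rho>) (lex_pos (n * p) i (lex_pos p j k))"
    using ij k by (simp add: F_smash_lex_pos[OF assms(1) s(2)] F_smash_lex_pos[OF assms(2,3)] lex_pos_le)
  also have "lex_pos (n * p) i (lex_pos p j k) = lex_pos p l k"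
    using ij k by (simp add: l_eq lex_pos_assoc)
  finally show "F_smash (m * n) p p' (F_smash m n n' \<phi> \<psi>) \<rho> (lex_pos p l k)
    = F_smash m (n * p) (n' * p') \<phi> (F_smash n p p' \<psi> \<rho>) (lex_pos p l k)" .
qed

section \<open>The symmetry of the smash product\<close>

lemma F_twist_lex_pos: "i \<le> m \<Longrightarrow> j \<le> n \<Longrightarrow> F_twist m n (lex_pos n i j) = lex_pos m j i"
  by (auto simp: F_twist_def lex_pos_le lex_row_pos lex_col_pos)

lemma F_twist_F_maps: "F_twist m n \<in> F_maps (m * n) (n * m)"
  unfolding F_twist_def
  by (auto simp: F_maps_def intro!: lex_pos_le dest: lex_row_bounds lex_col_bounds)

lemma F_twist_natural:
  assumes "\<phi> \<in> F_maps m m'" "\<psi> \<in> F_maps n n'"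
  shows "compose {..m * n} (F_twist m' n') (F_smash m n n' \<phi> \<psi>)
       = compose {..m * n} (F_smash n m m' \<psi> \<phi>) (F_twist m n)"
proof (rule F_maps_lex_eqI[OF F_maps_compose F_maps_compose])
  show "F_smash m n n' \<phi> \<psi> \<in> F_maps (m * n) (m' * n')" "F_smash n m m' \<psi> \<phi> \<in> F_maps (n * m) (n' * m')"
    "F_twist m' n' \<in> F_maps (m' * n') (n' * m')" "F_twist m n \<in> F_maps (m * n) (n * m)"
    using assms by (auto intro: F_smash_F_maps F_twist_F_maps)
  fix i j assume ij: "0 < i" "i \<le> m" "0 < j" "j \<le> n"
  then have le: "\<phi> i \<le> m'" "\<psi> j \<le> n'"
    using assms by (auto dest: F_maps_le)
  show "compose {..m * n} (F_twist m' n') (F_smash m n n' \<phi> \<psi>) (lex_pos n i j)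
      = compose {..m * n} (F_smash n m m' \<psi> \<phi>) (F_twist m n) (lex_pos n i j)"
    using ij le lex_pos_le[of i m j n]
    by (simp add: compose_eq F_smash_lex_pos[OF assms] F_smash_lex_pos[OF assms(2,1)] F_twist_lex_pos)
qed

section \<open>Discrete spaces\<close>

lemma topspace_cg_topology [simp]: "topspace (cg_topology X) = topspace X"
proof -
  have "cg_open X (topspace X)"
    by (auto simp: cg_open_def compactin_subset_topspace Int_absorb2 openin_subtopology_refl)
  then show ?thesis
    by (metis cg_open_def openin_cg_topology openin_subset openin_topspace subset_antisym)
qed

lemma cg_topology_discrete [simp]: "cg_topology (discrete_topology U) = discrete_topology U"
  by (auto simp: topology_eq openin_cg_topology cg_open_def)

text \<open>A single point of the product is an open rectangle, so the product topology is already
  discrete and passing to the compactly generated topology changes nothing.\<close>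

lemma cg_prod_discrete [simp]:
  "cg_prod (discrete_topology U) (discrete_topology V) = discrete_topology (U \<times> V)"
proof -
  have "openin (prod_topology (discrete_topology U) (discrete_topology V)) W" if "W \<subseteq> U \<times> V" for W
    unfolding openin_prod_topology_alt
  proof (intro allI impI)
    fix x y assume "(x, y) \<in> W"
    with that show "\<exists>A B. openin (discrete_topology U) A \<and> openin (discrete_topology V) B
        \<and> x \<in> A \<and> y \<in> B \<and> A \<times> B \<subseteq> W"
      by (intro exI[of _ "{x}"] exI[of _ "{y}"]) auto
  qed
  then have "prod_topology (discrete_topology U) (discrete_topology V) = discrete_topology (U \<times> V)"
    by (auto simp: topology_eq dest!: openin_subset)
  then show ?thesis by (simp add: cg_prod_def)
qed

lemma cgwh_space_discrete: "cgwh_space (discrete_topology U)"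
  by (auto simp: cgwh_space_def weak_Hausdorff_space_def continuous_map_def)

section \<open>Discrete F-G-spaces\<close>

text \<open>Bijectivity comes for free, with \<open>f (inv g)\<close> as two-sided inverse of
  \<open>f g\<close>. Extensionality is demanded because the elements of \<open>BijGroup E\<close>
  are extensional functions.\<close>

lemma group_actionI:
  assumes "group G"
    and "\<And>g. g \<in> carrier G \<Longrightarrow> f g \<in> extensional E"
    and closed: "\<And>g x. g \<in> carrier G \<Longrightarrow> x \<in> E \<Longrightarrow> f g x \<in> E"
    and one: "\<And>x. x \<in> E \<Longrightarrow> f \<one>\<^bsub>G\<^esub> x = x"
    and mult: "\<And>g h x. g \<in> carrier G \<Longrightarrow> h \<in> carrier G \<Longrightarrow> x \<in> E \<Longrightarrow> f (g \<otimes>\<^bsub>G\<^esub> h) x = f g (f h x)"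
  shows "group_action G E f"
proof -
  interpret group G by fact
  have "bij_betw (f g) E E" if "g \<in> carrier G" for g
    using that one closed mult[of "inv\<^bsub>G\<^esub> g" g] mult[of g "inv\<^bsub>G\<^esub> g"]
    by (intro bij_betw_byWitness[where f' = "f (inv\<^bsub>G\<^esub> g)"]) auto
  then have Bij: "f g \<in> Bij E" if "g \<in> carrier G" for g
    using that assms(2) by (auto simp: Bij_def)
  have "f (g \<otimes>\<^bsub>G\<^esub> h) = compose E (f g) (f h)" if "g \<in> carrier G" "h \<in> carrier G" for g h
    using that assms(2) mult by (intro extensionalityI[of _ E]) (auto simp: compose_def)
  then have "f \<in> hom G (BijGroup E)"
    using Bij by (auto simp: hom_def BijGroup_def)
  then show ?thesis
    unfolding group_action_def group_hom_def group_hom_axioms_def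
    using assms(1) group_BijGroup by blast
qed

locale F_set =
  fixes X :: "('g, 'u) FG_space"
  assumes discrete: "topo (sp X n) = discrete_topology (points (sp X n))"
    and pt_closed: "pt (sp X n) \<in> points (sp X n)"
    and points_zero: "points (sp X 0) = {pt (sp X 0)}"
    and ind_PiE: "\<phi> \<in> F_maps m n \<Longrightarrow> ind X m n \<phi> \<in> points (sp X m) \<rightarrow>\<^sub>E points (sp X n)"
    and ind_pt: "\<phi> \<in> F_maps m n \<Longrightarrow> ind X m n \<phi> (pt (sp X m)) = pt (sp X n)"
    and ind_id: "x \<in> points (sp X n) \<Longrightarrow> ind X n n (\<lambda>i\<in>{..n}. i) x = x"
    and ind_compose: "\<phi> \<in> F_maps m n \<Longrightarrow> \<psi> \<in> F_maps n p \<Longrightarrow> x \<in> points (sp X m)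
      \<Longrightarrow> ind X m p (compose {..m} \<psi> \<phi>) x = ind X n p \<psi> (ind X m n \<phi> x)"
begin

lemma ind_closed: "\<phi> \<in> F_maps m n \<Longrightarrow> x \<in> points (sp X m) \<Longrightarrow> ind X m n \<phi> x \<in> points (sp X n)"
  using ind_PiE by blast

end

locale FG_set = F_set X + group G for G :: "('g, 'x) monoid_scheme" and X :: "('g, 'u) FG_space" +
  assumes act_extensional: "g \<in> carrier G \<Longrightarrow> act (sp X n) g \<in> extensional (points (sp X n))"
    and act_closed: "g \<in> carrier G \<Longrightarrow> x \<in> points (sp X n) \<Longrightarrow> act (sp X n) g x \<in> points (sp X n)"
    and act_one: "x \<in> points (sp X n) \<Longrightarrow> act (sp X n) \<one>\<^bsub>G\<^esub> x = x"
    and act_mult: "g \<in> carrier G \<Longrightarrow> h \<in> carrier G \<Longrightarrow> x \<in> points (sp X n)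
      \<Longrightarrow> act (sp X n) (g \<otimes>\<^bsub>G\<^esub> h) x = act (sp X n) g (act (sp X n) h x)"
    and act_ind: "g \<in> carrier G \<Longrightarrow> \<phi> \<in> F_maps m n \<Longrightarrow> x \<in> points (sp X m)
      \<Longrightarrow> act (sp X n) g (ind X m n \<phi> x) = ind X m n \<phi> (act (sp X m) g x)"
begin

text \<open>Maps commuting with the induced maps are automatically based, because the basepoint of
  \<open>X(n)\<close> is the image of the only point of \<open>X(0)\<close>.\<close>

lemma act_pt:
  assumes "g \<in> carrier G"
  shows "act (sp X n) g (pt (sp X n)) = pt (sp X n)"
proof -
  let ?z = "\<lambda>i\<in>{..0}. 0"
  have "act (sp X 0) g (pt (sp X 0)) = pt (sp X 0)"
    using act_closed[OF assms, of _ 0] pt_closed[of 0] points_zero by blast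
  then show ?thesis
    using act_ind[OF assms, of ?z 0 n "pt (sp X 0)"] pt_closed[of 0] ind_pt[of ?z 0 n]
    by simp
qed

text \<open>Act by the inverse of \<open>g\<close>. The lemma makes the function that separates the
  basepoint from all other points invariant, as the NDR data below require.\<close>

lemma act_eq_pt_iff:
  assumes "g \<in> carrier G" "x \<in> points (sp X n)"
  shows "act (sp X n) g x = pt (sp X n) \<longleftrightarrow> x = pt (sp X n)"
proof
  assume "act (sp X n) g x = pt (sp X n)"
  then have "act (sp X n) (inv\<^bsub>G\<^esub> g \<otimes>\<^bsub>G\<^esub> g) x = pt (sp X n)"
    using assms by (subst act_mult) (auto simp: act_pt)
  then show "x = pt (sp X n)" using assms act_one[of x n] by simp
qed (use assms act_pt in auto)

lemma is_FG_space: "is_FG_space G X"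
  unfolding is_FG_space_def
proof (intro conjI allI ballI)
  fix n
  show "based_G_space G (sp X n)"
    unfolding based_G_space_def
  proof (intro conjI ballI)
    show "cgwh_space (topo (sp X n))" by (subst discrete) (rule cgwh_space_discrete)
    show "group_action G (points (sp X n)) (act (sp X n))"
      by (rule group_actionI) (auto simp: act_extensional act_closed act_one act_mult)
    show "continuous_map (topo (sp X n)) (topo (sp X n)) (act (sp X n) g)" if "g \<in> carrier G" for g
      using that by (subst discrete) (auto simp: act_closed)
  qed (auto simp: pt_closed act_pt)
  show "nondegenerate G (sp X n)"
    unfolding nondegenerate_def
  proof (intro exI conjI)
    \<comment> \<open>The basepoint is isolated, so \<open>u\<close> may jump from 0 to 1 away from
      it. Then \<open>u x < 1\<close> holds at the basepoint only, and the constant homotopy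
      \<open>fst\<close> suffices.\<close>
    show "continuous_map (topo (sp X n)) (top_of_set {0..1}) (\<lambda>x. if x = pt (sp X n) then 0 else 1 :: real)"
      by (subst discrete) auto
    show "continuous_map (prod_topology (topo (sp X n)) (top_of_set {0..1})) (topo (sp X n)) fst"
      by (rule continuous_map_fst)
  qed (auto simp: act_eq_pt_iff split: if_splits)
next
  fix m n \<phi> assume \<phi>: "\<phi> \<in> F_maps m n"
  show "ind X m n \<phi> \<in> G_maps G (sp X m) (sp X n)"
  proof -
    have "continuous_map (topo (sp X m)) (topo (sp X n)) (ind X m n \<phi>)"
      using ind_PiE[OF \<phi>] by (subst discrete) auto
    then show ?thesis
      using ind_PiE[OF \<phi>] \<phi> by (auto simp: G_maps_def ind_pt act_ind PiE_iff)
  qed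
next
  fix n
  show "ind X n n (\<lambda>i\<in>{..n}. i) = (\<lambda>x\<in>points (sp X n). x)"
    using ind_PiE[of "\<lambda>i\<in>{..n}. i" n n]
    by (intro extensionalityI[of _ "points (sp X n)"]) (auto simp: ind_id PiE_iff)
next
  fix m n p \<phi> \<psi> assume \<phi>: "\<phi> \<in> F_maps m n" and \<psi>: "\<psi> \<in> F_maps n p"
  show "ind X m p (compose {..m} \<psi> \<phi>) = compose (points (sp X m)) (ind X n p \<psi>) (ind X m n \<phi>)"
    using ind_PiE[OF F_maps_compose[OF \<phi> \<psi>]]
    by (intro extensionalityI[of _ "points (sp X m)"]) (auto simp: ind_compose[OF \<phi> \<psi>] PiE_iff compose_eq)
qed (rule points_zero)

end

lemma FG_set_imp_F_set: "FG_set G X \<Longrightarrow> F_set X"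
  by (simp add: FG_set_def)

subsection \<open>Natural maps\<close>

text \<open>The maps of the nonequivariant layer. Extensionality is built in so that maps agreeing
  on all points are equal.\<close>

definition F_nat :: "('g, 'u) FG_space \<Rightarrow> ('g, 'u) FG_space \<Rightarrow> (nat \<Rightarrow> 'u \<Rightarrow> 'u) set" where
  "F_nat X Y = {\<theta>. (\<forall>n. \<theta> n \<in> points (sp X n) \<rightarrow>\<^sub>E points (sp Y n)) \<and>
     (\<forall>m n. \<forall>\<phi>\<in>F_maps m n. \<forall>x\<in>points (sp X m). \<theta> n (ind X m n \<phi> x) = ind Y m n \<phi> (\<theta> m x))}"

definition equivariant ::
    "('g, 'x) monoid_scheme \<Rightarrow> ('g, 'u) FG_space \<Rightarrow> ('g, 'u) FG_space \<Rightarrow> (nat \<Rightarrow> 'u \<Rightarrow> 'u) \<Rightarrow> bool" where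
  "equivariant G X Y \<theta> \<longleftrightarrow> (\<forall>n. \<forall>g\<in>carrier G. \<forall>x\<in>points (sp X n). \<theta> n (act (sp X n) g x) = act (sp Y n) g (\<theta> n x))"

lemma F_nat_closed: "\<theta> \<in> F_nat X Y \<Longrightarrow> x \<in> points (sp X n) \<Longrightarrow> \<theta> n x \<in> points (sp Y n)"
  by (auto simp: F_nat_def)

lemma F_nat_ind: "\<theta> \<in> F_nat X Y \<Longrightarrow> \<phi> \<in> F_maps m n \<Longrightarrow> x \<in> points (sp X m)
    \<Longrightarrow> \<theta> n (ind X m n \<phi> x) = ind Y m n \<phi> (\<theta> m x)"
  by (auto simp: F_nat_def)

lemma F_nat_pt:
  assumes "F_set X" "F_set Y" "\<theta> \<in> F_nat X Y"
  shows "\<theta> n (pt (sp X n)) = pt (sp Y n)"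
proof -
  let ?z = "\<lambda>i\<in>{..0}. 0"
  have "\<theta> 0 (pt (sp X 0)) = pt (sp Y 0)"
    using F_nat_closed[OF assms(3), of _ 0] assms F_set.points_zero F_set.pt_closed by blast
  then show ?thesis
    using F_nat_ind[OF assms(3), of ?z 0 n "pt (sp X 0)"]
      F_set.pt_closed[OF assms(1)] F_set.ind_pt[of X ?z 0 n] F_set.ind_pt[of Y ?z 0 n] assms by simp
qed

text \<open>Continuity is automatic on discrete spaces and preservation of basepoints follows from
  naturality by \<open>F_nat_pt\<close>; only naturality and equivariance are left to check.\<close>

lemma FG_maps_iff:
  assumes "F_set X" "F_set Y"
  shows "\<theta> \<in> FG_maps G X Y \<longleftrightarrow> \<theta> \<in> F_nat X Y \<and> equivariant G X Y \<theta>"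
proof
  assume "\<theta> \<in> FG_maps G X Y"
  then show "\<theta> \<in> F_nat X Y \<and> equivariant G X Y \<theta>"
    by (auto simp: FG_maps_def F_nat_def G_maps_def equivariant_def PiE_iff continuous_map_def)
next
  assume R: "\<theta> \<in> F_nat X Y \<and> equivariant G X Y \<theta>"
  then have "continuous_map (topo (sp X n)) (topo (sp Y n)) (\<theta> n)" for n
    by (subst F_set.discrete[OF assms(1)]) (auto dest: F_nat_closed)
  then show "\<theta> \<in> FG_maps G X Y"
    using R F_nat_pt[OF assms]
    by (auto simp: FG_maps_def F_nat_def G_maps_def equivariant_def PiE_iff)
qed

definition F_compose :: "('g, 'u) FG_space \<Rightarrow> (nat \<Rightarrow> 'u \<Rightarrow> 'u) \<Rightarrow> (nat \<Rightarrow> 'u \<Rightarrow> 'u) \<Rightarrow> nat \<Rightarrow> 'u \<Rightarrow> 'u" where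
  "F_compose X \<theta> \<xi> = (\<lambda>n. compose (points (sp X n)) (\<theta> n) (\<xi> n))"

definition F_ident :: "('g, 'u) FG_space \<Rightarrow> nat \<Rightarrow> 'u \<Rightarrow> 'u" where
  "F_ident X = (\<lambda>n. \<lambda>x\<in>points (sp X n). x)"

lemma F_compose_apply [simp]: "x \<in> points (sp X n) \<Longrightarrow> F_compose X \<theta> \<xi> n x = \<theta> n (\<xi> n x)"
  by (simp add: F_compose_def compose_def)

lemma F_ident_apply [simp]: "x \<in> points (sp X n) \<Longrightarrow> F_ident X n x = x"
  by (simp add: F_ident_def)

lemma F_compose_F_nat: "\<xi> \<in> F_nat X Y \<Longrightarrow> \<theta> \<in> F_nat Y W \<Longrightarrow> F_set X \<Longrightarrow> F_compose X \<theta> \<xi> \<in> F_nat X W"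
  by (auto simp: F_nat_def F_compose_def compose_def F_set.ind_closed PiE_iff)

lemma F_ident_F_nat: "F_set X \<Longrightarrow> F_ident X \<in> F_nat X X"
  by (auto simp: F_nat_def F_ident_def F_set.ind_closed)

lemma F_nat_eqI:
  assumes "\<theta> \<in> F_nat X Y" "\<xi> \<in> F_nat X W" "\<And>n x. x \<in> points (sp X n) \<Longrightarrow> \<theta> n x = \<xi> n x"
  shows "\<theta> = \<xi>"
proof
  fix n show "\<theta> n = \<xi> n"
    using assms by (intro extensionalityI[of _ "points (sp X n)"]) (auto simp: F_nat_def PiE_iff)
qed

section \<open>Day convolution of discrete F-G-spaces\<close>

lemma closed_equiv_hull_discrete:
  "closed_equiv_hull (discrete_topology U) R0 = \<Inter>{R. equiv U R \<and> R0 \<subseteq> R}"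
  by (auto simp: closed_equiv_hull_def equiv_def)

lemma equiv_kernel: "equiv U {(s, t) \<in> U \<times> U. F s = F t}"
  by (auto simp: equiv_def refl_on_def sym_def trans_def)

lemma equiv_closed_equiv_hull:
  assumes "R0 \<subseteq> U \<times> U"
  shows "equiv U (closed_equiv_hull (discrete_topology U) R0)"
proof -
  \<comment> \<open>The total relation belongs to the family that is intersected. This is where
    \<open>R0 \<subseteq> U \<times> U\<close> enters: without a member of the family, the
    intersection would be the whole type.\<close>
  have "equiv U (U \<times> U)" by (auto simp: equiv_def refl_on_def sym_def trans_def)
  then have "closed_equiv_hull (discrete_topology U) R0 \<subseteq> U \<times> U"
    using assms by (auto simp: closed_equiv_hull_discrete)
  moreover have "refl_on U (\<Inter>{R. equiv U R \<and> R0 \<subseteq> R})"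
    unfolding equiv_def refl_on_def by blast
  moreover have "sym (\<Inter>{R. equiv U R \<and> R0 \<subseteq> R})"
    unfolding equiv_def sym_def by blast
  moreover have "trans (\<Inter>{R. equiv U R \<and> R0 \<subseteq> R})"
    unfolding equiv_def trans_def by blast
  ultimately show ?thesis by (simp add: closed_equiv_hull_discrete equiv_def)
qed

lemma subset_closed_equiv_hull: "R0 \<subseteq> closed_equiv_hull S R0"
  by (auto simp: closed_equiv_hull_def)

text \<open>The kernel of \<open>F\<close> is one of the relations in the intersection. This
  replaces an induction along chains of elementary relations.\<close>

lemma closed_equiv_hull_respects:
  assumes "R0 \<subseteq> U \<times> U" "\<And>s t. (s, t) \<in> R0 \<Longrightarrow> F s = F t"
    and "(s, t) \<in> closed_equiv_hull (discrete_topology U) R0"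
  shows "F s = F t"
proof -
  have "R0 \<subseteq> {(s, t) \<in> U \<times> U. F s = F t}" using assms by auto
  then have "(s, t) \<in> {(s, t) \<in> U \<times> U. F s = F t}"
    using assms(3) equiv_kernel unfolding closed_equiv_hull_discrete by blast
  then show ?thesis by simp
qed

lemma topspace_quotient_topology [simp]: "topspace (quotient_topology S q) = q ` topspace S"
proof
  show "topspace (quotient_topology S q) \<subseteq> q ` topspace S"
    using openin_topspace[of "quotient_topology S q"] by (simp only: openin_quotient_topology)
  have "{t \<in> topspace S. q t \<in> q ` topspace S} = topspace S" by auto
  then have "openin (quotient_topology S q) (q ` topspace S)"
    by (simp add: openin_quotient_topology)
  then show "q ` topspace S \<subseteq> topspace (quotient_topology S q)"
    by (rule openin_subset)
qed

lemma day_dom_iff: "((m, n, \<phi>), (x, y)) \<in> topspace (day_presum X Y p) \<longleftrightarrow>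
    \<phi> \<in> F_maps (m * n) p \<and> x \<in> points (sp X m) \<and> y \<in> points (sp Y n)"
  by (auto simp: day_presum_def cg_prod_def)

lemma day_presum_discrete:
  assumes "F_set X" "F_set Y"
  shows "day_presum X Y p = discrete_topology (topspace (day_presum X Y p))"
proof -
  have "cg_prod (topo (sp X m)) (topo (sp Y n)) = discrete_topology (points (sp X m) \<times> points (sp Y n))" for m n
    by (subst F_set.discrete[OF assms(1)], subst F_set.discrete[OF assms(2)]) simp
  then show ?thesis
    by (subst eq_commute, subst discrete_topology_unique)
      (auto simp: day_presum_def openin_sum_topology)
qed

text \<open>Transformations of functors on F \<times> F, the data that correspond to maps out of the
  Day convolution. No condition at basepoints is imposed: a point of the wedge comes from
  \<open>X(0)\<close> or \<open>Y(0)\<close>, so its image comes from \<open>W(0)\<close>, which is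
  a point for every \<open>F_set\<close>.\<close>

definition natural_family ::
    "('g, 'u) FG_space \<Rightarrow> ('g, 'u) FG_space \<Rightarrow> ('g, 'u) FG_space \<Rightarrow> (nat \<Rightarrow> nat \<Rightarrow> 'u \<Rightarrow> 'u \<Rightarrow> 'u) \<Rightarrow> bool" where
  "natural_family X Y W f \<longleftrightarrow>
     (\<forall>m n. \<forall>x\<in>points (sp X m). \<forall>y\<in>points (sp Y n). f m n x y \<in> points (sp W (m * n))) \<and>
     (\<forall>m m' n n'. \<forall>\<phi>\<in>F_maps m m'. \<forall>\<psi>\<in>F_maps n n'. \<forall>x\<in>points (sp X m). \<forall>y\<in>points (sp Y n).
        f m' n' (ind X m m' \<phi> x) (ind Y n n' \<psi> y)
        = ind W (m * n) (m' * n') (F_smash m n n' \<phi> \<psi>) (f m n x y))"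

lemma natural_familyI:
  assumes "\<And>m n x y. x \<in> points (sp X m) \<Longrightarrow> y \<in> points (sp Y n) \<Longrightarrow> f m n x y \<in> points (sp W (m * n))"
    and "\<And>m m' n n' \<phi> \<psi> x y. \<phi> \<in> F_maps m m' \<Longrightarrow> \<psi> \<in> F_maps n n' \<Longrightarrow> x \<in> points (sp X m) \<Longrightarrow> y \<in> points (sp Y n)
      \<Longrightarrow> f m' n' (ind X m m' \<phi> x) (ind Y n n' \<psi> y)
        = ind W (m * n) (m' * n') (F_smash m n n' \<phi> \<psi>) (f m n x y)"
  shows "natural_family X Y W f"
  using assms by (auto simp: natural_family_def)

definition equivariant_family ::
    "('g, 'x) monoid_scheme \<Rightarrow> ('g, 'u) FG_space \<Rightarrow> ('g, 'u) FG_space \<Rightarrow> ('g, 'u) FG_space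
     \<Rightarrow> (nat \<Rightarrow> nat \<Rightarrow> 'u \<Rightarrow> 'u \<Rightarrow> 'u) \<Rightarrow> bool" where
  "equivariant_family G X Y W f \<longleftrightarrow>
     (\<forall>m n. \<forall>g\<in>carrier G. \<forall>x\<in>points (sp X m). \<forall>y\<in>points (sp Y n).
        f m n (act (sp X m) g x) (act (sp Y n) g y) = act (sp W (m * n)) g (f m n x y))"

text \<open>A formula on the representative that codes a class, where \<open>day_lift\<close> is
  only a description. That the choice of representative does not matter is an instance of
  \<open>day_class_case\<close>.\<close>

definition family_lift ::
    "('g, 'a univ) FG_space \<Rightarrow> ('g, 'a univ) FG_space \<Rightarrow> ('g, 'a univ) FG_space
     \<Rightarrow> (nat \<Rightarrow> nat \<Rightarrow> 'a univ \<Rightarrow> 'a univ \<Rightarrow> 'a univ) \<Rightarrow> nat \<Rightarrow> 'a univ \<Rightarrow> 'a univ" where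
  "family_lift X Y W f = (\<lambda>p. \<lambda>w\<in>points (sp (day X Y) p).
     case w of Pt m n \<phi> x y \<Rightarrow> ind W (m * n) p \<phi> (f m n x y))"

section \<open>Classes of points in the Day convolution\<close>

context
  fixes X Y :: "('g, 'a univ) FG_space"
  assumes X: "F_set X" and Y: "F_set Y"
begin

interpretation X: F_set X by (rule X)
interpretation Y: F_set Y by (rule Y)

lemma day_relators_subset:
  "day_relators X Y p \<subseteq> topspace (day_presum X Y p) \<times> topspace (day_presum X Y p)"
  unfolding day_relators_def
  by (auto simp: day_dom_iff X.ind_closed Y.ind_closed intro!: F_maps_compose[OF F_smash_F_maps])

lemma equiv_day: "equiv (topspace (day_presum X Y p)) (closed_equiv_hull (day_presum X Y p) (day_relators X Y p))"
  using equiv_closed_equiv_hull[OF day_relators_subset] by (simp flip: day_presum_discrete[OF X Y])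

text \<open>Related points have the same set of relatives, so the choice operator sees the same
  predicate for both and picks the same representative.\<close>

lemma day_class_eq:
  assumes "(s, t) \<in> day_relators X Y p"
  shows "day_class X Y p s = day_class X Y p t"
proof -
  let ?R = "closed_equiv_hull (day_presum X Y p) (day_relators X Y p)"
  have "(s, t) \<in> ?R"
    using assms subset_closed_equiv_hull by blast
  then have "?R `` {s} = ?R `` {t}"
    using equiv_class_eq[OF equiv_day] by blast
  then have "(s, t') \<in> ?R \<longleftrightarrow> (t, t') \<in> ?R" for t'
    by blast
  then show ?thesis by (simp add: day_class_def)
qed

lemma day_class_move:
  assumes "f \<in> F_maps m m'" "g \<in> F_maps n n'" "\<phi> \<in> F_maps (m' * n') p"
    and "x \<in> points (sp X m)" "y \<in> points (sp Y n)"
  shows "day_class X Y p ((m', n', \<phi>), (ind X m m' f x, ind Y n n' g y))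
       = day_class X Y p ((m, n, compose {..m * n} \<phi> (F_smash m n n' f g)), (x, y))"
  by (rule day_class_eq) (use assms in \<open>auto simp: day_relators_def\<close>)

text \<open>The relators collapsing \<open>X(m) \<or> Y(n)\<close> follow from the others, again because basepoints
  come from \<open>X(0)\<close> and \<open>Y(0)\<close>.\<close>

lemma respects_day_relators:
  assumes H: "\<And>m n m' n' f g \<phi> x y. f \<in> F_maps m m' \<Longrightarrow> g \<in> F_maps n n' \<Longrightarrow> \<phi> \<in> F_maps (m' * n') p \<Longrightarrow>
      x \<in> points (sp X m) \<Longrightarrow> y \<in> points (sp Y n) \<Longrightarrow>
      H ((m', n', \<phi>), (ind X m m' f x, ind Y n n' g y)) = H ((m, n, compose {..m * n} \<phi> (F_smash m n n' f g)), (x, y))"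
    and "(s, t) \<in> day_relators X Y p"
  shows "H s = H t"
proof -
  let ?z = "\<lambda>m. \<lambda>i\<in>{..m}. 0 :: nat"
  let ?b = "((0, 0, ?z 0), (pt (sp X 0), pt (sp Y 0)))"
  have zero: "H ((m, n, \<phi>), (x, y)) = H ?b"
    if "((m, n, \<phi>), (x, y)) \<in> topspace (day_presum X Y p)" and xy: "m = 0 \<or> n = 0" for m n \<phi> x y
  proof -
    have dom: "\<phi> \<in> F_maps (m * n) p" "x \<in> points (sp X m)" "y \<in> points (sp Y n)"
      using that by (auto simp: day_dom_iff)
    have mn: "m * n = 0" using xy by auto
    \<comment> \<open>The null maps send \<open>x\<close> and \<open>y\<close> to the points of
      \<open>X(0)\<close> and \<open>Y(0)\<close>. Since \<open>m * n = 0\<close>, the index \<phi>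
      is itself null and factors through the smash of the null maps, so the coend relation leads to
      the base term.\<close>
    have "ind X m 0 (?z m) x = pt (sp X 0)" "ind Y n 0 (?z n) y = pt (sp Y 0)"
      using X.ind_closed[OF F_maps_null dom(2), of 0] Y.ind_closed[OF F_maps_null dom(3), of 0]
      by (auto simp: X.points_zero Y.points_zero)
    moreover have "compose {..m * n} (?z 0) (F_smash m n 0 (?z m) (?z n)) = \<phi>"
      using F_maps_compose[OF F_smash_F_maps[OF F_maps_null[of m 0] F_maps_null[of n 0]] F_maps_null[of "0 * 0" p]] dom(1)
      by (intro F_maps_eqI) (auto simp: mn)
    ultimately show ?thesis
      using H[OF F_maps_null[of m 0] F_maps_null[of n 0] F_maps_null[of "0 * 0" p] dom(2,3)] by simp
  qed
  have wedge: "H ((m, n, \<phi>), (x, y)) = H ?b"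
    if dom: "((m, n, \<phi>), (x, y)) \<in> topspace (day_presum X Y p)"
      and xy: "x = pt (sp X m) \<or> y = pt (sp Y n)" for m n \<phi> x y
    using xy
  proof
    assume x: "x = pt (sp X m)"
    have d: "\<phi> \<in> F_maps (m * n) p" "y \<in> points (sp Y n)"
      using dom by (auto simp: day_dom_iff)
    \<comment> \<open>The basepoint of \<open>X(m)\<close> is induced from that of
      \<open>X(0)\<close>; moving the map from \<open>0\<close> to \<open>m\<close> into the index
      leaves a term whose first level is 0, to which \<open>zero\<close> applies.\<close>
    have "H ((m, n, \<phi>), (x, y))
        = H ((0, n, compose {..0 * n} \<phi> (F_smash 0 n n (?z 0) (\<lambda>i\<in>{..n}. i))), (pt (sp X 0), y))"
      using H[OF F_maps_null[of 0 m] F_maps_id[of n] d(1) X.pt_closed[of 0] d(2)]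
        X.ind_pt[OF F_maps_null[of 0 m]] Y.ind_id[OF d(2)]
      by (simp only: x)
    also have "\<dots> = H ?b"
    proof (rule zero)
      have "compose {..0 * n} \<phi> (F_smash 0 n n (?z 0) (\<lambda>i\<in>{..n}. i)) \<in> F_maps (0 * n) p"
        by (intro F_maps_compose[OF F_smash_F_maps[OF F_maps_null F_maps_id] d(1)])
      then show "((0, n, compose {..0 * n} \<phi> (F_smash 0 n n (?z 0) (\<lambda>i\<in>{..n}. i))), (pt (sp X 0), y))
          \<in> topspace (day_presum X Y p)"
        using d by (simp add: day_dom_iff X.pt_closed)
    qed simp
    finally show ?thesis .
  next
    assume y: "y = pt (sp Y n)"
    have d: "\<phi> \<in> F_maps (m * n) p" "x \<in> points (sp X m)"
      using dom by (auto simp: day_dom_iff)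
    have "H ((m, n, \<phi>), (x, y))
        = H ((m, 0, compose {..m * 0} \<phi> (F_smash m 0 n (\<lambda>i\<in>{..m}. i) (?z 0))), (x, pt (sp Y 0)))"
      using H[OF F_maps_id[of m] F_maps_null[of 0 n] d(1) d(2) Y.pt_closed[of 0]]
        Y.ind_pt[OF F_maps_null[of 0 n]] X.ind_id[OF d(2)]
      by (simp only: y)
    also have "\<dots> = H ?b"
    proof (rule zero)
      have "compose {..m * 0} \<phi> (F_smash m 0 n (\<lambda>i\<in>{..m}. i) (?z 0)) \<in> F_maps (m * 0) p"
        by (intro F_maps_compose[OF F_smash_F_maps[OF F_maps_id F_maps_null] d(1)])
      then show "((m, 0, compose {..m * 0} \<phi> (F_smash m 0 n (\<lambda>i\<in>{..m}. i) (?z 0))), (x, pt (sp Y 0)))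
          \<in> topspace (day_presum X Y p)"
        using d by (simp add: day_dom_iff Y.pt_closed)
    qed simp
    finally show ?thesis .
  qed
  from assms(2) show ?thesis
    unfolding day_relators_def
  proof (elim UnE CollectE exE conjE Pair_inject)
    fix m n m' n' f g \<phi> x y
    assume "f \<in> F_maps m m'" "g \<in> F_maps n n'" "\<phi> \<in> F_maps (m' * n') p"
      "x \<in> points (sp X m)" "y \<in> points (sp Y n)"
      "s = ((m', n', \<phi>), (ind X m m' f x, ind Y n n' g y))"
      "t = ((m, n, compose {..m * n} \<phi> (F_smash m n n' f g)), (x, y))"
    then show "H s = H t" using H by blast
  next
    fix m n \<phi> x y m' n' \<phi>' x' y'
    assume "s = ((m, n, \<phi>), (x, y))" "t = ((m', n', \<phi>'), (x', y'))"
      "((m, n, \<phi>), (x, y)) \<in> topspace (day_presum X Y p)"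
      "((m', n', \<phi>'), (x', y')) \<in> topspace (day_presum X Y p)"
      "x = pt (sp X m) \<or> y = pt (sp Y n)" "x' = pt (sp X m') \<or> y' = pt (sp Y n')"
    then show "H s = H t" using wedge by metis
  qed
qed

text \<open>The tool by which every operation on classes is evaluated: the stored representative is
  related to the given one, and \<open>h\<close> is constant along the generated equivalence
  relation once it respects the coend relation. Basepoints need no separate check, by
  \<open>respects_day_relators\<close>.\<close>

lemma day_class_case:
  assumes H: "\<And>m n m' n' f g \<phi> x y. f \<in> F_maps m m' \<Longrightarrow> g \<in> F_maps n n' \<Longrightarrow> \<phi> \<in> F_maps (m' * n') p \<Longrightarrow>
      x \<in> points (sp X m) \<Longrightarrow> y \<in> points (sp Y n) \<Longrightarrow>
      h m' n' \<phi> (ind X m m' f x) (ind Y n n' g y) = h m n (compose {..m * n} \<phi> (F_smash m n n' f g)) x y"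
    and dom: "\<phi> \<in> F_maps (m * n) p" "x \<in> points (sp X m)" "y \<in> points (sp Y n)"
  shows "(case day_class X Y p ((m, n, \<phi>), (x, y)) of Pt m n \<phi> x y \<Rightarrow> h m n \<phi> x y) = h m n \<phi> x y"
proof -
  let ?R = "closed_equiv_hull (day_presum X Y p) (day_relators X Y p)"
  define H where "H = (\<lambda>((m, n, \<phi>), (x, y)). h m n \<phi> x y)"
  define s where "s = ((m, n, \<phi>), (x, y))"
  have "(s, s) \<in> ?R"
    using dom equiv_day unfolding s_def equiv_def refl_on_def by (simp add: day_dom_iff)
  then have some: "(s, SOME t. (s, t) \<in> ?R) \<in> ?R" by (rule someI)
  obtain m' n' \<phi>' x' y' where t: "(SOME t. (s, t) \<in> ?R) = ((m', n', \<phi>'), (x', y'))"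
    by (metis prod.exhaust)
  have "H s = H (SOME t. (s, t) \<in> ?R)"
  proof (rule closed_equiv_hull_respects[OF day_relators_subset])
    show "(s, SOME t. (s, t) \<in> ?R) \<in> closed_equiv_hull (discrete_topology (topspace (day_presum X Y p))) (day_relators X Y p)"
      using some by (simp flip: day_presum_discrete[OF X Y])
    show "H s = H t" if "(s, t) \<in> day_relators X Y p" for s t
      by (rule respects_day_relators[OF _ that]) (simp add: H_def H)
  qed
  then show ?thesis
    unfolding day_class_def using t by (simp add: H_def s_def)
qed

lemma points_day: "points (sp (day X Y) p) = day_class X Y p ` topspace (day_presum X Y p)"
  by (simp add: day_def)

lemma day_discrete: "topo (sp (day X Y) p) = discrete_topology (points (sp (day X Y) p))"
proof (subst eq_commute, subst discrete_topology_unique, intro conjI ballI)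
  fix w assume "w \<in> points (sp (day X Y) p)"
  then show "openin (topo (sp (day X Y) p)) {w}"
    unfolding points_day
    by (simp add: day_def openin_quotient_topology) (subst day_presum_discrete[OF X Y], auto)
qed simp

lemma day_class_points:
  "\<phi> \<in> F_maps (m * n) p \<Longrightarrow> x \<in> points (sp X m) \<Longrightarrow> y \<in> points (sp Y n)
    \<Longrightarrow> day_class X Y p ((m, n, \<phi>), (x, y)) \<in> points (sp (day X Y) p)"
  by (auto simp: points_day day_dom_iff)

lemma day_point_cases:
  assumes "w \<in> points (sp (day X Y) p)"
  obtains m n \<phi> x y where "\<phi> \<in> F_maps (m * n) p" "x \<in> points (sp X m)" "y \<in> points (sp Y n)"
    "w = day_class X Y p ((m, n, \<phi>), (x, y))"
  using assms by (auto simp: points_day day_dom_iff)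

lemma ind_day_class:
  assumes \<psi>: "\<psi> \<in> F_maps p q" and dom: "\<phi> \<in> F_maps (m * n) p" "x \<in> points (sp X m)" "y \<in> points (sp Y n)"
  shows "ind (day X Y) p q \<psi> (day_class X Y p ((m, n, \<phi>), (x, y)))
       = day_class X Y q ((m, n, compose {..m * n} \<psi> \<phi>), (x, y))"
proof -
  have "(case day_class X Y p ((m, n, \<phi>), (x, y)) of Pt m n \<phi> x y \<Rightarrow> day_class X Y q ((m, n, compose {..m * n} \<psi> \<phi>), (x, y)))
     = day_class X Y q ((m, n, compose {..m * n} \<psi> \<phi>), (x, y))"
  proof (rule day_class_case[OF _ dom])
    fix m n m' n' f g \<phi> x y
    assume *: "f \<in> F_maps m m'" "g \<in> F_maps n n'" "\<phi> \<in> F_maps (m' * n') p"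
      "x \<in> points (sp X m)" "y \<in> points (sp Y n)"
    show "day_class X Y q ((m', n', compose {..m' * n'} \<psi> \<phi>), ind X m m' f x, ind Y n n' g y)
      = day_class X Y q ((m, n, compose {..m * n} \<psi> (compose {..m * n} \<phi> (F_smash m n n' f g))), x, y)"
      using day_class_move[OF *(1,2) F_maps_compose[OF *(3) \<psi>] *(4,5)]
      by (simp add: F_maps_compose_assoc[OF F_smash_F_maps[OF *(1,2)]])
  qed
  then show ?thesis
    using day_class_points[OF dom] unfolding points_day by (simp add: day_def)
qed

lemma day_pair_points:
  "x \<in> points (sp X m) \<Longrightarrow> y \<in> points (sp Y n) \<Longrightarrow> day_pair X Y m n x y \<in> points (sp (day X Y) (m * n))"
  by (simp add: day_pair_def day_class_points)

text \<open>A generator \<open>day_pair\<close> has the identity as its index, so inducing along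
  \<phi> produces the index \<phi>. Hence a natural map is determined by its values on
  generators.\<close>

lemma day_class_eq_ind_pair:
  assumes "\<phi> \<in> F_maps (m * n) p" "x \<in> points (sp X m)" "y \<in> points (sp Y n)"
  shows "day_class X Y p ((m, n, \<phi>), (x, y)) = ind (day X Y) (m * n) p \<phi> (day_pair X Y m n x y)"
  using assms by (simp add: day_pair_def ind_day_class F_maps_compose_id)

lemma day_point_ind:
  assumes "w \<in> points (sp (day X Y) p)"
  obtains m n \<phi> x y where "\<phi> \<in> F_maps (m * n) p" "x \<in> points (sp X m)" "y \<in> points (sp Y n)"
    "w = ind (day X Y) (m * n) p \<phi> (day_pair X Y m n x y)"
  using assms by (metis day_point_cases day_class_eq_ind_pair)

lemma pt_day: "pt (sp (day X Y) n) = day_class X Y n ((0, 0, \<lambda>i\<in>{..0}. 0), pt (sp X 0), pt (sp Y 0))"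
  by (simp add: day_def)

lemma F_set_day: "F_set (day X Y)"
proof
  fix n show "topo (sp (day X Y) n) = discrete_topology (points (sp (day X Y) n))"
    by (rule day_discrete)
next
  fix n
  have "day_class X Y n ((0, 0, \<lambda>i\<in>{..0}. 0), pt (sp X 0), pt (sp Y 0)) \<in> points (sp (day X Y) n)"
    by (rule day_class_points) (auto simp: X.pt_closed Y.pt_closed)
  then show "pt (sp (day X Y) n) \<in> points (sp (day X Y) n)"
    by (simp only: pt_day)
next
  have "w = pt (sp (day X Y) 0)" if w: "w \<in> points (sp (day X Y) 0)" for w
    using w
  proof (rule day_point_cases)
    fix m n \<phi> x y
    assume *: "\<phi> \<in> F_maps (m * n) 0" "x \<in> points (sp X m)" "y \<in> points (sp Y n)"
      "w = day_class X Y 0 ((m, n, \<phi>), x, y)"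
    let ?z = "\<lambda>m. \<lambda>i\<in>{..m}. 0 :: nat"
    \<comment> \<open>Over \<open>0\<close> the index is null by \<open>F_maps_to_zero\<close>, so
      it factors through the smash of the null maps and the class moves to the basepoint.\<close>
    have "ind X m 0 (?z m) x = pt (sp X 0)" "ind Y n 0 (?z n) y = pt (sp Y 0)"
      using X.ind_closed[OF F_maps_null *(2), of 0] Y.ind_closed[OF F_maps_null *(3), of 0]
      by (auto simp: X.points_zero Y.points_zero)
    moreover have "compose {..m * n} (?z 0) (F_smash m n 0 (?z m) (?z n)) = \<phi>"
      using F_maps_to_zero[OF F_maps_compose[OF F_smash_F_maps[OF F_maps_null[of m 0] F_maps_null[of n 0]] F_maps_null]]
        F_maps_to_zero[OF *(1)] by simp
    ultimately show "w = pt (sp (day X Y) 0)"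
      using day_class_move[OF F_maps_null[of m 0] F_maps_null[of n 0] F_maps_null[of "0 * 0" 0] *(2,3)] *(4)
      by (simp add: pt_day)
  qed
  moreover have "day_class X Y 0 ((0, 0, \<lambda>i\<in>{..0}. 0), pt (sp X 0), pt (sp Y 0)) \<in> points (sp (day X Y) 0)"
    by (rule day_class_points) (auto simp: X.pt_closed Y.pt_closed)
  ultimately show "points (sp (day X Y) 0) = {pt (sp (day X Y) 0)}"
    unfolding pt_day by blast
next
  fix \<phi> m n assume \<phi>: "\<phi> \<in> F_maps m n"
  show "ind (day X Y) m n \<phi> \<in> points (sp (day X Y) m) \<rightarrow>\<^sub>E points (sp (day X Y) n)"
  proof (rule PiE_I)
    fix w assume "w \<in> points (sp (day X Y) m)"
    then show "ind (day X Y) m n \<phi> w \<in> points (sp (day X Y) n)"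
      using \<phi> by (elim day_point_cases) (auto simp: ind_day_class intro: day_class_points F_maps_compose)
  next
    fix w assume "w \<notin> points (sp (day X Y) m)"
    then show "ind (day X Y) m n \<phi> w = undefined"
      by (simp add: points_day) (simp add: day_def)
  qed
  have "ind (day X Y) m n \<phi> (day_class X Y m ((0, 0, \<lambda>i\<in>{..0}. 0), pt (sp X 0), pt (sp Y 0)))
     = day_class X Y n ((0, 0, \<lambda>i\<in>{..0}. 0), pt (sp X 0), pt (sp Y 0))"
    using ind_day_class[OF \<phi> _ X.pt_closed[of 0] Y.pt_closed[of 0], of "\<lambda>i\<in>{..0}. 0"]
      F_maps_from_zero[OF F_maps_compose[OF F_maps_null \<phi>]] F_maps_null[of 0 m]
    by (simp only: mult_0)
  then show "ind (day X Y) m n \<phi> (pt (sp (day X Y) m)) = pt (sp (day X Y) n)"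
    by (simp only: pt_day)
next
  fix w n assume "w \<in> points (sp (day X Y) n)"
  then show "ind (day X Y) n n (\<lambda>i\<in>{..n}. i) w = w"
    by (elim day_point_cases) (simp add: ind_day_class compose_id_F_maps)
next
  fix \<phi> m n \<psi> p w assume \<phi>: "\<phi> \<in> F_maps m n" and \<psi>: "\<psi> \<in> F_maps n p" and "w \<in> points (sp (day X Y) m)"
  then show "ind (day X Y) m p (compose {..m} \<psi> \<phi>) w = ind (day X Y) n p \<psi> (ind (day X Y) m n \<phi> w)"
    by (elim day_point_cases) (simp add: ind_day_class F_maps_compose F_maps_compose_assoc[of _ _ m])
qed

interpretation day: F_set "day X Y" by (rule F_set_day)

text \<open>Both sides are the class of \<open>(x, y)\<close> with index
  \<open>F_smash m n n' \<phi> \<psi>\<close>: the left one by the coend relation at the identity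
  index, the right one by the definition of induced maps.\<close>

lemma natural_family_day_pair: "natural_family X Y (day X Y) (day_pair X Y)"
proof (rule natural_familyI)
  fix m m' n n' \<phi> \<psi> x y
  assume *: "\<phi> \<in> F_maps m m'" "\<psi> \<in> F_maps n n'" "x \<in> points (sp X m)" "y \<in> points (sp Y n)"
  show "day_pair X Y m' n' (ind X m m' \<phi> x) (ind Y n n' \<psi> y) =
      ind (day X Y) (m * n) (m' * n') (F_smash m n n' \<phi> \<psi>) (day_pair X Y m n x y)"
    unfolding day_pair_def
    using * F_smash_F_maps[OF *(1,2)] day_class_move[OF *(1,2) F_maps_id *(3,4)]
    by (simp add: ind_day_class F_maps_compose_id compose_id_F_maps)
qed (rule day_pair_points)

subsection \<open>The universal property\<close>

lemma F_nat_day_eqI: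
  assumes "\<theta> \<in> F_nat (day X Y) W" "\<xi> \<in> F_nat (day X Y) W"
    and "\<And>m n x y. x \<in> points (sp X m) \<Longrightarrow> y \<in> points (sp Y n)
      \<Longrightarrow> \<theta> (m * n) (day_pair X Y m n x y) = \<xi> (m * n) (day_pair X Y m n x y)"
  shows "\<theta> = \<xi>"
  using assms(1,2)
proof (rule F_nat_eqI)
  fix p w assume "w \<in> points (sp (day X Y) p)"
  then show "\<theta> p w = \<xi> p w"
    by (elim day_point_ind)
      (simp add: F_nat_ind[OF assms(1)] F_nat_ind[OF assms(2)] day_pair_points assms(3))
qed

context
  fixes W :: "('g, 'a univ) FG_space" and f :: "nat \<Rightarrow> nat \<Rightarrow> 'a univ \<Rightarrow> 'a univ \<Rightarrow> 'a univ"
  assumes W: "F_set W" and f: "natural_family X Y W f"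
begin

interpretation W: F_set W by (rule W)

lemma family_closed: "x \<in> points (sp X m) \<Longrightarrow> y \<in> points (sp Y n) \<Longrightarrow> f m n x y \<in> points (sp W (m * n))"
  using f by (auto simp: natural_family_def)

lemma family_natural: "\<phi> \<in> F_maps m m' \<Longrightarrow> \<psi> \<in> F_maps n n' \<Longrightarrow> x \<in> points (sp X m) \<Longrightarrow> y \<in> points (sp Y n) \<Longrightarrow>
    f m' n' (ind X m m' \<phi> x) (ind Y n n' \<psi> y) = ind W (m * n) (m' * n') (F_smash m n n' \<phi> \<psi>) (f m n x y)"
  using f by (auto simp: natural_family_def)

text \<open>Naturality of \<open>f\<close>, followed by functoriality of \<open>W\<close>, is
  exactly compatibility with the coend relation.\<close>

lemma family_lift_class:
  assumes dom: "\<phi> \<in> F_maps (m * n) p" "x \<in> points (sp X m)" "y \<in> points (sp Y n)"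
  shows "family_lift X Y W f p (day_class X Y p ((m, n, \<phi>), (x, y))) = ind W (m * n) p \<phi> (f m n x y)"
proof -
  have "(case day_class X Y p ((m, n, \<phi>), (x, y)) of Pt m n \<phi> x y \<Rightarrow> ind W (m * n) p \<phi> (f m n x y))
     = ind W (m * n) p \<phi> (f m n x y)"
  proof (rule day_class_case[OF _ dom])
    fix m n m' n' \<phi>' g \<phi> x y
    assume *: "\<phi>' \<in> F_maps m m'" "g \<in> F_maps n n'" "\<phi> \<in> F_maps (m' * n') p"
      "x \<in> points (sp X m)" "y \<in> points (sp Y n)"
    show "ind W (m' * n') p \<phi> (f m' n' (ind X m m' \<phi>' x) (ind Y n n' g y))
      = ind W (m * n) p (compose {..m * n} \<phi> (F_smash m n n' \<phi>' g)) (f m n x y)"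
      using * by (simp add: family_natural W.ind_compose[OF F_smash_F_maps] family_closed)
  qed
  then show ?thesis
    using day_class_points[OF dom] by (simp add: family_lift_def)
qed

lemma family_lift_pair: "x \<in> points (sp X m) \<Longrightarrow> y \<in> points (sp Y n)
    \<Longrightarrow> family_lift X Y W f (m * n) (day_pair X Y m n x y) = f m n x y"
  by (simp add: day_pair_def family_lift_class W.ind_id family_closed)

lemma family_lift_F_nat: "family_lift X Y W f \<in> F_nat (day X Y) W"
  unfolding F_nat_def
proof (intro CollectI conjI allI ballI PiE_I)
  fix n w assume "w \<in> points (sp (day X Y) n)"
  then show "family_lift X Y W f n w \<in> points (sp W n)"
    by (elim day_point_cases) (simp add: family_lift_class W.ind_closed family_closed)
next
  fix n w assume "w \<notin> points (sp (day X Y) n)"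
  then show "family_lift X Y W f n w = undefined" by (simp add: family_lift_def)
next
  fix p q \<psi> w assume "\<psi> \<in> F_maps p q" "w \<in> points (sp (day X Y) p)"
  then show "family_lift X Y W f q (ind (day X Y) p q \<psi> w) = ind W p q \<psi> (family_lift X Y W f p w)"
    by (elim day_point_cases)
      (simp add: family_lift_class ind_day_class F_maps_compose W.ind_compose family_closed)
qed

end

end

lemma family_ind_left:
  assumes "natural_family X Y W f" "F_set Y" "\<phi> \<in> F_maps m m'" "x \<in> points (sp X m)" "y \<in> points (sp Y n)"
  shows "f m' n (ind X m m' \<phi> x) y = ind W (m * n) (m' * n) (F_smash m n n \<phi> (\<lambda>i\<in>{..n}. i)) (f m n x y)"
  using assms(1) F_set.ind_id[OF assms(2,5)] assms(3-) F_maps_id[of n] unfolding natural_family_def by metis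

text \<open>Generators are used twice. A point \<open>v\<close> of the inner convolution is induced
  from a pair, and naturality of \<open>day_pair\<close> in its first slot brings the inducing map
  outside as a smash with an identity.\<close>

lemma F_nat_day3_eqI:
  assumes X: "F_set X" and Y: "F_set Y" and W: "F_set W"
    and \<theta>: "\<theta> \<in> F_nat (day (day X Y) W) V" and \<xi>: "\<xi> \<in> F_nat (day (day X Y) W) V"
    and eq: "\<And>m n p x y w. x \<in> points (sp X m) \<Longrightarrow> y \<in> points (sp Y n) \<Longrightarrow> w \<in> points (sp W p)
      \<Longrightarrow> \<theta> (m * n * p) (day_pair (day X Y) W (m * n) p (day_pair X Y m n x y) w)
        = \<xi> (m * n * p) (day_pair (day X Y) W (m * n) p (day_pair X Y m n x y) w)"
  shows "\<theta> = \<xi>"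
proof (rule F_nat_day_eqI[OF F_set_day[OF X Y] W \<theta> \<xi>])
  fix k p v w assume v: "v \<in> points (sp (day X Y) k)" and w: "w \<in> points (sp W p)"
  from X Y v obtain m n \<phi> x y where \<phi>: "\<phi> \<in> F_maps (m * n) k" and xy: "x \<in> points (sp X m)" "y \<in> points (sp Y n)"
    and v_eq: "v = ind (day X Y) (m * n) k \<phi> (day_pair X Y m n x y)"
    by (rule day_point_ind)
  note pair = day_pair_points[OF X Y xy]
  note pair2 = day_pair_points[OF F_set_day[OF X Y] W pair w]
  have "day_pair (day X Y) W k p v w = ind (day (day X Y) W) (m * n * p) (k * p)
      (F_smash (m * n) p p \<phi> (\<lambda>i\<in>{..p}. i)) (day_pair (day X Y) W (m * n) p (day_pair X Y m n x y) w)"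
    unfolding v_eq by (rule family_ind_left[OF natural_family_day_pair[OF F_set_day[OF X Y] W] W \<phi> pair w])
  then show "\<theta> (k * p) (day_pair (day X Y) W k p v w) = \<xi> (k * p) (day_pair (day X Y) W k p v w)"
    by (simp add: F_nat_ind[OF \<theta> F_smash_F_maps[OF \<phi> F_maps_id] pair2]
        F_nat_ind[OF \<xi> F_smash_F_maps[OF \<phi> F_maps_id] pair2] eq[OF xy w])
qed

subsection \<open>Equivariance\<close>

context
  fixes G :: "('g, 'x) monoid_scheme" and X Y :: "('g, 'a univ) FG_space"
  assumes GX: "FG_set G X" and GY: "FG_set G Y"
begin

interpretation X: FG_set G X by (rule GX)
interpretation Y: FG_set G Y by (rule GY)

lemmas F_sets_XY = X.F_set_axioms Y.F_set_axioms

text \<open>The actions on \<open>X\<close> and \<open>Y\<close> commute with induced maps, so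
  acting on a representative respects the coend relation.\<close>

lemma act_day_class:
  assumes g: "g \<in> carrier G" and dom: "\<phi> \<in> F_maps (m * n) p" "x \<in> points (sp X m)" "y \<in> points (sp Y n)"
  shows "act (sp (day X Y) p) g (day_class X Y p ((m, n, \<phi>), (x, y)))
       = day_class X Y p ((m, n, \<phi>), (act (sp X m) g x, act (sp Y n) g y))"
proof -
  have "(case day_class X Y p ((m, n, \<phi>), (x, y)) of Pt m n \<phi> x y \<Rightarrow>
        day_class X Y p ((m, n, \<phi>), (act (sp X m) g x, act (sp Y n) g y)))
     = day_class X Y p ((m, n, \<phi>), (act (sp X m) g x, act (sp Y n) g y))"
    using g by (intro day_class_case[OF F_sets_XY _ dom])
      (simp add: X.act_ind Y.act_ind day_class_move[OF F_sets_XY] X.act_closed Y.act_closed)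
  then show ?thesis
    using day_class_points[OF F_sets_XY dom] unfolding points_day[OF F_sets_XY] by (simp add: day_def)
qed

lemma FG_set_day: "FG_set G (day X Y)"
proof -
  interpret day: F_set "day X Y" by (rule F_set_day[OF F_sets_XY])
  note cls = act_day_class X.act_closed Y.act_closed
  show ?thesis
  proof
    fix g n assume "g \<in> carrier G"
    show "act (sp (day X Y) n) g \<in> extensional (points (sp (day X Y) n))"
      unfolding points_day[OF F_sets_XY] by (simp add: day_def)
  next
    fix g w n assume "g \<in> carrier G" "w \<in> points (sp (day X Y) n)"
    then show "act (sp (day X Y) n) g w \<in> points (sp (day X Y) n)"
      by (elim day_point_cases[OF F_sets_XY]) (simp add: cls day_class_points[OF F_sets_XY])
  next
    fix w n assume "w \<in> points (sp (day X Y) n)"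
    then show "act (sp (day X Y) n) \<one>\<^bsub>G\<^esub> w = w"
      by (elim day_point_cases[OF F_sets_XY]) (simp add: cls X.act_one Y.act_one)
  next
    fix g h w n assume "g \<in> carrier G" "h \<in> carrier G" "w \<in> points (sp (day X Y) n)"
    then show "act (sp (day X Y) n) (g \<otimes>\<^bsub>G\<^esub> h) w = act (sp (day X Y) n) g (act (sp (day X Y) n) h w)"
      by (elim day_point_cases[OF F_sets_XY]) (simp add: cls X.act_mult Y.act_mult)
  next
    fix g \<phi> m n w assume "g \<in> carrier G" "\<phi> \<in> F_maps m n" "w \<in> points (sp (day X Y) m)"
    then show "act (sp (day X Y) n) g (ind (day X Y) m n \<phi> w) = ind (day X Y) m n \<phi> (act (sp (day X Y) m) g w)"
      by (elim day_point_cases[OF F_sets_XY]) (simp add: cls ind_day_class[OF F_sets_XY] F_maps_compose)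
  qed
qed

lemma equivariant_family_day_pair: "equivariant_family G X Y (day X Y) (day_pair X Y)"
  by (auto simp: equivariant_family_def day_pair_def act_day_class)

context
  fixes W :: "('g, 'a univ) FG_space" and f :: "nat \<Rightarrow> nat \<Rightarrow> 'a univ \<Rightarrow> 'a univ \<Rightarrow> 'a univ"
  assumes GW: "FG_set G W" and nat: "natural_family X Y W f" and eqv: "equivariant_family G X Y W f"
begin

interpretation W: FG_set G W by (rule GW)

lemma equivariant_family_lift: "equivariant G (day X Y) W (family_lift X Y W f)"
  unfolding equivariant_def
proof (intro allI ballI)
  fix n g w assume g: "g \<in> carrier G" and "w \<in> points (sp (day X Y) n)"
  from F_sets_XY this(2) obtain m k \<phi> x y where *: "\<phi> \<in> F_maps (m * k) n" "x \<in> points (sp X m)" "y \<in> points (sp Y k)"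
    "w = day_class X Y n ((m, k, \<phi>), x, y)"
    by (rule day_point_cases)
  then show "family_lift X Y W f n (act (sp (day X Y) n) g w) = act (sp W n) g (family_lift X Y W f n w)"
    using g family_closed[OF F_sets_XY W.F_set_axioms nat *(2,3)] eqv unfolding equivariant_family_def
    by (simp add: act_day_class family_lift_class[OF F_sets_XY W.F_set_axioms nat] X.act_closed Y.act_closed W.act_ind)
qed

text \<open>This discharges the definite description: \<open>family_lift\<close> is equivariant with
  the prescribed values on pairs, and a natural map is determined by those values.\<close>

lemma day_lift_eq: "day_lift G X Y W f = family_lift X Y W f"
  unfolding day_lift_def
proof (rule the_equality)
  note iff = FG_maps_iff[OF F_set_day[OF F_sets_XY] W.F_set_axioms]
  show "family_lift X Y W f \<in> FG_maps G (day X Y) W \<and>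
    (\<forall>m n. \<forall>x\<in>points (sp X m). \<forall>y\<in>points (sp Y n). family_lift X Y W f (m * n) (day_pair X Y m n x y) = f m n x y)"
    using equivariant_family_lift family_lift_F_nat[OF F_sets_XY W.F_set_axioms nat] family_lift_pair[OF F_sets_XY W.F_set_axioms nat]
    by (simp add: iff)
  fix \<theta> assume \<theta>: "\<theta> \<in> FG_maps G (day X Y) W \<and>
    (\<forall>m n. \<forall>x\<in>points (sp X m). \<forall>y\<in>points (sp Y n). \<theta> (m * n) (day_pair X Y m n x y) = f m n x y)"
  then show "\<theta> = family_lift X Y W f"
    by (intro F_nat_day_eqI[OF F_sets_XY _ family_lift_F_nat[OF F_sets_XY W.F_set_axioms nat]])
      (auto simp: iff family_lift_pair[OF F_sets_XY W.F_set_axioms nat])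
qed

lemma day_lift_F_nat: "day_lift G X Y W f \<in> F_nat (day X Y) W"
  by (simp add: day_lift_eq family_lift_F_nat[OF F_sets_XY W.F_set_axioms nat])

lemma equivariant_day_lift: "equivariant G (day X Y) W (day_lift G X Y W f)"
  by (simp add: day_lift_eq equivariant_family_lift)

lemma day_lift_pair: "x \<in> points (sp X m) \<Longrightarrow> y \<in> points (sp Y n)
    \<Longrightarrow> day_lift G X Y W f (m * n) (day_pair X Y m n x y) = f m n x y"
  by (simp add: day_lift_eq family_lift_pair[OF F_sets_XY W.F_set_axioms nat])

end

end

subsection \<open>The associativity constraint\<close>

text \<open>To construct \<open>(X \<and> Y) \<and> W \<rightarrow> V\<close> one fixes a point of \<open>W(p)\<close> and lifts to
  \<open>X \<and> Y \<rightarrow> V(- \<and> p)\<close>. Such a lift is not equivariant, which is why \<open>family_lift\<close> does not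
  involve the group.\<close>

definition shift :: "nat \<Rightarrow> ('g, 'u) FG_space \<Rightarrow> ('g, 'u) FG_space" where
  "shift p V = \<lparr>sp = \<lambda>k. sp V (k * p),
     ind = \<lambda>k l \<phi>. ind V (k * p) (l * p) (F_smash k p p \<phi> (\<lambda>i\<in>{..p}. i))\<rparr>"

lemma sp_shift [simp]: "sp (shift p V) k = sp V (k * p)"
  by (simp add: shift_def)

lemma ind_shift [simp]: "ind (shift p V) k l \<phi> = ind V (k * p) (l * p) (F_smash k p p \<phi> (\<lambda>i\<in>{..p}. i))"
  by (simp add: shift_def)

text \<open>This is \<open>V\<close> precomposed with the endofunctor - \<and> p of F. It is again
  reduced because \<open>0 * p = 0\<close>.\<close>

lemma F_set_shift:
  assumes "F_set V"
  shows "F_set (shift p V)"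
proof -
  interpret V: F_set V by fact
  show ?thesis
  proof
    fix n show "topo (sp (shift p V) n) = discrete_topology (points (sp (shift p V) n))"
      unfolding sp_shift by (rule V.discrete)
    fix x assume "x \<in> points (sp (shift p V) n)"
    then show "ind (shift p V) n n (\<lambda>i\<in>{..n}. i) x = x"
      by (simp add: F_smash_id V.ind_id)
  next
    fix \<phi> m n \<psi> q x assume *: "\<phi> \<in> F_maps m n" "\<psi> \<in> F_maps n q" "x \<in> points (sp (shift p V) m)"
    have "compose {..m * p} (F_smash n p p \<psi> (\<lambda>i\<in>{..p}. i)) (F_smash m p p \<phi> (\<lambda>i\<in>{..p}. i))
        = F_smash m p p (compose {..m} \<psi> \<phi>) (\<lambda>i\<in>{..p}. i)"
      using F_smash_compose[OF *(1) F_maps_id *(2) F_maps_id] compose_id_F_maps[OF F_maps_id[of p]] by simp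
    then show "ind (shift p V) m q (compose {..m} \<psi> \<phi>) x = ind (shift p V) n q \<psi> (ind (shift p V) m n \<phi> x)"
      using * V.ind_compose[OF F_smash_F_maps[OF *(1) F_maps_id[of p]] F_smash_F_maps[OF *(2) F_maps_id[of p]]] by simp
  qed (use V.ind_PiE V.pt_closed V.points_zero V.ind_pt F_smash_F_maps in simp_all)
qed

context
  fixes X Y W :: "('g, 'a univ) FG_space"
  assumes X: "F_set X" and Y: "F_set Y" and W: "F_set W"
begin

text \<open>The value lives at level \<open>m * (n * p)\<close>. As this equals
  \<open>m * n * p\<close>, it is level \<open>m * n\<close> of the shifted functor, so for fixed
  \<open>w\<close> the family can be lifted over \<open>X\<close> and \<open>Y\<close>.\<close>

definition assoc_inner :: "nat \<Rightarrow> 'a univ \<Rightarrow> nat \<Rightarrow> nat \<Rightarrow> 'a univ \<Rightarrow> 'a univ \<Rightarrow> 'a univ" where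
  "assoc_inner p w m n x y = day_pair X (day Y W) m (n * p) x (day_pair Y W n p y w)"

definition assoc_family :: "nat \<Rightarrow> nat \<Rightarrow> 'a univ \<Rightarrow> 'a univ \<Rightarrow> 'a univ" where
  "assoc_family k p v w = family_lift X Y (shift p (day X (day Y W))) (assoc_inner p w) k v"

lemma F_set_day3: "F_set (day X (day Y W))"
  by (intro F_set_day X Y W)

text \<open>Naturality of \<open>day_pair\<close> is applied twice, and strict associativity of the
  smash product joins the two steps. All three variables are allowed to move at once; the uses below
  put identities in some of the slots.\<close>

lemma assoc_inner_natural:
  assumes "\<phi> \<in> F_maps m m'" "\<psi> \<in> F_maps n n'" "\<omega> \<in> F_maps p p'"
    and "x \<in> points (sp X m)" "y \<in> points (sp Y n)" "w \<in> points (sp W p)"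
  shows "assoc_inner p' (ind W p p' \<omega> w) m' n' (ind X m m' \<phi> x) (ind Y n n' \<psi> y)
       = ind (day X (day Y W)) (m * n * p) (m' * n' * p') (F_smash (m * n) p p' (F_smash m n n' \<phi> \<psi>) \<omega>) (assoc_inner p w m n x y)"
proof -
  have yw: "day_pair Y W n' p' (ind Y n n' \<psi> y) (ind W p p' \<omega> w)
      = ind (day Y W) (n * p) (n' * p') (F_smash n p p' \<psi> \<omega>) (day_pair Y W n p y w)"
    using natural_family_day_pair[OF Y W] assms by (simp add: natural_family_def)
  have "day_pair X (day Y W) m' (n' * p') (ind X m m' \<phi> x) (ind (day Y W) (n * p) (n' * p') (F_smash n p p' \<psi> \<omega>) (day_pair Y W n p y w))
      = ind (day X (day Y W)) (m * (n * p)) (m' * (n' * p')) (F_smash m (n * p) (n' * p') \<phi> (F_smash n p p' \<psi> \<omega>))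
          (day_pair X (day Y W) m (n * p) x (day_pair Y W n p y w))"
    using natural_family_day_pair[OF X F_set_day[OF Y W]] assms F_smash_F_maps[OF assms(2,3)] day_pair_points[OF Y W assms(5,6)]
    unfolding natural_family_def by blast
  then show ?thesis
    unfolding assoc_inner_def yw F_smash_assoc[OF assms(1-3)] by (simp only: mult.assoc)
qed

lemma assoc_inner_closed:
  "x \<in> points (sp X m) \<Longrightarrow> y \<in> points (sp Y n) \<Longrightarrow> w \<in> points (sp W p) \<Longrightarrow> assoc_inner p w m n x y \<in> points (sp (day X (day Y W)) (m * n * p))"
  using day_pair_points[OF X F_set_day[OF Y W] _ day_pair_points[OF Y W]]
  unfolding assoc_inner_def mult.assoc by blast

lemma natural_family_assoc_inner:
  assumes w: "w \<in> points (sp W p)"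
  shows "natural_family X Y (shift p (day X (day Y W))) (assoc_inner p w)"
proof (rule natural_familyI)
  fix m m' n n' \<phi> \<psi> x y
  assume *: "\<phi> \<in> F_maps m m'" "\<psi> \<in> F_maps n n'" "x \<in> points (sp X m)" "y \<in> points (sp Y n)"
  show "assoc_inner p w m' n' (ind X m m' \<phi> x) (ind Y n n' \<psi> y)
      = ind (shift p (day X (day Y W))) (m * n) (m' * n') (F_smash m n n' \<phi> \<psi>) (assoc_inner p w m n x y)"
    using assoc_inner_natural[OF *(1,2) F_maps_id[of p] *(3,4) w] F_set.ind_id[OF W w] by simp
qed (simp add: assoc_inner_closed w)

lemma assoc_family_pair:
  assumes "x \<in> points (sp X m)" "y \<in> points (sp Y n)" "w \<in> points (sp W p)"
  shows "assoc_family (m * n) p (day_pair X Y m n x y) w = day_pair X (day Y W) m (n * p) x (day_pair Y W n p y w)"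
  using family_lift_pair[OF X Y F_set_shift[OF F_set_day3] natural_family_assoc_inner[OF assms(3)] assms(1,2)]
  by (simp add: assoc_family_def assoc_inner_def)

lemma assoc_family_ind_left:
  assumes "\<phi> \<in> F_maps k l" "v \<in> points (sp (day X Y) k)" "w \<in> points (sp W p)"
  shows "assoc_family l p (ind (day X Y) k l \<phi> v) w
       = ind (day X (day Y W)) (k * p) (l * p) (F_smash k p p \<phi> (\<lambda>i\<in>{..p}. i)) (assoc_family k p v w)"
  using F_nat_ind[OF family_lift_F_nat[OF X Y F_set_shift[OF F_set_day3] natural_family_assoc_inner[OF assms(3)]] assms(1,2)]
  by (simp add: assoc_family_def)

text \<open>Naturality in \<open>k\<close> is inherited from the lift, but the lift was made
  separately for each \<open>w\<close>, so naturality in \<open>p\<close> has to be verified on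
  generators of the inner convolution.\<close>

lemma natural_family_assoc: "natural_family (day X Y) W (day X (day Y W)) assoc_family"
proof (rule natural_familyI)
  fix k p v w assume v: "v \<in> points (sp (day X Y) k)" and w: "w \<in> points (sp W p)"
  show "assoc_family k p v w \<in> points (sp (day X (day Y W)) (k * p))"
    using F_nat_closed[OF family_lift_F_nat[OF X Y F_set_shift[OF F_set_day3] natural_family_assoc_inner[OF w]] v]
    by (simp add: assoc_family_def)
next
  fix k k' p p' \<phi> \<psi> v w
  assume \<phi>: "\<phi> \<in> F_maps k k'" and \<psi>: "\<psi> \<in> F_maps p p'"
    and v: "v \<in> points (sp (day X Y) k)" and w: "w \<in> points (sp W p)"
  interpret V: F_set "day X (day Y W)" by (rule F_set_day3)
  have w': "ind W p p' \<psi> w \<in> points (sp W p')" using F_set.ind_closed[OF W \<psi> w] .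
  from X Y v obtain m n \<omega> x y where \<omega>: "\<omega> \<in> F_maps (m * n) k" and xy: "x \<in> points (sp X m)" "y \<in> points (sp Y n)"
    and v_eq: "v = ind (day X Y) (m * n) k \<omega> (day_pair X Y m n x y)"
    by (rule day_point_ind)
  note pair = day_pair_points[OF X Y xy]
  have c: "assoc_inner p w m n x y \<in> points (sp (day X (day Y W)) (m * n * p))" using assoc_inner_closed[OF xy w] .
  \<comment> \<open>Both sides are the image of \<open>assoc_inner p w m n x y\<close> under (\<phi>
    o \<omega>) \<and> \<psi>. The left side factors this map as (\<phi> o \<omega>) \<and> id after
    id \<and> \<psi>, the right side as \<phi> \<and> \<psi> after \<omega> \<and> id.\<close>
  have "assoc_family k' p' (ind (day X Y) k k' \<phi> v) (ind W p p' \<psi> w)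
      = ind (day X (day Y W)) (m * n * p') (k' * p') (F_smash (m * n) p' p' (compose {..m * n} \<phi> \<omega>) (\<lambda>i\<in>{..p'}. i))
          (assoc_inner p' (ind W p p' \<psi> w) m n x y)"
    unfolding v_eq
    by (simp add: F_set.ind_compose[OF F_set_day[OF X Y] \<omega> \<phi> pair, symmetric]
        assoc_family_ind_left[OF F_maps_compose[OF \<omega> \<phi>] pair w'] assoc_family_pair[OF xy w'] assoc_inner_def)
  also have "assoc_inner p' (ind W p p' \<psi> w) m n x y
      = ind (day X (day Y W)) (m * n * p) (m * n * p') (F_smash (m * n) p p' (\<lambda>i\<in>{..m * n}. i) \<psi>) (assoc_inner p w m n x y)"
    using assoc_inner_natural[OF F_maps_id[of m] F_maps_id[of n] \<psi> xy w]
    by (simp add: F_set.ind_id[OF X xy(1)] F_set.ind_id[OF Y xy(2)] F_smash_id)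
  also have "ind (day X (day Y W)) (m * n * p') (k' * p') (F_smash (m * n) p' p' (compose {..m * n} \<phi> \<omega>) (\<lambda>i\<in>{..p'}. i)) \<dots>
      = ind (day X (day Y W)) (m * n * p) (k' * p') (F_smash (m * n) p p' (compose {..m * n} \<phi> \<omega>) \<psi>) (assoc_inner p w m n x y)"
    using V.ind_compose[OF F_smash_F_maps[OF F_maps_id \<psi>] F_smash_F_maps[OF F_maps_compose[OF \<omega> \<phi>] F_maps_id] c]
      F_smash_compose[OF F_maps_id \<psi> F_maps_compose[OF \<omega> \<phi>] F_maps_id]
    by (simp add: F_maps_compose_id[OF F_maps_compose[OF \<omega> \<phi>]] compose_id_F_maps[OF \<psi>])
  also have "\<dots> = ind (day X (day Y W)) (k * p) (k' * p') (F_smash k p p' \<phi> \<psi>)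
      (ind (day X (day Y W)) (m * n * p) (k * p) (F_smash (m * n) p p \<omega> (\<lambda>i\<in>{..p}. i)) (assoc_inner p w m n x y))"
    using V.ind_compose[OF F_smash_F_maps[OF \<omega> F_maps_id] F_smash_F_maps[OF \<phi> \<psi>] c]
      F_smash_compose[OF \<omega> F_maps_id \<phi> \<psi>]
    by (simp add: F_maps_compose_id[OF \<psi>])
  also have "ind (day X (day Y W)) (m * n * p) (k * p) (F_smash (m * n) p p \<omega> (\<lambda>i\<in>{..p}. i)) (assoc_inner p w m n x y) = assoc_family k p v w"
    unfolding v_eq by (simp add: assoc_family_ind_left[OF \<omega> pair w] assoc_family_pair[OF xy w] assoc_inner_def)
  finally show "assoc_family k' p' (ind (day X Y) k k' \<phi> v) (ind W p p' \<psi> w)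
      = ind (day X (day Y W)) (k * p) (k' * p') (F_smash k p p' \<phi> \<psi>) (assoc_family k p v w)" .
qed

end

text \<open>Equivariance, lost while \<open>w\<close> was held fixed, returns when \<open>g\<close>
  moves \<open>w\<close> together with \<open>v\<close>. On generators it reduces to equivariance of
  the two nested pairs.\<close>

lemma equivariant_family_assoc:
  assumes X: "FG_set G X" and Y: "FG_set G Y" and W: "FG_set G W"
  shows "equivariant_family G (day X Y) W (day X (day Y W)) (assoc_family X Y W)"
  unfolding equivariant_family_def
proof (intro allI ballI)
  interpret X: FG_set G X by fact
  interpret Y: FG_set G Y by fact
  interpret W: FG_set G W by fact
  interpret XY: FG_set G "day X Y" by (intro FG_set_day X Y)
  interpret V: FG_set G "day X (day Y W)" by (intro FG_set_day X Y W)
  note ax = X.F_set_axioms Y.F_set_axioms W.F_set_axioms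
  fix k p g v w assume g: "g \<in> carrier G" and v: "v \<in> points (sp (day X Y) k)" and w: "w \<in> points (sp W p)"
  from ax(1,2) v obtain m n \<omega> x y where \<omega>: "\<omega> \<in> F_maps (m * n) k" and xy: "x \<in> points (sp X m)" "y \<in> points (sp Y n)"
    and v_eq: "v = ind (day X Y) (m * n) k \<omega> (day_pair X Y m n x y)"
    by (rule day_point_ind)
  note pair = day_pair_points[OF ax(1,2) xy]
  have gpair: "act (sp (day X Y) (m * n)) g (day_pair X Y m n x y) = day_pair X Y m n (act (sp X m) g x) (act (sp Y n) g y)"
    using equivariant_family_day_pair[OF X Y] g xy by (simp add: equivariant_family_def)
  have gv: "act (sp (day X Y) k) g v = ind (day X Y) (m * n) k \<omega> (day_pair X Y m n (act (sp X m) g x) (act (sp Y n) g y))"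
    unfolding v_eq by (simp add: XY.act_ind[OF g \<omega> pair] gpair)
  have gyw: "day_pair Y W n p (act (sp Y n) g y) (act (sp W p) g w) = act (sp (day Y W) (n * p)) g (day_pair Y W n p y w)"
    using equivariant_family_day_pair[OF Y W] g xy w by (simp add: equivariant_family_def)
  have gxyw: "day_pair X (day Y W) m (n * p) (act (sp X m) g x) (act (sp (day Y W) (n * p)) g (day_pair Y W n p y w))
      = act (sp (day X (day Y W)) (m * (n * p))) g (day_pair X (day Y W) m (n * p) x (day_pair Y W n p y w))"
    using equivariant_family_day_pair[OF X FG_set_day[OF Y W]] g xy(1) day_pair_points[OF ax(2,3) xy(2) w]
    by (simp add: equivariant_family_def)
  have c: "day_pair X (day Y W) m (n * p) x (day_pair Y W n p y w) \<in> points (sp (day X (day Y W)) (m * n * p))"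
    using day_pair_points[OF ax(1) F_set_day[OF ax(2,3)] xy(1) day_pair_points[OF ax(2,3) xy(2) w]] by (simp only: mult.assoc)
  show "assoc_family X Y W k p (act (sp (day X Y) k) g v) (act (sp W p) g w)
      = act (sp (day X (day Y W)) (k * p)) g (assoc_family X Y W k p v w)"
    unfolding gv unfolding v_eq
    using assoc_family_ind_left[OF ax \<omega> pair w] assoc_family_pair[OF ax xy w]
      assoc_family_ind_left[OF ax \<omega> XY.act_closed[OF g pair] W.act_closed[OF g w]]
      assoc_family_pair[OF ax X.act_closed[OF g xy(1)] Y.act_closed[OF g xy(2)] W.act_closed[OF g w]]
    by (simp add: gpair gyw gxyw V.act_ind[OF g F_smash_F_maps[OF \<omega> F_maps_id] c]) (simp only: mult.assoc)
qed

context
  fixes G :: "('g, 'x) monoid_scheme" and X Y W :: "('g, 'a univ) FG_space"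
  assumes X: "FG_set G X" and Y: "FG_set G Y" and W: "FG_set G W"
begin

lemmas F_sets_assoc = X[THEN FG_set_imp_F_set] Y[THEN FG_set_imp_F_set] W[THEN FG_set_imp_F_set]
  FG_set_day[OF X Y, THEN FG_set_imp_F_set] FG_set_day[OF X FG_set_day[OF Y W], THEN FG_set_imp_F_set]
  FG_set_day[OF FG_set_day[OF X Y] W, THEN FG_set_imp_F_set] FG_set_day[OF X Y] FG_set_day[OF X FG_set_day[OF Y W]]

lemma day_assoc_eq: "day_assoc G X Y W = family_lift (day X Y) W (day X (day Y W)) (assoc_family X Y W)"
  unfolding day_assoc_def
proof (rule the_equality)
  let ?\<alpha> = "family_lift (day X Y) W (day X (day Y W)) (assoc_family X Y W)"
  note iff = FG_maps_iff[OF F_sets_assoc(6) F_sets_assoc(5)]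
  have \<alpha>: "?\<alpha> \<in> F_nat (day (day X Y) W) (day X (day Y W))"
    by (rule family_lift_F_nat[OF F_sets_assoc(4,3,5) natural_family_assoc[OF F_sets_assoc(1-3)]])
  have pair: "?\<alpha> (m * n * p) (day_pair (day X Y) W (m * n) p (day_pair X Y m n x y) w)
      = day_pair X (day Y W) m (n * p) x (day_pair Y W n p y w)"
    if "x \<in> points (sp X m)" "y \<in> points (sp Y n)" "w \<in> points (sp W p)" for m n p x y w
    using that by (simp add: family_lift_pair[OF F_sets_assoc(4,3,5) natural_family_assoc[OF F_sets_assoc(1-3)]]
      day_pair_points[OF F_sets_assoc(1,2)] assoc_family_pair[OF F_sets_assoc(1-3)])
  show "?\<alpha> \<in> FG_maps G (day (day X Y) W) (day X (day Y W)) \<and>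
    (\<forall>m n p. \<forall>x\<in>points (sp X m). \<forall>y\<in>points (sp Y n). \<forall>w\<in>points (sp W p).
        ?\<alpha> (m * n * p) (day_pair (day X Y) W (m * n) p (day_pair X Y m n x y) w)
        = day_pair X (day Y W) m (n * p) x (day_pair Y W n p y w))"
    using \<alpha> pair equivariant_family_lift[OF F_sets_assoc(7) W F_sets_assoc(8) natural_family_assoc[OF F_sets_assoc(1-3)] equivariant_family_assoc[OF X Y W]]
    by (simp add: iff)
  show "\<theta> = ?\<alpha>" if "\<theta> \<in> FG_maps G (day (day X Y) W) (day X (day Y W)) \<and>
    (\<forall>m n p. \<forall>x\<in>points (sp X m). \<forall>y\<in>points (sp Y n). \<forall>w\<in>points (sp W p).
        \<theta> (m * n * p) (day_pair (day X Y) W (m * n) p (day_pair X Y m n x y) w)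
        = day_pair X (day Y W) m (n * p) x (day_pair Y W n p y w))" for \<theta>
    using that by (intro F_nat_day3_eqI[OF F_sets_assoc(1-3) _ \<alpha>]) (auto simp: iff pair)
qed

lemma day_assoc_F_nat: "day_assoc G X Y W \<in> F_nat (day (day X Y) W) (day X (day Y W))"
  unfolding day_assoc_eq by (rule family_lift_F_nat[OF F_sets_assoc(4,3,5) natural_family_assoc[OF F_sets_assoc(1-3)]])

lemma day_assoc_pair:
  assumes "x \<in> points (sp X m)" "y \<in> points (sp Y n)" "w \<in> points (sp W p)"
  shows "day_assoc G X Y W (m * n * p) (day_pair (day X Y) W (m * n) p (day_pair X Y m n x y) w)
    = day_pair X (day Y W) m (n * p) x (day_pair Y W n p y w)"
  using assms by (simp add: day_assoc_eq family_lift_pair[OF F_sets_assoc(4,3,5) natural_family_assoc[OF F_sets_assoc(1-3)]]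
      day_pair_points[OF F_sets_assoc(1,2)] assoc_family_pair[OF F_sets_assoc(1-3)])

end

section \<open>Tensor products of abelian groups\<close>

lemma frag_of_list_append: "frag_of_list (l @ l') = frag_of_list l + frag_of_list l'"
  by (simp add: frag_of_list_def)

lemma frag_of_list_uminus: "frag_of_list (map (\<lambda>(k, ab). (- k, ab)) l) = - frag_of_list l"
  by (induction l) (auto simp: frag_of_list_def)

text \<open>Every coset therefore contains the value of some list, so the choice made in
  \<open>tensor_code\<close> really picks an element of the coset. Negating all coefficients of a
  list accounts for differences.\<close>

lemma frag_of_list_surj:
  fixes c :: "'b \<times> 'b \<Rightarrow>\<^sub>0 int"
  shows "\<exists>l. frag_of_list l = c"
proof (rule free_Abelian_group_induct[of c UNIV])
  show "\<exists>l. frag_of_list l = 0"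
    by (intro exI[of _ "[]"]) (simp add: frag_of_list_def)
  show "\<exists>l. frag_of_list l = frag_of x" for x :: "'b \<times> 'b"
    by (intro exI[of _ "[(1, x)]"]) (simp add: frag_of_list_def)
  fix a b :: "'b \<times> 'b \<Rightarrow>\<^sub>0 int"
  assume "\<exists>l. frag_of_list l = a" "\<exists>l. frag_of_list l = b"
  then obtain l l' where "frag_of_list l = a" "frag_of_list l' = b" by blast
  then have "frag_of_list (l @ map (\<lambda>(k, ab). (- k, ab)) l') = a - b"
    by (simp add: frag_of_list_append frag_of_list_uminus)
  then show "\<exists>l. frag_of_list l = a - b" by blast
qed simp

section \<open>Bilinear maps\<close>

definition bilinear_map ::
    "('u, 'x) monoid_scheme \<Rightarrow> ('u, 'y) monoid_scheme \<Rightarrow> ('u, 'z) monoid_scheme \<Rightarrow> ('u \<Rightarrow> 'u \<Rightarrow> 'u) \<Rightarrow> bool" where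
  "bilinear_map A B C f \<longleftrightarrow>
     (\<forall>a\<in>carrier A. (\<lambda>b. f a b) \<in> hom B C) \<and> (\<forall>b\<in>carrier B. (\<lambda>a. f a b) \<in> hom A C)"

lemma bilinear_mapI:
  assumes "\<And>a b. a \<in> carrier A \<Longrightarrow> b \<in> carrier B \<Longrightarrow> f a b \<in> carrier C"
    and "\<And>a a' b. a \<in> carrier A \<Longrightarrow> a' \<in> carrier A \<Longrightarrow> b \<in> carrier B \<Longrightarrow> f (a \<otimes>\<^bsub>A\<^esub> a') b = f a b \<otimes>\<^bsub>C\<^esub> f a' b"
    and "\<And>a b b'. a \<in> carrier A \<Longrightarrow> b \<in> carrier B \<Longrightarrow> b' \<in> carrier B \<Longrightarrow> f a (b \<otimes>\<^bsub>B\<^esub> b') = f a b \<otimes>\<^bsub>C\<^esub> f a b'"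
  shows "bilinear_map A B C f"
  using assms by (auto simp: bilinear_map_def hom_def)

lemma bilinear_map_closed:
  "bilinear_map A B C f \<Longrightarrow> a \<in> carrier A \<Longrightarrow> b \<in> carrier B \<Longrightarrow> f a b \<in> carrier C"
  by (auto simp: bilinear_map_def hom_def)

lemma bilinear_map_mult_left: "bilinear_map A B C f \<Longrightarrow> a \<in> carrier A \<Longrightarrow> a' \<in> carrier A \<Longrightarrow> b \<in> carrier B
    \<Longrightarrow> f (a \<otimes>\<^bsub>A\<^esub> a') b = f a b \<otimes>\<^bsub>C\<^esub> f a' b"
  by (auto simp: bilinear_map_def hom_def)

lemma bilinear_map_mult_right: "bilinear_map A B C f \<Longrightarrow> a \<in> carrier A \<Longrightarrow> b \<in> carrier B \<Longrightarrow> b' \<in> carrier B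
    \<Longrightarrow> f a (b \<otimes>\<^bsub>B\<^esub> b') = f a b \<otimes>\<^bsub>C\<^esub> f a b'"
  by (auto simp: bilinear_map_def hom_def)

text \<open>Quotients are treated in one piece because \<open>free_Abelian_group_induct\<close>
  builds elements by subtraction; the induction on tensors below inherits that shape.\<close>

lemma hom_diff:
  assumes "h \<in> hom G H" "group G" "group H" "x \<in> carrier G" "y \<in> carrier G"
  shows "h (x \<otimes>\<^bsub>G\<^esub> inv\<^bsub>G\<^esub> y) = h x \<otimes>\<^bsub>H\<^esub> inv\<^bsub>H\<^esub> h y"
proof -
  interpret group_hom G H h
    using assms by (simp add: group_hom_def group_hom_axioms_def)
  show ?thesis using assms by simp
qed

section \<open>The coded quotient of the free abelian group\<close>

definition tensor_class ::
    "('a univ, 'x) monoid_scheme \<Rightarrow> ('a univ, 'y) monoid_scheme \<Rightarrow> ('a univ \<times> 'a univ \<Rightarrow>\<^sub>0 int) \<Rightarrow> 'a univ" where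
  "tensor_class A B c = tensor_code (tensor_subgroup A B #>\<^bsub>free_Abelian_group (carrier A \<times> carrier B)\<^esub> c)"

lemma pure_tensor_eq: "pure_tensor A B a b = tensor_class A B (frag_of (a, b))"
  by (simp add: pure_tensor_def tensor_class_def)

context
  fixes A :: "('a univ, 'x) monoid_scheme" and B :: "('a univ, 'y) monoid_scheme"
  assumes A: "comm_group A" and B: "comm_group B"
begin

interpretation A: comm_group A by (rule A)
interpretation B: comm_group B by (rule B)

abbreviation "FAB \<equiv> free_Abelian_group (carrier A \<times> carrier B)"

interpretation F: comm_group FAB by (rule abelian_free_Abelian_group)

lemma tensor_relators_subset: "tensor_relators A B \<subseteq> carrier FAB"
  unfolding tensor_relators_def
  by (auto dest!: subsetD[OF keys_diff])

lemma subgroup_tensor_subgroup: "subgroup (tensor_subgroup A B) FAB"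
  unfolding tensor_subgroup_def by (rule F.generate_is_subgroup[OF tensor_relators_subset])

lemma normal_tensor_subgroup: "tensor_subgroup A B \<lhd> FAB"
  by (rule F.subgroup_imp_normal[OF subgroup_tensor_subgroup])

interpretation N: normal "tensor_subgroup A B" FAB by (rule normal_tensor_subgroup)

text \<open>Injectivity of the coding: a code determines a list whose value lies in the coset, so
  cosets with equal codes meet and hence coincide.\<close>

lemma tensor_class_eq_iff:
  assumes "x \<in> carrier FAB" "y \<in> carrier FAB"
  shows "tensor_class A B x = tensor_class A B y \<longleftrightarrow> tensor_subgroup A B #>\<^bsub>FAB\<^esub> x = tensor_subgroup A B #>\<^bsub>FAB\<^esub> y"
    (is "_ \<longleftrightarrow> ?c x = ?c y")
proof
  have some: "frag_of_list (SOME l. frag_of_list l \<in> ?c z) \<in> ?c z" if "z \<in> carrier FAB" for z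
    using frag_of_list_surj[of z] F.rcos_self[OF that subgroup_tensor_subgroup] by (metis someI)
  assume "tensor_class A B x = tensor_class A B y"
  then have "(SOME l. frag_of_list l \<in> ?c x) = (SOME l. frag_of_list l \<in> ?c y)"
    by (simp add: tensor_class_def tensor_code_def)
  then have "?c x \<inter> ?c y \<noteq> {}"
    using some[OF assms(1)] some[OF assms(2)] by auto
  then show "?c x = ?c y"
    using assms F.rcos_disjoint[OF subgroup_tensor_subgroup] N.subset
    by (metis F.rcosetsI disjnt_def pairwiseD)
qed (simp add: tensor_class_def)

lemma carrier_tensor_group: "carrier (tensor_group A B) = tensor_class A B ` carrier FAB"
  by (simp add: tensor_group_def Let_def tensor_quotient_def carrier_FactGroup tensor_class_def image_image)

lemma tensor_class_decode:
  assumes "x \<in> carrier FAB"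
  shows "inv_into (carrier (tensor_quotient A B)) tensor_code (tensor_class A B x) = tensor_subgroup A B #>\<^bsub>FAB\<^esub> x"
proof -
  have "inj_on tensor_code (carrier (tensor_quotient A B))"
    using tensor_class_eq_iff by (auto simp: inj_on_def tensor_quotient_def carrier_FactGroup tensor_class_def)
  then show ?thesis
    unfolding tensor_class_def by (rule inv_into_f_f) (use assms in \<open>auto simp: tensor_quotient_def carrier_FactGroup\<close>)
qed

lemma mult_tensor_group:
  assumes "x \<in> carrier FAB" "y \<in> carrier FAB"
  shows "tensor_class A B x \<otimes>\<^bsub>tensor_group A B\<^esub> tensor_class A B y = tensor_class A B (x + y)"
  using N.rcos_sum[OF assms]
  by (simp add: tensor_group_def Let_def tensor_class_decode[OF assms(1)] tensor_class_decode[OF assms(2)])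
    (simp add: tensor_quotient_def tensor_class_def)

lemma one_tensor_group: "\<one>\<^bsub>tensor_group A B\<^esub> = tensor_class A B 0"
  using F.coset_join2[OF F.one_closed subgroup_tensor_subgroup] subgroup.one_closed[OF subgroup_tensor_subgroup]
  by (simp add: tensor_group_def Let_def tensor_class_def tensor_quotient_def)

lemma FAB_add: "x \<in> carrier FAB \<Longrightarrow> y \<in> carrier FAB \<Longrightarrow> x + y \<in> carrier FAB"
  using F.m_closed[of x y] by simp

lemma FAB_uminus: "x \<in> carrier FAB \<Longrightarrow> - x \<in> carrier FAB"
  using F.inv_closed[of x] by simp

lemma comm_group_tensor_group: "comm_group (tensor_group A B)"
proof (rule comm_groupI)
  fix x assume "x \<in> carrier (tensor_group A B)"
  then obtain c where c: "c \<in> carrier FAB" "x = tensor_class A B c"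
    unfolding carrier_tensor_group by blast
  have "tensor_class A B (- c) \<otimes>\<^bsub>tensor_group A B\<^esub> x = \<one>\<^bsub>tensor_group A B\<^esub>"
    using c FAB_uminus by (simp add: mult_tensor_group one_tensor_group del: carrier_free_Abelian_group_iff)
  then show "\<exists>y\<in>carrier (tensor_group A B). y \<otimes>\<^bsub>tensor_group A B\<^esub> x = \<one>\<^bsub>tensor_group A B\<^esub>"
    unfolding carrier_tensor_group using FAB_uminus[OF c(1)] by blast
qed (use F.one_closed in \<open>auto simp: carrier_tensor_group mult_tensor_group one_tensor_group FAB_add ac_simps
    simp del: carrier_free_Abelian_group_iff\<close>)

interpretation T: comm_group "tensor_group A B" by (rule comm_group_tensor_group)

lemma tensor_class_hom: "tensor_class A B \<in> hom FAB (tensor_group A B)"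
  by (auto simp: hom_def carrier_tensor_group mult_tensor_group simp del: carrier_free_Abelian_group_iff)

lemma tensor_class_diff:
  assumes "x \<in> carrier FAB" "y \<in> carrier FAB"
  shows "tensor_class A B (x - y) = tensor_class A B x \<otimes>\<^bsub>tensor_group A B\<^esub> inv\<^bsub>tensor_group A B\<^esub> tensor_class A B y"
  using hom_diff[OF tensor_class_hom F.is_group T.is_group assms] assms by simp

lemma pure_tensor_closed: "a \<in> carrier A \<Longrightarrow> b \<in> carrier B \<Longrightarrow> pure_tensor A B a b \<in> carrier (tensor_group A B)"
  by (simp add: pure_tensor_eq carrier_tensor_group)

text \<open>Both kinds of relators have the shape u - v - w, so one argument gives additivity in
  either variable.\<close>

lemma tensor_class_relator:
  assumes "frag_of u - frag_of v - frag_of w \<in> tensor_relators A B"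
    and "u \<in> carrier A \<times> carrier B" "v \<in> carrier A \<times> carrier B" "w \<in> carrier A \<times> carrier B"
  shows "tensor_class A B (frag_of u) = tensor_class A B (frag_of v) \<otimes>\<^bsub>tensor_group A B\<^esub> tensor_class A B (frag_of w)"
proof -
  have c: "frag_of u \<in> carrier FAB" "frag_of v \<in> carrier FAB" "frag_of w \<in> carrier FAB"
    using assms by simp_all
  then have vw: "frag_of v + frag_of w \<in> carrier FAB" using FAB_add by blast
  have "frag_of u - frag_of v - frag_of w \<in> tensor_subgroup A B"
    using assms(1) unfolding tensor_subgroup_def by (rule generate.incl)
  then have "frag_of u \<in> tensor_subgroup A B #>\<^bsub>FAB\<^esub> (frag_of v + frag_of w)"
    unfolding r_coset_def by (auto intro!: bexI[of _ "frag_of u - frag_of v - frag_of w"] simp: algebra_simps)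
  then have "tensor_class A B (frag_of u) = tensor_class A B (frag_of v + frag_of w)"
    using F.repr_independence[OF _ vw subgroup_tensor_subgroup] by (simp add: tensor_class_def)
  then show ?thesis by (simp add: mult_tensor_group[OF c(2,3)])
qed

lemma bilinear_pure_tensor: "bilinear_map A B (tensor_group A B) (pure_tensor A B)"
proof (rule bilinear_mapI)
  fix a a' b assume "a \<in> carrier A" "a' \<in> carrier A" "b \<in> carrier B"
  then show "pure_tensor A B (a \<otimes>\<^bsub>A\<^esub> a') b = pure_tensor A B a b \<otimes>\<^bsub>tensor_group A B\<^esub> pure_tensor A B a' b"
    unfolding pure_tensor_eq by (intro tensor_class_relator) (auto simp: tensor_relators_def)
next
  fix a b b' assume "a \<in> carrier A" "b \<in> carrier B" "b' \<in> carrier B"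
  then show "pure_tensor A B a (b \<otimes>\<^bsub>B\<^esub> b') = pure_tensor A B a b \<otimes>\<^bsub>tensor_group A B\<^esub> pure_tensor A B a b'"
    unfolding pure_tensor_eq by (intro tensor_class_relator) (auto simp: tensor_relators_def)
qed (rule pure_tensor_closed)

lemma tensor_group_induct [consumes 1, case_names pure one diff]:
  assumes "t \<in> carrier (tensor_group A B)"
    and pure: "\<And>a b. a \<in> carrier A \<Longrightarrow> b \<in> carrier B \<Longrightarrow> P (pure_tensor A B a b)"
    and one: "P \<one>\<^bsub>tensor_group A B\<^esub>"
    and diff: "\<And>s t. s \<in> carrier (tensor_group A B) \<Longrightarrow> t \<in> carrier (tensor_group A B) \<Longrightarrow> P s \<Longrightarrow> P t
      \<Longrightarrow> P (s \<otimes>\<^bsub>tensor_group A B\<^esub> inv\<^bsub>tensor_group A B\<^esub> t)"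
  shows "P t"
proof -
  from assms(1) obtain c where c: "c \<in> carrier FAB" "t = tensor_class A B c"
    unfolding carrier_tensor_group by blast
  have "P (tensor_class A B c)"
  proof (rule free_Abelian_group_induct)
    show "Poly_Mapping.keys c \<subseteq> carrier A \<times> carrier B" using c by simp
    show "P (tensor_class A B 0)" using one by (simp add: one_tensor_group)
    show "P (tensor_class A B (frag_of x))" if "x \<in> carrier A \<times> carrier B" for x
      using that pure by (auto simp: pure_tensor_eq)
    show "P (tensor_class A B (x - y))"
      if "Poly_Mapping.keys x \<subseteq> carrier A \<times> carrier B" "Poly_Mapping.keys y \<subseteq> carrier A \<times> carrier B"
        "P (tensor_class A B x)" "P (tensor_class A B y)" for x y
      using that tensor_class_diff[of x y] diff[of "tensor_class A B x" "tensor_class A B y"]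
      by (simp add: carrier_tensor_group)
  qed
  then show ?thesis using c by simp
qed

lemma tensor_hom_eqI:
  assumes "h \<in> hom (tensor_group A B) C" "k \<in> hom (tensor_group A B) C" "group C"
    and "\<And>a b. a \<in> carrier A \<Longrightarrow> b \<in> carrier B \<Longrightarrow> h (pure_tensor A B a b) = k (pure_tensor A B a b)"
    and "t \<in> carrier (tensor_group A B)"
  shows "h t = k t"
  using assms(5)
proof (induction rule: tensor_group_induct)
  case one
  then show ?case using assms hom_one[OF _ T.is_group] by metis
next
  case (diff s t)
  then show ?case
    by (simp add: hom_diff[OF assms(1) T.is_group assms(3)] hom_diff[OF assms(2) T.is_group assms(3)])
qed (rule assms(4))

text \<open>The free abelian group supplies a homomorphism extending \<open>f\<close>. Bilinearity
  says that it kills the relators, so it factors through the quotient. Uniqueness holds because pure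
  tensors generate.\<close>

lemma tensor_lift_unique_exists:
  assumes C: "comm_group C" and f: "bilinear_map A B C f"
  shows "\<exists>!h. h \<in> hom (tensor_group A B) C \<inter> extensional (carrier (tensor_group A B)) \<and>
     (\<forall>a\<in>carrier A. \<forall>b\<in>carrier B. h (pure_tensor A B a b) = f a b)"
proof (rule ex_ex1I)
  interpret C: comm_group C by (rule C)
  note f_closed = bilinear_map_closed[OF f]
  have "(\<lambda>(a, b). f a b) ` (carrier A \<times> carrier B) \<subseteq> carrier C"
    using f_closed by auto
  then obtain h where h: "h \<in> hom FAB C" and h_of: "\<And>x. x \<in> carrier A \<times> carrier B \<Longrightarrow> h (frag_of x) = (\<lambda>(a, b). f a b) x"
    using C.free_Abelian_group_universal by metis
  interpret h: group_hom FAB C h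
    using h F.is_group C.is_group by (simp add: group_hom_def group_hom_axioms_def)
  have h_rel: "h (frag_of u - frag_of v - frag_of w) = \<one>\<^bsub>C\<^esub>"
    if "u \<in> carrier A \<times> carrier B" "v \<in> carrier A \<times> carrier B" "w \<in> carrier A \<times> carrier B"
      "h (frag_of u) = h (frag_of v) \<otimes>\<^bsub>C\<^esub> h (frag_of w)" for u v w
  proof -
    have c: "frag_of u \<in> carrier FAB" "frag_of v \<in> carrier FAB" "frag_of w \<in> carrier FAB"
      using that by simp_all
    then have vw: "frag_of v + frag_of w \<in> carrier FAB" using FAB_add by blast
    have "h (frag_of u \<otimes>\<^bsub>FAB\<^esub> inv\<^bsub>FAB\<^esub> (frag_of v \<otimes>\<^bsub>FAB\<^esub> frag_of w)) = \<one>\<^bsub>C\<^esub>"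
      using c vw that(4) by (simp add: hom_diff[OF h F.is_group C.is_group] del: mult_free_Abelian_group inv_free_Abelian_group carrier_free_Abelian_group_iff)
    moreover have e: "frag_of u \<otimes>\<^bsub>FAB\<^esub> inv\<^bsub>FAB\<^esub> (frag_of v \<otimes>\<^bsub>FAB\<^esub> frag_of w) = frag_of u - frag_of v - frag_of w"
      using vw by (simp add: algebra_simps)
    ultimately show ?thesis by (simp only: e)
  qed
  have "h x = \<one>\<^bsub>C\<^esub>" if "x \<in> tensor_relators A B" for x
    using that unfolding tensor_relators_def
    by (auto intro!: h_rel simp: h_of bilinear_map_mult_left[OF f] bilinear_map_mult_right[OF f])
  then have "tensor_relators A B \<subseteq> kernel FAB C h"
    using tensor_relators_subset unfolding kernel_def by blast
  then have "tensor_subgroup A B \<subseteq> kernel FAB C h"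
    unfolding tensor_subgroup_def by (rule F.generate_subgroup_incl[OF _ h.subgroup_kernel])
  with h.FactGroup_universal_kernel[OF normal_tensor_subgroup]
  obtain k where k: "\<And>x. x \<in> carrier FAB \<Longrightarrow> k (tensor_subgroup A B #>\<^bsub>FAB\<^esub> x) = h x"
    by metis
  \<comment> \<open>The factored map is transported along the coding: a code is first turned back
    into its coset. The restriction makes \<open>l\<close> extensional, without which uniqueness
    would fail.\<close>
  define l where "l = (\<lambda>t\<in>carrier (tensor_group A B). k (inv_into (carrier (tensor_quotient A B)) tensor_code t))"
  have l: "l (tensor_class A B x) = h x" if "x \<in> carrier FAB" for x
    using that by (simp add: l_def carrier_tensor_group tensor_class_decode k del: carrier_free_Abelian_group_iff)
  have "l \<in> hom (tensor_group A B) C"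
  proof (rule homI)
    fix s t assume "s \<in> carrier (tensor_group A B)" "t \<in> carrier (tensor_group A B)"
    then show "l (s \<otimes>\<^bsub>tensor_group A B\<^esub> t) = l s \<otimes>\<^bsub>C\<^esub> l t"
      using h.hom_mult by (auto simp: carrier_tensor_group mult_tensor_group l FAB_add simp del: carrier_free_Abelian_group_iff)
  qed (use h.hom_closed in \<open>auto simp: carrier_tensor_group l simp del: carrier_free_Abelian_group_iff\<close>)
  moreover have "l (pure_tensor A B a b) = f a b" if "a \<in> carrier A" "b \<in> carrier B" for a b
    using that l[of "frag_of (a, b)"] h_of[of "(a, b)"] by (simp add: pure_tensor_eq)
  ultimately show "\<exists>h. h \<in> hom (tensor_group A B) C \<inter> extensional (carrier (tensor_group A B)) \<and>
     (\<forall>a\<in>carrier A. \<forall>b\<in>carrier B. h (pure_tensor A B a b) = f a b)"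
    by (intro exI[of _ l]) (auto simp: l_def)
next
  fix h k
  assume h: "h \<in> hom (tensor_group A B) C \<inter> extensional (carrier (tensor_group A B)) \<and>
      (\<forall>a\<in>carrier A. \<forall>b\<in>carrier B. h (pure_tensor A B a b) = f a b)"
    and k: "k \<in> hom (tensor_group A B) C \<inter> extensional (carrier (tensor_group A B)) \<and>
      (\<forall>a\<in>carrier A. \<forall>b\<in>carrier B. k (pure_tensor A B a b) = f a b)"
  interpret C: comm_group C by (rule C)
  show "h = k"
  proof (rule extensionalityI)
    show "h t = k t" if "t \<in> carrier (tensor_group A B)" for t
      by (rule tensor_hom_eqI[OF _ _ C.is_group _ that]) (use h k in auto)
  qed (use h k in auto)
qed

context
  fixes C :: "('a univ, 'z) monoid_scheme" and f :: "'a univ \<Rightarrow> 'a univ \<Rightarrow> 'a univ"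
  assumes C: "comm_group C" and f: "bilinear_map A B C f"
begin

lemma tensor_lift_properties:
  "tensor_lift A B C f \<in> hom (tensor_group A B) C \<inter> extensional (carrier (tensor_group A B)) \<and>
     (\<forall>a\<in>carrier A. \<forall>b\<in>carrier B. tensor_lift A B C f (pure_tensor A B a b) = f a b)"
  unfolding tensor_lift_def by (rule theI'[OF tensor_lift_unique_exists[OF C f]])

lemma tensor_lift_hom: "tensor_lift A B C f \<in> hom (tensor_group A B) C"
  using tensor_lift_properties by blast

lemma tensor_lift_extensional: "tensor_lift A B C f \<in> extensional (carrier (tensor_group A B))"
  using tensor_lift_properties by blast

lemma tensor_lift_pure: "a \<in> carrier A \<Longrightarrow> b \<in> carrier B \<Longrightarrow> tensor_lift A B C f (pure_tensor A B a b) = f a b"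
  using tensor_lift_properties by blast

end

end

section \<open>Abelian G-groups\<close>

lemma comm_group_cong:
  assumes "comm_group H" "carrier K = carrier H" "mult K = mult H" "one K = one H"
  shows "comm_group K"
proof -
  interpret H: comm_group H by fact
  show ?thesis
    by (rule comm_groupI) (auto simp: assms H.m_ac intro: H.l_inv_ex)
qed

lemma abelian_G_groupI:
  assumes G: "group G" and A: "comm_group A"
    and ext: "\<And>g. g \<in> carrier G \<Longrightarrow> gact A g \<in> extensional (carrier A)"
    and hom: "\<And>g. g \<in> carrier G \<Longrightarrow> gact A g \<in> hom A A"
    and one: "\<And>a. a \<in> carrier A \<Longrightarrow> gact A \<one>\<^bsub>G\<^esub> a = a"
    and mult: "\<And>g h a. g \<in> carrier G \<Longrightarrow> h \<in> carrier G \<Longrightarrow> a \<in> carrier A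
      \<Longrightarrow> gact A (g \<otimes>\<^bsub>G\<^esub> h) a = gact A g (gact A h a)"
  shows "abelian_G_group G A"
proof -
  interpret A: comm_group A by fact
  interpret act: group_action G "carrier A" "gact A"
    by (rule group_actionI[OF G ext _ one mult]) (use hom in \<open>auto simp: hom_def\<close>)
  have aut: "gact A g \<in> auto A" if "g \<in> carrier G" for g
    using act.bij_prop0[OF that] hom[OF that] by (simp add: auto_def)
  have "gact A \<in> hom G (BijGroup (carrier A))"
    using act.group_hom group_hom.homh by blast
  then have "gact A \<in> hom G (AutoGroup A)"
    using aut by (auto simp: hom_def AutoGroup_def)
  then show ?thesis
    using G A A.AutoGroup by (simp add: abelian_G_group_def group_hom_def group_hom_axioms_def)
qed

locale G_module =
  fixes G :: "('g, 'x) monoid_scheme" and A :: "('g, 'u) G_group"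
  assumes abelian_G_group: "abelian_G_group G A"
begin

sublocale comm_group A
  using abelian_G_group by (simp add: abelian_G_group_def)

interpretation act: group_hom G "AutoGroup A" "gact A"
  using abelian_G_group by (simp add: abelian_G_group_def)

lemma gact_auto: "g \<in> carrier G \<Longrightarrow> gact A g \<in> auto A"
  using act.hom_closed by (simp add: AutoGroup_def)

lemma gact_hom: "g \<in> carrier G \<Longrightarrow> gact A g \<in> hom A A"
  using gact_auto by (simp add: auto_def)

lemma gact_closed: "g \<in> carrier G \<Longrightarrow> a \<in> carrier A \<Longrightarrow> gact A g a \<in> carrier A"
  using gact_hom by (auto simp: hom_def)

lemma gact_one: "a \<in> carrier A \<Longrightarrow> gact A \<one>\<^bsub>G\<^esub> a = a"
  using act.hom_one by (simp add: AutoGroup_def BijGroup_def)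

lemma gact_mult:
  assumes "g \<in> carrier G" "h \<in> carrier G" "a \<in> carrier A"
  shows "gact A (g \<otimes>\<^bsub>G\<^esub> h) a = gact A g (gact A h a)"
  using act.hom_mult[OF assms(1,2)] gact_auto[OF assms(1)] gact_auto[OF assms(2)] assms(3)
  by (simp add: AutoGroup_def BijGroup_def auto_def compose_eq)

end

subsection \<open>Tensor products of abelian G-groups\<close>

lemma carrier_tensor_G [simp]: "carrier (tensor_G A B) = carrier (tensor_group A B)"
  by (simp add: tensor_G_def)

lemma mult_tensor_G [simp]: "mult (tensor_G A B) = mult (tensor_group A B)"
  by (simp add: tensor_G_def)

lemma one_tensor_G [simp]: "one (tensor_G A B) = one (tensor_group A B)"
  by (simp add: tensor_G_def)

lemma hom_tensor_G [simp]: "hom (tensor_G A B) C = hom (tensor_group A B) C" "hom C (tensor_G A B) = hom C (tensor_group A B)"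
  by (simp_all add: hom_def)

lemma bilinear_map_tensor_G [simp]: "bilinear_map A B (tensor_G C D) = bilinear_map A B (tensor_group C D)"
  by (simp add: bilinear_map_def fun_eq_iff)

lemma comm_group_tensor_G: "comm_group A \<Longrightarrow> comm_group B \<Longrightarrow> comm_group (tensor_G A B)"
  by (rule comm_group_cong[OF comm_group_tensor_group]) simp_all

lemma bilinear_map_compose:
  assumes "bilinear_map A' B' C f" "h \<in> hom A A'" "k \<in> hom B B'"
  shows "bilinear_map A B C (\<lambda>a b. f (h a) (k b))"
  using assms by (auto simp: bilinear_map_def hom_def Pi_def)

lemma bilinear_tensor_hom:
  assumes "comm_group A'" "comm_group B'" "h \<in> hom A A'" "k \<in> hom B B'"
  shows "bilinear_map A B (tensor_group A' B') (\<lambda>a b. pure_tensor A' B' (h a) (k b))"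
  by (rule bilinear_map_compose[OF bilinear_pure_tensor[OF assms(1,2)] assms(3,4)])

lemma gact_tensor_G:
  assumes "abelian_G_group G A" "abelian_G_group G B" "g \<in> carrier G"
  shows "gact (tensor_G A B) g \<in> hom (tensor_group A B) (tensor_group A B)"
    and "gact (tensor_G A B) g \<in> extensional (carrier (tensor_group A B))"
    and "a \<in> carrier A \<Longrightarrow> b \<in> carrier B \<Longrightarrow>
      gact (tensor_G A B) g (pure_tensor A B a b) = pure_tensor A B (gact A g a) (gact B g b)"
proof -
  interpret A: G_module G A by (rule G_module.intro) fact
  interpret B: G_module G B by (rule G_module.intro) fact
  note ax = A.comm_group_axioms B.comm_group_axioms
  note lift = comm_group_tensor_group[OF ax] bilinear_tensor_hom[OF ax A.gact_hom[OF assms(3)] B.gact_hom[OF assms(3)]]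
  have eq: "gact (tensor_G A B) g = tensor_lift A B (tensor_group A B) (\<lambda>a b. pure_tensor A B (gact A g a) (gact B g b))"
    by (simp add: tensor_G_def)
  show "gact (tensor_G A B) g \<in> hom (tensor_group A B) (tensor_group A B)"
    "gact (tensor_G A B) g \<in> extensional (carrier (tensor_group A B))"
    "a \<in> carrier A \<Longrightarrow> b \<in> carrier B \<Longrightarrow>
      gact (tensor_G A B) g (pure_tensor A B a b) = pure_tensor A B (gact A g a) (gact B g b)"
    unfolding eq by (simp_all add: tensor_lift_hom[OF ax lift] tensor_lift_extensional[OF ax lift] tensor_lift_pure[OF ax lift])
qed

text \<open>Each action law equates two homomorphisms out of the tensor product, so it can be tested
  on pure tensors, where the action is diagonal.\<close>

lemma abelian_G_group_tensor_G:
  assumes G: "group G" and AB: "abelian_G_group G A" "abelian_G_group G B"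
  shows "abelian_G_group G (tensor_G A B)"
proof -
  interpret G: group G by fact
  interpret A: G_module G A by (rule G_module.intro) fact
  interpret B: G_module G B by (rule G_module.intro) fact
  note ax = A.comm_group_axioms B.comm_group_axioms
  interpret T: comm_group "tensor_group A B" by (rule comm_group_tensor_group[OF ax])
  note act = gact_tensor_G[OF AB]
  show ?thesis
  proof (rule abelian_G_groupI[OF G comm_group_tensor_G[OF ax]])
    fix t assume t: "t \<in> carrier (tensor_G A B)"
    have "(\<lambda>t. t) \<in> hom (tensor_group A B) (tensor_group A B)" by (auto simp: hom_def)
    from tensor_hom_eqI[OF ax act(1)[OF G.one_closed] this T.is_group]
    show "gact (tensor_G A B) \<one>\<^bsub>G\<^esub> t = t"
      using t by (simp add: act A.gact_one B.gact_one)
    fix g h assume gh: "g \<in> carrier G" "h \<in> carrier G"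
    have "(\<lambda>t. gact (tensor_G A B) g (gact (tensor_G A B) h t)) \<in> hom (tensor_group A B) (tensor_group A B)"
      using act(1)[OF gh(1)] act(1)[OF gh(2)] by (auto simp: hom_def Pi_def)
    from tensor_hom_eqI[OF ax act(1)[OF G.m_closed[OF gh]] this T.is_group]
    show "gact (tensor_G A B) (g \<otimes>\<^bsub>G\<^esub> h) t = gact (tensor_G A B) g (gact (tensor_G A B) h t)"
      using t gh by (simp add: act A.gact_mult B.gact_mult A.gact_closed B.gact_closed)
  qed (simp_all add: act)
qed

lemma comm_group_integers_G: "comm_group integers_G"
proof (rule comm_groupI)
  fix x :: "'a univ" assume "x \<in> carrier integers_G"
  then obtain k where "x = Z k" by (auto simp: integers_G_def)
  then show "\<exists>y\<in>carrier integers_G. y \<otimes>\<^bsub>integers_G\<^esub> x = \<one>\<^bsub>integers_G\<^esub>"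
    by (intro bexI[of _ "Z (- k)"]) (auto simp: integers_G_def)
qed (auto simp: integers_G_def)

lemma abelian_G_group_integers_G: "group G \<Longrightarrow> abelian_G_group G integers_G"
proof (rule abelian_G_groupI[OF _ comm_group_integers_G])
  assume "group G"
  interpret group G by fact
  show "gact integers_G (g \<otimes>\<^bsub>G\<^esub> h) a = gact integers_G g (gact integers_G h a)"
    if "a \<in> carrier integers_G" for g h and a :: "'c univ"
    using that by (auto simp: integers_G_def)
qed (auto simp: integers_G_def hom_def)

text \<open>Additivity in the exponent holds in any group; compatibility with products in
  \<open>A\<close> is where commutativity enters.\<close>

lemma bilinear_int_pow:
  assumes "comm_group A"
  shows "bilinear_map integers_G A A (\<lambda>z a. a [^]\<^bsub>A\<^esub> the_Z z)" "bilinear_map A integers_G A (\<lambda>a z. a [^]\<^bsub>A\<^esub> the_Z z)"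
proof -
  interpret comm_group A by fact
  show "bilinear_map integers_G A A (\<lambda>z a. a [^]\<^bsub>A\<^esub> the_Z z)" "bilinear_map A integers_G A (\<lambda>a z. a [^]\<^bsub>A\<^esub> the_Z z)"
    by (auto intro!: bilinear_mapI simp: integers_G_def int_pow_mult int_pow_distrib)
qed

subsection \<open>Associativity of the tensor product\<close>

context
  fixes A B C :: "('g, 'a univ) G_group"
  assumes A: "comm_group A" and B: "comm_group B" and C: "comm_group C"
begin

interpretation A: comm_group A by (rule A)
interpretation B: comm_group B by (rule B)
interpretation C: comm_group C by (rule C)

lemma pure3_bilinear:
  assumes "c \<in> carrier C"
  shows "bilinear_map A B (tensor_group A (tensor_G B C)) (\<lambda>a b. pure_tensor A (tensor_G B C) a (pure_tensor B C b c))"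
proof (rule bilinear_map_compose[OF bilinear_pure_tensor[OF A comm_group_tensor_G[OF B C]]])
  show "(\<lambda>b. pure_tensor B C b c) \<in> hom B (tensor_G B C)"
    using bilinear_pure_tensor[OF B C] assms by (auto simp: bilinear_map_def)
qed (simp add: hom_def Pi_def)

lemma tensor3_hom_eqI:
  assumes h: "h \<in> hom (tensor_group (tensor_G A B) C) D" "k \<in> hom (tensor_group (tensor_G A B) C) D" and D: "group D"
    and eq: "\<And>a b c. a \<in> carrier A \<Longrightarrow> b \<in> carrier B \<Longrightarrow> c \<in> carrier C
      \<Longrightarrow> h (pure_tensor (tensor_G A B) C (pure_tensor A B a b) c) = k (pure_tensor (tensor_G A B) C (pure_tensor A B a b) c)"
    and t: "t \<in> carrier (tensor_group (tensor_G A B) C)"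
  shows "h t = k t"
proof (rule tensor_hom_eqI[OF comm_group_tensor_G[OF A B] C h D _ t])
  fix s c assume s: "s \<in> carrier (tensor_G A B)" and c: "c \<in> carrier C"
  have "(\<lambda>s. pure_tensor (tensor_G A B) C s c) \<in> hom (tensor_group A B) (tensor_group (tensor_G A B) C)"
    using bilinear_pure_tensor[OF comm_group_tensor_G[OF A B] C] c by (auto simp: bilinear_map_def)
  then have hom: "(\<lambda>s. l (pure_tensor (tensor_G A B) C s c)) \<in> hom (tensor_group A B) D"
    if "l \<in> hom (tensor_group (tensor_G A B) C) D" for l
    using that by (auto simp: hom_def Pi_def)
  show "h (pure_tensor (tensor_G A B) C s c) = k (pure_tensor (tensor_G A B) C s c)"
    using tensor_hom_eqI[OF A B hom[OF h(1)] hom[OF h(2)] D] s c by (simp add: eq)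
qed

text \<open>The same currying as for the Day convolution: for fixed \<open>c\<close> lift in
  \<open>(a, b)\<close>, then lift the result in \<open>(s, c)\<close>. Additivity in
  \<open>c\<close> compares two homomorphisms in \<open>s\<close>, so it too is tested on pure
  tensors.\<close>

lemma tensor_assoc_unique_exists:
  "\<exists>!h. h \<in> hom (tensor_G (tensor_G A B) C) (tensor_G A (tensor_G B C))
         \<inter> extensional (carrier (tensor_G (tensor_G A B) C)) \<and>
     (\<forall>a\<in>carrier A. \<forall>b\<in>carrier B. \<forall>c\<in>carrier C.
        h (pure_tensor (tensor_G A B) C (pure_tensor A B a b) c)
        = pure_tensor A (tensor_G B C) a (pure_tensor B C b c))"
proof (rule ex_ex1I)
  let ?T = "tensor_group A (tensor_G B C)"
  have T: "comm_group ?T" by (intro comm_group_tensor_group comm_group_tensor_G A B C)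
  interpret T: comm_group ?T by (rule T)
  define f where "f = (\<lambda>s c. tensor_lift A B ?T (\<lambda>a b. pure_tensor A (tensor_G B C) a (pure_tensor B C b c)) s)"
  have f_hom: "(\<lambda>s. f s c) \<in> hom (tensor_group A B) ?T" if "c \<in> carrier C" for c
    unfolding f_def using tensor_lift_hom[OF A B T pure3_bilinear[OF that]] .
  have f_pure: "f (pure_tensor A B a b) c = pure_tensor A (tensor_G B C) a (pure_tensor B C b c)"
    if "a \<in> carrier A" "b \<in> carrier B" "c \<in> carrier C" for a b c
    unfolding f_def using tensor_lift_pure[OF A B T pure3_bilinear] that by simp
  have bil: "bilinear_map (tensor_G A B) C ?T f"
  proof (rule bilinear_mapI)
    fix s c c' assume s: "s \<in> carrier (tensor_G A B)" and c: "c \<in> carrier C" "c' \<in> carrier C"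
    show "f s (c \<otimes>\<^bsub>C\<^esub> c') = f s c \<otimes>\<^bsub>?T\<^esub> f s c'"
    proof (rule tensor_hom_eqI[OF A B f_hom[OF C.m_closed[OF c]] T.hom_group_mult[OF f_hom[OF c(1)] f_hom[OF c(2)]] T.is_group])
      fix a b assume ab: "a \<in> carrier A" "b \<in> carrier B"
      show "f (pure_tensor A B a b) (c \<otimes>\<^bsub>C\<^esub> c') = f (pure_tensor A B a b) c \<otimes>\<^bsub>?T\<^esub> f (pure_tensor A B a b) c'"
        using ab c bilinear_map_mult_right[OF bilinear_pure_tensor[OF B C], of b c c']
          bilinear_map_mult_right[OF bilinear_pure_tensor[OF A comm_group_tensor_G[OF B C]], of a "pure_tensor B C b c" "pure_tensor B C b c'"]
        by (simp add: f_pure pure_tensor_closed[OF B C])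
    qed (use s c in auto)
  qed (use f_hom in \<open>auto simp: hom_def Pi_def\<close>)
  let ?h = "tensor_lift (tensor_G A B) C ?T f"
  show "\<exists>h. h \<in> hom (tensor_G (tensor_G A B) C) (tensor_G A (tensor_G B C))
         \<inter> extensional (carrier (tensor_G (tensor_G A B) C)) \<and>
     (\<forall>a\<in>carrier A. \<forall>b\<in>carrier B. \<forall>c\<in>carrier C.
        h (pure_tensor (tensor_G A B) C (pure_tensor A B a b) c)
        = pure_tensor A (tensor_G B C) a (pure_tensor B C b c))"
    using tensor_lift_hom[OF comm_group_tensor_G[OF A B] C T bil] tensor_lift_extensional[OF comm_group_tensor_G[OF A B] C T bil]
    by (intro exI[of _ ?h]) (simp add: tensor_lift_pure[OF comm_group_tensor_G[OF A B] C T bil] pure_tensor_closed[OF A B] f_pure)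
  fix h k
  assume h: "h \<in> hom (tensor_G (tensor_G A B) C) (tensor_G A (tensor_G B C))
         \<inter> extensional (carrier (tensor_G (tensor_G A B) C)) \<and>
     (\<forall>a\<in>carrier A. \<forall>b\<in>carrier B. \<forall>c\<in>carrier C.
        h (pure_tensor (tensor_G A B) C (pure_tensor A B a b) c)
        = pure_tensor A (tensor_G B C) a (pure_tensor B C b c))"
    and k: "k \<in> hom (tensor_G (tensor_G A B) C) (tensor_G A (tensor_G B C))
         \<inter> extensional (carrier (tensor_G (tensor_G A B) C)) \<and>
     (\<forall>a\<in>carrier A. \<forall>b\<in>carrier B. \<forall>c\<in>carrier C.
        k (pure_tensor (tensor_G A B) C (pure_tensor A B a b) c)
        = pure_tensor A (tensor_G B C) a (pure_tensor B C b c))"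
  show "h = k"
  proof (rule extensionalityI)
    show "h t = k t" if "t \<in> carrier (tensor_G (tensor_G A B) C)" for t
      by (rule tensor3_hom_eqI[of h _ k, OF _ _ T.is_group]) (use h k that in auto)
  qed (use h k in auto)
qed

lemma tensor_assoc_properties:
  "tensor_assoc A B C \<in> hom (tensor_G (tensor_G A B) C) (tensor_G A (tensor_G B C))
         \<inter> extensional (carrier (tensor_G (tensor_G A B) C)) \<and>
     (\<forall>a\<in>carrier A. \<forall>b\<in>carrier B. \<forall>c\<in>carrier C.
        tensor_assoc A B C (pure_tensor (tensor_G A B) C (pure_tensor A B a b) c)
        = pure_tensor A (tensor_G B C) a (pure_tensor B C b c))"
  unfolding tensor_assoc_def by (rule theI'[OF tensor_assoc_unique_exists])

lemma tensor_assoc_hom: "tensor_assoc A B C \<in> hom (tensor_G (tensor_G A B) C) (tensor_G A (tensor_G B C))"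
  using tensor_assoc_properties by blast

lemma tensor_assoc_pure: "a \<in> carrier A \<Longrightarrow> b \<in> carrier B \<Longrightarrow> c \<in> carrier C \<Longrightarrow>
    tensor_assoc A B C (pure_tensor (tensor_G A B) C (pure_tensor A B a b) c)
        = pure_tensor A (tensor_G B C) a (pure_tensor B C b c)"
  using tensor_assoc_properties by blast

end

section \<open>Finite products\<close>

lemma hom_finprod:
  assumes "comm_group A" "comm_group B" "h \<in> hom A B" "f \<in> I \<rightarrow> carrier A"
  shows "h (finprod A f I) = finprod B (\<lambda>i. h (f i)) I"
proof -
  interpret A: comm_group A by fact
  interpret B: comm_group B by fact
  interpret h: group_hom A B h using assms by (simp add: group_hom_def group_hom_axioms_def)
  show ?thesis using assms(4)
  proof (induction I rule: infinite_finite_induct)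
    case (insert i I)
    then have "f \<in> I \<rightarrow> carrier A" "f i \<in> carrier A" "(\<lambda>i. h (f i)) \<in> I \<rightarrow> carrier B"
      by (auto simp: Pi_def)
    then show ?case using insert by simp
  qed auto
qed

text \<open>The product set is the disjoint union of its slices over \<open>I\<close>.\<close>

lemma (in comm_monoid) finprod_cartesian:
  assumes "finite I" "finite J" "\<And>i j. i \<in> I \<Longrightarrow> j \<in> J \<Longrightarrow> f i j \<in> carrier G"
  shows "finprod G (\<lambda>i. finprod G (f i) J) I = finprod G (\<lambda>(i, j). f i j) (I \<times> J)"
proof -
  have "finprod G (\<lambda>(i, j). f i j) (\<Union>i\<in>I. Pair i ` J) = finprod G (\<lambda>i. finprod G (\<lambda>(i, j). f i j) (Pair i ` J)) I"
    by (rule finprod_UN_disjoint) (use assms in \<open>auto simp: pairwise_def disjnt_def\<close>)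
  also have "\<dots> = finprod G (\<lambda>i. finprod G (f i) J) I"
  proof (rule finprod_cong')
    fix i assume "i \<in> I"
    then have "(\<lambda>(i, j). f i j) \<in> Pair i ` J \<rightarrow> carrier G" using assms by auto
    then show "finprod G (\<lambda>(i, j). f i j) (Pair i ` J) = finprod G (f i) J"
      by (simp add: finprod_reindex inj_on_def)
  qed (use assms in auto)
  also have "(\<Union>i\<in>I. Pair i ` J) = I \<times> J" by auto
  finally show ?thesis by simp
qed

text \<open>Expand in the first variable, then in the second. Through this identity bilinearity
  enters the naturality of the multiplication of \<open>R\<close>.\<close>

lemma bilinear_finprod:
  assumes A: "comm_group A" and B: "comm_group B" and C: "comm_group C" and f: "bilinear_map A B C f"
    and fin: "finite I" "finite J" and x: "x \<in> I \<rightarrow> carrier A" and y: "y \<in> J \<rightarrow> carrier B"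
  shows "f (finprod A x I) (finprod B y J) = finprod C (\<lambda>(i, j). f (x i) (y j)) (I \<times> J)"
proof -
  interpret A: comm_group A by fact
  interpret B: comm_group B by fact
  interpret C: comm_group C by fact
  note closed = bilinear_map_closed[OF f]
  have "f (finprod A x I) (finprod B y J) = finprod C (\<lambda>i. f (x i) (finprod B y J)) I"
    using f y by (intro hom_finprod[OF A C _ x, of "\<lambda>a. f a (finprod B y J)"]) (simp add: bilinear_map_def)
  also have "\<dots> = finprod C (\<lambda>i. finprod C (\<lambda>j. f (x i) (y j)) J) I"
  proof (rule C.finprod_cong')
    fix i assume "i \<in> I"
    then show "f (x i) (finprod B y J) = finprod C (\<lambda>j. f (x i) (y j)) J"
      using f x by (intro hom_finprod[OF B C _ y, of "\<lambda>b. f (x i) b"]) (auto simp: bilinear_map_def)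
  qed (use closed x y in \<open>auto intro!: C.finprod_closed\<close>)
  also have "\<dots> = finprod C (\<lambda>(i, j). f (x i) (y j)) (I \<times> J)"
    using fin closed x y by (intro C.finprod_cartesian) auto
  finally show ?thesis .
qed

lemma (in comm_monoid) finprod_delta:
  assumes "finite I" "a \<in> carrier G"
  shows "finprod G (\<lambda>i. if i = k then a else \<one>) I = (if k \<in> I then a else \<one>)"
  using assms finprod_singleton_swap[of k I "\<lambda>_. a"] by (auto intro!: finprod_one_eqI)

section \<open>The functor R\<close>

text \<open>Coordinates are numbered from 1, since 0 is the basepoint of \<open>n\<close>, whereas
  list entries are numbered from 0; \<open>tuple\<close> and \<open>coord\<close> absorb the
  shift.\<close>

definition tuple :: "nat \<Rightarrow> (nat \<Rightarrow> 'a univ) \<Rightarrow> 'a univ" where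
  "tuple n f = Tup (map f [1..<n + 1])"

definition coord :: "'a univ \<Rightarrow> nat \<Rightarrow> 'a univ" where
  "coord a i = entries a ! (i - 1)"

lemma coord_tuple: "0 < i \<Longrightarrow> i \<le> n \<Longrightarrow> coord (tuple n f) i = f i"
  by (cases i) (auto simp: tuple_def coord_def simp del: upt_Suc)

lemma tuple_cong: "(\<And>i. 0 < i \<Longrightarrow> i \<le> n \<Longrightarrow> f i = g i) \<Longrightarrow> tuple n f = tuple n g"
  by (auto simp: tuple_def simp del: upt_Suc)

lemma tuple_powers_iff: "tuple n f \<in> powers A n \<longleftrightarrow> (\<forall>i. 0 < i \<longrightarrow> i \<le> n \<longrightarrow> f i \<in> carrier A)"
  by (auto simp: tuple_def powers_def image_subset_iff Suc_le_eq simp del: upt_Suc)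

lemma coord_closed: "a \<in> powers A n \<Longrightarrow> 0 < i \<Longrightarrow> i \<le> n \<Longrightarrow> coord a i \<in> carrier A"
  by (auto simp: powers_def coord_def intro!: subsetD[OF _ nth_mem])

lemma powers_eqI:
  assumes "a \<in> powers A n" "b \<in> powers B n" "\<And>i. 0 < i \<Longrightarrow> i \<le> n \<Longrightarrow> coord a i = coord b i"
  shows "a = b"
proof -
  obtain as bs where ab: "a = Tup as" "b = Tup bs" "length as = n" "length bs = n"
    using assms(1,2) by (auto simp: powers_def)
  have "as ! k = bs ! k" if "k < n" for k
    using assms(3)[of "Suc k"] that by (simp add: ab coord_def)
  then show ?thesis using ab by (simp add: list_eq_iff_nth_eq)
qed

lemma powers_lex_eqI:
  assumes "a \<in> powers A (m * n)" "b \<in> powers B (m * n)"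
    and "\<And>i j. 0 < i \<Longrightarrow> i \<le> m \<Longrightarrow> 0 < j \<Longrightarrow> j \<le> n \<Longrightarrow> coord a (lex_pos n i j) = coord b (lex_pos n i j)"
  shows "a = b"
  using assms(1,2)
proof (rule powers_eqI)
  fix k assume "0 < k" "k \<le> m * n"
  then show "coord a k = coord b k"
    using assms(3)[of "lex_row n k" "lex_col n k"] by (simp add: lex_row_bounds lex_col_bounds lex_pos_row_col)
qed

lemma tuple_coord: "a \<in> powers A n \<Longrightarrow> tuple n (coord a) = a"
  by (rule powers_eqI[of _ A n _ A]) (auto simp: tuple_powers_iff coord_closed coord_tuple)

lemma map_entries: "a \<in> powers A n \<Longrightarrow> Tup (map f (entries a)) = tuple n (\<lambda>i. f (coord a i))"
  by (auto simp: powers_def tuple_def coord_def intro!: nth_equalityI simp del: upt_Suc)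

lemma points_R_obj [simp]: "points (sp (R_obj A) n) = powers A n"
  by (simp add: R_obj_def)

lemma ind_R_obj: "a \<in> powers A m \<Longrightarrow> ind (R_obj A) m n \<phi> a
    = tuple n (\<lambda>j. finprod A (coord a) {i \<in> {1..m}. \<phi> i = j})"
  by (simp add: R_obj_def tuple_def coord_def[abs_def])

lemma act_R_obj: "a \<in> powers A n \<Longrightarrow> act (sp (R_obj A) n) g a = tuple n (\<lambda>i. gact A g (coord a i))"
  by (simp add: R_obj_def map_entries)

lemma R_hom_apply: "a \<in> powers A n \<Longrightarrow> R_hom A B f n a = tuple n (\<lambda>i. f (coord a i))"
  by (simp add: R_hom_def map_entries)

lemma pt_R_obj: "pt (sp (R_obj A) n) = tuple n (\<lambda>_. \<one>\<^bsub>A\<^esub>)"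
  by (simp add: R_obj_def tuple_def map_replicate_const del: upt_Suc)

lemma F_set_R_obj:
  assumes "comm_group A"
  shows "F_set (R_obj A)"
proof -
  interpret comm_group A by fact
  have coord_Pi: "coord a \<in> {i \<in> {1..n}. P i} \<rightarrow> carrier A" if "a \<in> powers A n" for a n P
    using coord_closed[OF that] by (auto simp: Suc_le_eq)
  have closed: "ind (R_obj A) m n \<phi> a \<in> powers A n" if "a \<in> powers A m" for m n \<phi> a
    unfolding ind_R_obj[OF that] tuple_powers_iff using that by (intro allI impI finprod_closed coord_Pi)
  have pt: "pt (sp (R_obj A) n) \<in> powers A n" for n
    by (simp add: pt_R_obj tuple_powers_iff)
  show ?thesis
  proof
    show "topo (sp (R_obj A) n) = discrete_topology (points (sp (R_obj A) n))" for n
      by (simp add: R_obj_def)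
    show "points (sp (R_obj A) 0) = {pt (sp (R_obj A) 0)}"
      using pt[of 0] by (auto intro: powers_eqI)
    show "ind (R_obj A) m n \<phi> \<in> points (sp (R_obj A) m) \<rightarrow>\<^sub>E points (sp (R_obj A) n)" for m n \<phi>
      using closed by (auto simp: R_obj_def)
  next
    fix \<phi> m n
    show "ind (R_obj A) m n \<phi> (pt (sp (R_obj A) m)) = pt (sp (R_obj A) n)"
    proof (rule powers_eqI[OF closed[OF pt] pt])
      fix j assume "0 < j" "j \<le> n"
      then show "coord (ind (R_obj A) m n \<phi> (pt (sp (R_obj A) m))) j = coord (pt (sp (R_obj A) n)) j"
        using pt[of m] by (auto simp: ind_R_obj coord_tuple pt_R_obj intro!: finprod_one_eqI)
    qed
  next
    fix a n assume "a \<in> points (sp (R_obj A) n)"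
    then have a: "a \<in> powers A n" by simp
    show "ind (R_obj A) n n (\<lambda>i\<in>{..n}. i) a = a"
    proof (rule powers_eqI[OF closed[OF a] a])
      fix j assume j: "0 < j" "j \<le> n"
      then have "{i \<in> {1..n}. (\<lambda>i\<in>{..n}. i) i = j} = {j}" by auto
      then show "coord (ind (R_obj A) n n (\<lambda>i\<in>{..n}. i) a) j = coord a j"
        using a j coord_closed[OF a j] by (simp add: ind_R_obj coord_tuple Pi_def)
    qed
  next
    fix \<phi> m n \<psi> p a
    assume \<phi>: "\<phi> \<in> F_maps m n" and \<psi>: "\<psi> \<in> F_maps n p" and "a \<in> points (sp (R_obj A) m)"
    then have a: "a \<in> powers A m" by simp
    show "ind (R_obj A) m p (compose {..m} \<psi> \<phi>) a = ind (R_obj A) n p \<psi> (ind (R_obj A) m n \<phi> a)"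
    proof (rule powers_eqI[OF closed[OF a] closed[OF closed[OF a]]])
      fix j assume j: "0 < j" "j \<le> p"
      \<comment> \<open>Since \<open>j\<close> is nonzero and \<psi> is based, the intermediate
        value \<open>\<phi> i\<close> is nonzero. So no factor is lost at the basepoint, and the
        fibre of the composite is the disjoint union of fibres of \<phi> over the fibre of
        \<psi>.\<close>
      have "{i \<in> {1..m}. compose {..m} \<psi> \<phi> i = j} = (\<Union>k\<in>{k \<in> {1..n}. \<psi> k = j}. {i \<in> {1..m}. \<phi> i = k})"
        using j F_maps_le[OF \<phi>] F_maps_zero[OF \<psi>] by (auto simp: compose_def Suc_le_eq) (metis neq0_conv)
      then have "finprod A (coord a) {i \<in> {1..m}. compose {..m} \<psi> \<phi> i = j}
          = finprod A (\<lambda>k. finprod A (coord a) {i \<in> {1..m}. \<phi> i = k}) {k \<in> {1..n}. \<psi> k = j}"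
        using coord_closed[OF a] by (auto simp: pairwise_def disjnt_def intro!: finprod_UN_disjoint)
      also have "\<dots> = finprod A (coord (ind (R_obj A) m n \<phi> a)) {k \<in> {1..n}. \<psi> k = j}"
        using coord_Pi[OF closed[OF a]] by (intro finprod_cong') (auto simp: ind_R_obj[OF a] coord_tuple)
      finally show "coord (ind (R_obj A) m p (compose {..m} \<psi> \<phi>) a) j
          = coord (ind (R_obj A) n p \<psi> (ind (R_obj A) m n \<phi> a)) j"
        using a j closed[OF a] by (simp add: ind_R_obj coord_tuple)
    qed
  qed (simp add: pt)
qed

lemma R_hom_F_nat:
  assumes "comm_group A" "comm_group B" "f \<in> hom A B"
  shows "R_hom A B f \<in> F_nat (R_obj A) (R_obj B)"
proof -
  interpret A: comm_group A by fact
  interpret B: comm_group B by fact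
  interpret RA: F_set "R_obj A" by (rule F_set_R_obj) fact
  interpret RB: F_set "R_obj B" by (rule F_set_R_obj) fact
  have closed: "R_hom A B f n a \<in> powers B n" if "a \<in> powers A n" for n a
    using that assms(3) by (auto simp: R_hom_apply tuple_powers_iff coord_closed hom_def Pi_def)
  show ?thesis
    unfolding F_nat_def
  proof (intro CollectI conjI allI ballI PiE_I)
    fix m n \<phi> a assume \<phi>: "\<phi> \<in> F_maps m n" and "a \<in> points (sp (R_obj A) m)"
    then have a: "a \<in> powers A m" by simp
    have ind: "ind (R_obj A) m n \<phi> a \<in> powers A n" "ind (R_obj B) m n \<phi> (R_hom A B f m a) \<in> powers B n"
      using RA.ind_closed[OF \<phi>] RB.ind_closed[OF \<phi>] a closed[OF a] by auto
    show "R_hom A B f n (ind (R_obj A) m n \<phi> a) = ind (R_obj B) m n \<phi> (R_hom A B f m a)"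
    proof (rule powers_eqI[OF closed[OF ind(1)] ind(2)])
      fix j assume j: "0 < j" "j \<le> n"
      have "f (finprod A (coord a) {i \<in> {1..m}. \<phi> i = j}) = finprod B (\<lambda>i. f (coord a i)) {i \<in> {1..m}. \<phi> i = j}"
        using coord_closed[OF a] by (intro hom_finprod assms) auto
      also have "\<dots> = finprod B (coord (R_hom A B f m a)) {i \<in> {1..m}. \<phi> i = j}"
        using coord_closed[OF closed[OF a]] by (intro B.finprod_cong') (auto simp: R_hom_apply[OF a] coord_tuple)
      finally show "coord (R_hom A B f n (ind (R_obj A) m n \<phi> a)) j = coord (ind (R_obj B) m n \<phi> (R_hom A B f m a)) j"
        unfolding R_hom_apply[OF ind(1)] ind_R_obj[OF closed[OF a]] coord_tuple[OF j] unfolding ind_R_obj[OF a] coord_tuple[OF j] .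
    qed
  qed (simp_all add: closed, simp add: R_hom_def)
qed

lemma FG_set_R_obj:
  assumes G: "group G" and A: "abelian_G_group G A"
  shows "FG_set G (R_obj A)"
proof -
  interpret G: group G by fact
  interpret A: G_module G A by (rule G_module.intro) fact
  interpret R: F_set "R_obj A" by (rule F_set_R_obj[OF A.comm_group_axioms])
  have closed: "act (sp (R_obj A) n) g a \<in> powers A n" if "g \<in> carrier G" "a \<in> powers A n" for n g a
    using that by (simp add: act_R_obj tuple_powers_iff A.gact_closed coord_closed)
  show ?thesis
  proof
    show "act (sp (R_obj A) n) g \<in> extensional (points (sp (R_obj A) n))" for n g
      by (simp add: R_obj_def)
    fix g m n \<phi> a assume *: "g \<in> carrier G" "\<phi> \<in> F_maps m n" "a \<in> points (sp (R_obj A) m)"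
    \<comment> \<open>A group element acts on tuples as \<open>R_hom\<close> of the automorphism
      \<open>gact A g\<close>, so compatibility with induced maps is naturality of
      \<open>R_hom\<close>.\<close>
    have "act (sp (R_obj A) k) g b = R_hom A A (gact A g) k b" if "b \<in> powers A k" for k b
      using that by (simp add: act_R_obj R_hom_apply)
    then show "act (sp (R_obj A) n) g (ind (R_obj A) m n \<phi> a) = ind (R_obj A) m n \<phi> (act (sp (R_obj A) m) g a)"
      using * R.ind_closed[OF *(2,3)] F_nat_ind[OF R_hom_F_nat[OF A.comm_group_axioms A.comm_group_axioms A.gact_hom]] by simp
  next
    fix a n assume "a \<in> points (sp (R_obj A) n)"
    then have a: "a \<in> powers A n" by simp
    have "act (sp (R_obj A) n) \<one>\<^bsub>G\<^esub> a = tuple n (coord a)"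
      by (rule powers_eqI[of _ A n _ A])
        (use a closed[OF G.one_closed a] in \<open>auto simp: act_R_obj tuple_coord coord_tuple A.gact_one coord_closed\<close>)
    then show "act (sp (R_obj A) n) \<one>\<^bsub>G\<^esub> a = a" by (simp add: tuple_coord[OF a])
    fix g h assume gh: "g \<in> carrier G" "h \<in> carrier G"
    show "act (sp (R_obj A) n) (g \<otimes>\<^bsub>G\<^esub> h) a = act (sp (R_obj A) n) g (act (sp (R_obj A) n) h a)"
      by (rule powers_eqI[of _ A n _ A])
        (use a gh closed in \<open>auto simp: act_R_obj coord_tuple A.gact_mult coord_closed\<close>)
  qed (simp add: closed)
qed

lemma R_hom_equivariant:
  assumes A: "abelian_G_group G A" and f: "f \<in> G_homs G A B"
  shows "equivariant G (R_obj A) (R_obj B) (R_hom A B f)"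
  unfolding equivariant_def
proof (intro allI ballI)
  interpret A: G_module G A by (rule G_module.intro) fact
  fix n g a assume g: "g \<in> carrier G" and "a \<in> points (sp (R_obj A) n)"
  then have a: "a \<in> powers A n" by simp
  have act: "act (sp (R_obj A) n) g a \<in> powers A n"
    using a g by (simp add: act_R_obj tuple_powers_iff A.gact_closed coord_closed)
  have Rf: "R_hom A B f n a \<in> powers B n"
    using a f by (auto simp: R_hom_apply tuple_powers_iff coord_closed G_homs_def hom_def Pi_def)
  have "tuple n (\<lambda>i. f (coord (act (sp (R_obj A) n) g a) i)) = tuple n (\<lambda>i. gact B g (coord (R_hom A B f n a) i))"
    unfolding tuple_def using g f a
    by (auto simp: act_R_obj R_hom_apply coord_tuple G_homs_def coord_closed simp del: upt_Suc)
  then show "R_hom A B f n (act (sp (R_obj A) n) g a) = act (sp (R_obj B) n) g (R_hom A B f n a)"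
    by (simp add: R_hom_apply[OF act] act_R_obj[OF Rf])
qed

subsection \<open>The multiplication of R\<close>

definition pairing ::
    "('g, 'a univ) G_group \<Rightarrow> ('g, 'a univ) G_group \<Rightarrow> nat \<Rightarrow> nat \<Rightarrow> 'a univ \<Rightarrow> 'a univ \<Rightarrow> 'a univ" where
  "pairing A B m n x y = tuple (m * n) (\<lambda>k. pure_tensor A B (coord x (lex_row n k)) (coord y (lex_col n k)))"

lemma coord_pairing:
  "0 < i \<Longrightarrow> i \<le> m \<Longrightarrow> 0 < j \<Longrightarrow> j \<le> n \<Longrightarrow> coord (pairing A B m n x y) (lex_pos n i j) = pure_tensor A B (coord x i) (coord y j)"
  by (simp add: pairing_def coord_tuple lex_pos_le lex_row_pos lex_col_pos)

lemma pairing_closed: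
  assumes "comm_group A" "comm_group B" "x \<in> powers A m" "y \<in> powers B n"
  shows "pairing A B m n x y \<in> powers (tensor_G A B) (m * n)"
  using assms by (auto simp: pairing_def tuple_powers_iff intro!: pure_tensor_closed coord_closed dest: lex_row_bounds lex_col_bounds)

text \<open>A coordinate on the left is the pure tensor of a product over a fibre of \<phi> and one
  over a fibre of \<psi>; expanding it gives the product over the fibre of \<phi> \<and> \<psi> on
  the right.\<close>

lemma natural_family_pairing:
  assumes A: "comm_group A" and B: "comm_group B"
  shows "natural_family (R_obj A) (R_obj B) (R_obj (tensor_G A B)) (pairing A B)"
proof (rule natural_familyI)
  interpret T: comm_group "tensor_G A B" by (rule comm_group_tensor_G[OF A B])
  interpret RA: F_set "R_obj A" by (rule F_set_R_obj[OF A])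
  interpret RB: F_set "R_obj B" by (rule F_set_R_obj[OF B])
  interpret RT: F_set "R_obj (tensor_G A B)" by (rule F_set_R_obj[OF T.comm_group_axioms])
  fix m m' n n' \<phi> \<psi> x y
  assume \<phi>: "\<phi> \<in> F_maps m m'" and \<psi>: "\<psi> \<in> F_maps n n'" and "x \<in> points (sp (R_obj A) m)" "y \<in> points (sp (R_obj B) n)"
  then have x: "x \<in> powers A m" and y: "y \<in> powers B n" by simp_all
  let ?p = "pairing A B m n x y"
  have p: "?p \<in> powers (tensor_G A B) (m * n)" by (rule pairing_closed[OF A B x y])
  have ind: "ind (R_obj A) m m' \<phi> x \<in> powers A m'" "ind (R_obj B) n n' \<psi> y \<in> powers B n'"
    "ind (R_obj (tensor_G A B)) (m * n) (m' * n') (F_smash m n n' \<phi> \<psi>) ?p \<in> powers (tensor_G A B) (m' * n')"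
    using RA.ind_closed[OF \<phi>] RB.ind_closed[OF \<psi>] RT.ind_closed[OF F_smash_F_maps[OF \<phi> \<psi>]] x y p by auto
  show "pairing A B m' n' (ind (R_obj A) m m' \<phi> x) (ind (R_obj B) n n' \<psi> y)
      = ind (R_obj (tensor_G A B)) (m * n) (m' * n') (F_smash m n n' \<phi> \<psi>) ?p"
  proof (rule powers_lex_eqI[OF pairing_closed[OF A B ind(1,2)] ind(3)])
    fix a b assume ab: "0 < a" "a \<le> m'" "0 < b" "b \<le> n'"
    define I where "I = {i \<in> {1..m}. \<phi> i = a}"
    define J where "J = {j \<in> {1..n}. \<psi> j = b}"
    have Pi: "coord x \<in> I \<rightarrow> carrier A" "coord y \<in> J \<rightarrow> carrier B"
      using coord_closed[OF x] coord_closed[OF y] by (auto simp: I_def J_def)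
    have p_Pi: "coord ?p \<in> {k \<in> {1..m * n}. P k} \<rightarrow> carrier (tensor_G A B)" for P
      using coord_closed[OF p] by (simp add: Pi_def)
    \<comment> \<open>As \<open>a\<close> and \<open>b\<close> are nonzero, a position lies over
      \<open>(a, b)\<close> exactly when its row lies over \<open>a\<close> and its column over
      \<open>b\<close>: the fibre of the smash product is the product of the fibres.\<close>
    have K: "{k \<in> {1..m * n}. F_smash m n n' \<phi> \<psi> k = lex_pos n' a b} = (\<lambda>(i, j). lex_pos n i j) ` (I \<times> J)"
    proof (intro subset_antisym subsetI)
      fix k assume k: "k \<in> {k \<in> {1..m * n}. F_smash m n n' \<phi> \<psi> k = lex_pos n' a b}"
      then have "0 < k" "k \<le> m * n" by auto
      note rc = lex_row_bounds[OF this] lex_col_bounds[OF this] lex_pos_row_col[OF this(1), of n]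
      have "lex_pos n' a b = lex_pos n' (\<phi> (lex_row n k)) (\<psi> (lex_col n k))"
        using k F_smash_lex_pos[OF \<phi> \<psi>, of "lex_row n k" "lex_col n k"] rc by simp
      then have "a = \<phi> (lex_row n k)" "b = \<psi> (lex_col n k)"
        using lex_pos_eq_iff[OF ab(1,3,4)] F_maps_le[OF \<psi>] rc by auto
      then show "k \<in> (\<lambda>(i, j). lex_pos n i j) ` (I \<times> J)"
        using rc by (intro image_eqI[of _ _ "(lex_row n k, lex_col n k)"]) (auto simp: I_def J_def)
    next
      fix k assume "k \<in> (\<lambda>(i, j). lex_pos n i j) ` (I \<times> J)"
      then obtain i j where "i \<in> I" "j \<in> J" "k = lex_pos n i j" by auto
      then show "k \<in> {k \<in> {1..m * n}. F_smash m n n' \<phi> \<psi> k = lex_pos n' a b}"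
        by (auto simp: I_def J_def F_smash_lex_pos[OF \<phi> \<psi>] lex_pos_le Suc_le_eq)
    qed
    have inj: "inj_on (\<lambda>(i, j). lex_pos n i j) (I \<times> J)"
      using lex_pos_eq_iff by (fastforce simp: inj_on_def I_def J_def)
    have "pure_tensor A B (finprod A (coord x) I) (finprod B (coord y) J)
        = finprod (tensor_G A B) (\<lambda>(i, j). pure_tensor A B (coord x i) (coord y j)) (I \<times> J)"
      by (rule bilinear_finprod[OF A B T.comm_group_axioms _ _ _ Pi]) (simp_all add: bilinear_pure_tensor[OF A B] I_def J_def)
    also have "\<dots> = finprod (tensor_G A B) (\<lambda>q. coord ?p ((\<lambda>(i, j). lex_pos n i j) q)) (I \<times> J)"
      using p_Pi[of "\<lambda>k. F_smash m n n' \<phi> \<psi> k = lex_pos n' a b"] unfolding K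
      by (intro T.finprod_cong') (auto simp: I_def J_def coord_pairing)
    also have "\<dots> = finprod (tensor_G A B) (coord ?p) {k \<in> {1..m * n}. F_smash m n n' \<phi> \<psi> k = lex_pos n' a b}"
      using p_Pi[of "\<lambda>k. F_smash m n n' \<phi> \<psi> k = lex_pos n' a b"] unfolding K by (intro T.finprod_reindex[symmetric] inj)
    finally show "coord (pairing A B m' n' (ind (R_obj A) m m' \<phi> x) (ind (R_obj B) n n' \<psi> y)) (lex_pos n' a b)
        = coord (ind (R_obj (tensor_G A B)) (m * n) (m' * n') (F_smash m n n' \<phi> \<psi>) ?p) (lex_pos n' a b)"
      using ab by (simp add: coord_pairing ind_R_obj[OF x] ind_R_obj[OF y] ind_R_obj[OF p] coord_tuple lex_pos_le I_def J_def)
  qed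
qed (use pairing_closed[OF A B] in simp)

lemma equivariant_family_pairing:
  assumes A: "abelian_G_group G A" and B: "abelian_G_group G B"
  shows "equivariant_family G (R_obj A) (R_obj B) (R_obj (tensor_G A B)) (pairing A B)"
  unfolding equivariant_family_def
proof (intro allI ballI)
  interpret A: G_module G A by (rule G_module.intro) fact
  interpret B: G_module G B by (rule G_module.intro) fact
  note ax = A.comm_group_axioms B.comm_group_axioms
  fix m n g x y assume g: "g \<in> carrier G" and "x \<in> points (sp (R_obj A) m)" "y \<in> points (sp (R_obj B) n)"
  then have x: "x \<in> powers A m" and y: "y \<in> powers B n" by simp_all
  note p = pairing_closed[OF ax x y]
  have act: "act (sp (R_obj A) m) g x \<in> powers A m" "act (sp (R_obj B) n) g y \<in> powers B n"
    "act (sp (R_obj (tensor_G A B)) (m * n)) g (pairing A B m n x y) \<in> powers (tensor_G A B) (m * n)"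
    using x y p gact_tensor_G(1)[OF A B g] g
    by (auto simp: act_R_obj tuple_powers_iff A.gact_closed B.gact_closed coord_closed hom_def Pi_def dest: coord_closed)
  show "pairing A B m n (act (sp (R_obj A) m) g x) (act (sp (R_obj B) n) g y)
      = act (sp (R_obj (tensor_G A B)) (m * n)) g (pairing A B m n x y)"
  proof (rule powers_lex_eqI[OF pairing_closed[OF ax act(1,2)] act(3)])
    fix i j assume "0 < i" "i \<le> m" "0 < j" "j \<le> n"
    then show "coord (pairing A B m n (act (sp (R_obj A) m) g x) (act (sp (R_obj B) n) g y)) (lex_pos n i j)
      = coord (act (sp (R_obj (tensor_G A B)) (m * n)) g (pairing A B m n x y)) (lex_pos n i j)"
      by (simp add: coord_pairing act_R_obj[OF x] act_R_obj[OF y] act_R_obj[OF p] coord_tuple lex_pos_le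
          gact_tensor_G(3)[OF A B g] coord_closed[OF x] coord_closed[OF y])
  qed
qed

subsection \<open>The unit of R\<close>

text \<open>The unit of the Day convolution is F(1, -), so by Yoneda its maps to the functor of the
  integers are the elements of \<int>; this one corresponds to 1. The basepoint 0 goes to the zero
  vector because no coordinate has number 0.\<close>

definition R_unit :: "nat \<Rightarrow> 'a univ \<Rightarrow> 'a univ" where
  "R_unit n = (\<lambda>z\<in>(\<lambda>i. Z (int i)) ` {..n}. tuple n (\<lambda>j. Z (if j = nat (the_Z z) then 1 else 0)))"

lemma points_day_unit [simp]: "points (sp day_unit n) = (\<lambda>i. Z (int i)) ` {..n}"
  by (simp add: day_unit_def)

lemma ind_day_unit [simp]: "i \<le> m \<Longrightarrow> ind day_unit m n \<phi> (Z (int i)) = Z (int (\<phi> i))"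
  by (auto simp: day_unit_def)

lemma FG_set_day_unit:
  assumes "group G"
  shows "FG_set G day_unit"
proof -
  interpret group G by fact
  show ?thesis
  proof
    show "topo (sp day_unit n) = discrete_topology (points (sp day_unit n))" for n
      by (simp add: day_unit_def)
    show "ind day_unit m n \<phi> \<in> points (sp day_unit m) \<rightarrow>\<^sub>E points (sp day_unit n)" if "\<phi> \<in> F_maps m n" for m n \<phi>
      using F_maps_le[OF that] by (auto simp: day_unit_def)
  qed (auto simp: day_unit_def F_maps_zero compose_eq F_maps_le)
qed

lemma R_unit_apply: "i \<le> n \<Longrightarrow> R_unit n (Z (int i)) = tuple n (\<lambda>j. Z (if j = i then 1 else 0))"
  by (auto simp: R_unit_def)

lemma R_unit_closed: "z \<in> points (sp day_unit n) \<Longrightarrow> R_unit n z \<in> powers integers_G n"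
  by (auto simp: R_unit_apply tuple_powers_iff integers_G_def)

lemma R_unit_F_nat: "R_unit \<in> F_nat (day_unit :: ('g, 'a univ) FG_space) (R_obj integers_G)"
  unfolding F_nat_def
proof (intro CollectI conjI allI ballI PiE_I)
  let ?Z = "integers_G :: ('g, 'a univ) G_group" and ?U = "day_unit :: ('g, 'a univ) FG_space"
  interpret Z: comm_group "?Z" by (rule comm_group_integers_G)
  interpret R: F_set "R_obj ?Z" by (rule F_set_R_obj[OF comm_group_integers_G])
  fix m n :: nat and \<phi> and z :: "'a univ" assume \<phi>: "\<phi> \<in> F_maps m n" and "z \<in> points (sp ?U m)"
  then obtain i where z: "z = Z (int i)" and i: "i \<le> m" by auto
  then have closed: "R_unit m z \<in> powers ?Z m" by (intro R_unit_closed) simp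
  show "R_unit n (ind ?U m n \<phi> z) = ind (R_obj ?Z) m n \<phi> (R_unit m z)"
  proof (rule powers_eqI)
    show "R_unit n (ind ?U m n \<phi> z) \<in> powers ?Z n"
      using i F_maps_le[OF \<phi>] by (intro R_unit_closed) (simp add: z)
    show "ind (R_obj ?Z) m n \<phi> (R_unit m z) \<in> powers ?Z n"
      using R.ind_closed[OF \<phi>, of "R_unit m z"] closed by simp
    fix j assume j: "0 < j" "j \<le> n"
    have "finprod ?Z (coord (R_unit m z)) {i' \<in> {1..m}. \<phi> i' = j}
        = finprod ?Z (\<lambda>i'. if i' = i then Z 1 else \<one>\<^bsub>?Z\<^esub>) {i' \<in> {1..m}. \<phi> i' = j}"
      using i by (intro Z.finprod_cong') (auto simp: z R_unit_apply coord_tuple integers_G_def)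
    \<comment> \<open>If \<open>\<phi> i = j\<close> then \<open>i\<close> is nonzero, since
      \<open>j\<close> is and \<phi> is based. Hence \<open>i\<close> belongs to the index set,
      which omits the basepoint.\<close>
    also have "\<dots> = (if \<phi> i = j then Z 1 else Z 0)"
      using i j F_maps_zero[OF \<phi>] by (subst Z.finprod_delta) (auto simp: integers_G_def Suc_le_eq intro: ccontr)
    finally show "coord (R_unit n (ind ?U m n \<phi> z)) j = coord (ind (R_obj ?Z) m n \<phi> (R_unit m z)) j"
      using i j F_maps_le[OF \<phi> i] by (auto simp: ind_R_obj[OF closed] coord_tuple) (auto simp: z R_unit_apply coord_tuple)
  qed
next
  fix n and z :: "'a univ" assume "z \<in> points (sp (day_unit :: ('g, 'a univ) FG_space) n)"
  then show "R_unit n z \<in> points (sp (R_obj (integers_G :: ('g, 'a univ) G_group)) n)"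
    using R_unit_closed by simp
qed (simp add: R_unit_def)

lemma R_unit_equivariant: "equivariant G (day_unit :: ('g, 'a univ) FG_space) (R_obj integers_G) R_unit"
  unfolding equivariant_def
proof (intro allI ballI)
  fix n g and z :: "'a univ" assume z: "z \<in> points (sp (day_unit :: ('g, 'a univ) FG_space) n)"
  note a = R_unit_closed[OF z]
  have "act (sp (R_obj integers_G) n) g (R_unit n z) = tuple n (coord (R_unit n z))"
    unfolding act_R_obj[OF a] tuple_def using coord_closed[OF a] by (auto simp: integers_G_def Suc_le_eq simp del: upt_Suc)
  then show "R_unit n (act (sp day_unit n) g z) = act (sp (R_obj integers_G) n) g (R_unit n z)"
    using z by (simp add: tuple_coord[OF a]) (auto simp: day_unit_def)
qed

section \<open>The structure maps of Day convolution\<close>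

lemma natural_family_day_map:
  assumes F: "F_set X" "F_set Y" "F_set X'" "F_set Y'" and \<theta>: "\<theta> \<in> F_nat X X'" and \<xi>: "\<xi> \<in> F_nat Y Y'"
  shows "natural_family X Y (day X' Y') (\<lambda>m n x y. day_pair X' Y' m n (\<theta> m x) (\<xi> n y))"
proof (rule natural_familyI)
  note closed = F_nat_closed[OF \<theta>] F_nat_closed[OF \<xi>]
  fix m m' n n' \<phi> \<psi> x y
  assume *: "\<phi> \<in> F_maps m m'" "\<psi> \<in> F_maps n n'" "x \<in> points (sp X m)" "y \<in> points (sp Y n)"
  then show "day_pair X' Y' m' n' (\<theta> m' (ind X m m' \<phi> x)) (\<xi> n' (ind Y n n' \<psi> y))
      = ind (day X' Y') (m * n) (m' * n') (F_smash m n n' \<phi> \<psi>) (day_pair X' Y' m n (\<theta> m x) (\<xi> n y))"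
    using natural_family_day_pair[OF F(3,4)] closed
    by (simp add: F_nat_ind[OF \<theta>] F_nat_ind[OF \<xi>] natural_family_def)
qed (intro day_pair_points F F_nat_closed[OF \<theta>] F_nat_closed[OF \<xi>])

lemma equivariant_family_day_map:
  assumes F: "FG_set G X'" "FG_set G Y'"
    and "\<theta> \<in> F_nat X X'" "\<xi> \<in> F_nat Y Y'" "equivariant G X X' \<theta>" "equivariant G Y Y' \<xi>"
  shows "equivariant_family G X Y (day X' Y') (\<lambda>m n x y. day_pair X' Y' m n (\<theta> m x) (\<xi> n y))"
  using equivariant_family_day_pair[OF F] assms(3-) F_nat_closed[OF assms(3)] F_nat_closed[OF assms(4)]
  by (simp add: equivariant_family_def equivariant_def)

lemma equivariant_F_ident: "FG_set G X \<Longrightarrow> equivariant G X X (F_ident X)"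
  by (simp add: equivariant_def FG_set.act_closed)

section \<open>Families for the unit constraints and the braiding\<close>

lemma lex_pos_left_F_maps: "i \<le> m \<Longrightarrow> (\<lambda>j\<in>{..n}. lex_pos n i j) \<in> F_maps n (m * n)"
  by (auto simp: F_maps_def lex_pos_le)

lemma lex_pos_right_F_maps: "j \<le> n \<Longrightarrow> (\<lambda>i\<in>{..m}. lex_pos n i j) \<in> F_maps m (m * n)"
  by (auto simp: F_maps_def lex_pos_le)

text \<open>The map n = 1 \<and> n \<rightarrow> m \<and> n picked out by \<open>i\<close> is
  natural in both \<open>n\<close> and the pair \<open>(m, i)\<close>; this gives naturality of the
  left unit family.\<close>

lemma F_smash_lex_pos_left:
  assumes "\<phi> \<in> F_maps m m'" "\<psi> \<in> F_maps n n'" "i \<le> m"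
  shows "compose {..n} (F_smash m n n' \<phi> \<psi>) (\<lambda>j\<in>{..n}. lex_pos n i j)
       = compose {..n} (\<lambda>j\<in>{..n'}. lex_pos n' (\<phi> i) j) \<psi>"
  using assms F_maps_le[OF assms(2)]
  by (auto simp: compose_def fun_eq_iff restrict_def F_smash_lex_pos)

lemma F_smash_lex_pos_right:
  assumes "\<phi> \<in> F_maps m m'" "\<psi> \<in> F_maps n n'" "j \<le> n"
  shows "compose {..m} (F_smash m n n' \<phi> \<psi>) (\<lambda>i\<in>{..m}. lex_pos n i j)
       = compose {..m} (\<lambda>i\<in>{..m'}. lex_pos n' i (\<psi> j)) \<phi>"
  using assms F_maps_le[OF assms(1)]
  by (auto simp: compose_def fun_eq_iff restrict_def F_smash_lex_pos)

abbreviation left_unit_family :: "('g, 'a univ) FG_space \<Rightarrow> nat \<Rightarrow> nat \<Rightarrow> 'a univ \<Rightarrow> 'a univ \<Rightarrow> 'a univ" where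
  "left_unit_family X \<equiv> \<lambda>m n i x. ind X n (m * n) (\<lambda>j\<in>{..n}. lex_pos n (nat (the_Z i)) j) x"

abbreviation right_unit_family :: "('g, 'a univ) FG_space \<Rightarrow> nat \<Rightarrow> nat \<Rightarrow> 'a univ \<Rightarrow> 'a univ \<Rightarrow> 'a univ" where
  "right_unit_family X \<equiv> \<lambda>m n x j. ind X m (m * n) (\<lambda>i\<in>{..m}. lex_pos n i (nat (the_Z j))) x"

abbreviation braid_family ::
    "('g, 'a univ) FG_space \<Rightarrow> ('g, 'a univ) FG_space \<Rightarrow> nat \<Rightarrow> nat \<Rightarrow> 'a univ \<Rightarrow> 'a univ \<Rightarrow> 'a univ" where
  "braid_family X Y \<equiv> \<lambda>m n x y. ind (day Y X) (n * m) (m * n) (F_twist n m) (day_pair Y X n m y x)"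

lemma natural_left_unit_family:
  assumes "F_set X"
  shows "natural_family day_unit X X (left_unit_family X)"
proof (rule natural_familyI)
  interpret X: F_set X by fact
  fix m n and z x :: "'b univ" assume "z \<in> points (sp day_unit m)" "x \<in> points (sp X n)"
  then show "left_unit_family X m n z x \<in> points (sp X (m * n))"
    by (auto simp: X.ind_closed lex_pos_left_F_maps)
next
  interpret X: F_set X by fact
  fix m m' n n' :: nat and \<phi> \<psi> and z x :: "'b univ"
  assume *: "\<phi> \<in> F_maps m m'" "\<psi> \<in> F_maps n n'" and "z \<in> points (sp day_unit m)" and x: "x \<in> points (sp X n)"
  then obtain i where z: "z = Z (int i)" and i: "i \<le> m" by auto
  show "left_unit_family X m' n' (ind day_unit m m' \<phi> z) (ind X n n' \<psi> x)
      = ind X (m * n) (m' * n') (F_smash m n n' \<phi> \<psi>) (left_unit_family X m n z x)"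
    using X.ind_compose[OF *(2) lex_pos_left_F_maps[OF F_maps_le[OF *(1) i]] x]
      X.ind_compose[OF lex_pos_left_F_maps[OF i] F_smash_F_maps[OF *] x] F_smash_lex_pos_left[OF * i] i
    by (simp add: z)
qed

lemma natural_right_unit_family:
  assumes "F_set X"
  shows "natural_family X day_unit X (right_unit_family X)"
proof (rule natural_familyI)
  interpret X: F_set X by fact
  fix m n and x z :: "'b univ" assume "x \<in> points (sp X m)" "z \<in> points (sp day_unit n)"
  then show "right_unit_family X m n x z \<in> points (sp X (m * n))"
    by (auto simp: X.ind_closed lex_pos_right_F_maps)
next
  interpret X: F_set X by fact
  fix m m' n n' :: nat and \<phi> \<psi> and x z :: "'b univ"
  assume *: "\<phi> \<in> F_maps m m'" "\<psi> \<in> F_maps n n'" and x: "x \<in> points (sp X m)" and "z \<in> points (sp day_unit n)"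
  then obtain j where z: "z = Z (int j)" and j: "j \<le> n" by auto
  show "right_unit_family X m' n' (ind X m m' \<phi> x) (ind day_unit n n' \<psi> z)
      = ind X (m * n) (m' * n') (F_smash m n n' \<phi> \<psi>) (right_unit_family X m n x z)"
    using X.ind_compose[OF *(1) lex_pos_right_F_maps[OF F_maps_le[OF *(2) j]] x]
      X.ind_compose[OF lex_pos_right_F_maps[OF j] F_smash_F_maps[OF *] x] F_smash_lex_pos_right[OF * j] j
    by (simp add: z)
qed

lemma equivariant_unit_families:
  assumes "FG_set G X"
  shows "equivariant_family G day_unit X X (left_unit_family X)"
    and "equivariant_family G X day_unit X (right_unit_family X)"
proof -
  interpret X: FG_set G X by fact
  show "equivariant_family G day_unit X X (left_unit_family X)"
    by (auto simp: equivariant_family_def X.act_ind lex_pos_left_F_maps) (auto simp: day_unit_def)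
  show "equivariant_family G X day_unit X (right_unit_family X)"
    by (auto simp: equivariant_family_def X.act_ind lex_pos_right_F_maps) (auto simp: day_unit_def)
qed

text \<open>The levels \<open>n * m\<close> and \<open>m * n\<close> are the same number but
  enumerate pairs in different orders. \<open>F_twist\<close> corrects for this, and its naturality
  is the content of the proof.\<close>

lemma natural_braid_family:
  assumes X: "F_set X" and Y: "F_set Y"
  shows "natural_family X Y (day Y X) (braid_family X Y)"
proof (rule natural_familyI)
  interpret YX: F_set "day Y X" by (rule F_set_day[OF Y X])
  note pair = day_pair_points[OF Y X]
  show "braid_family X Y m n x y \<in> points (sp (day Y X) (m * n))"
    if "x \<in> points (sp X m)" "y \<in> points (sp Y n)" for m n x y
    by (rule YX.ind_closed[OF F_twist_F_maps pair[OF that(2,1)]])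
  fix m m' n n' \<phi> \<psi> x y
  assume *: "\<phi> \<in> F_maps m m'" "\<psi> \<in> F_maps n n'" "x \<in> points (sp X m)" "y \<in> points (sp Y n)"
  have "day_pair Y X n' m' (ind Y n n' \<psi> y) (ind X m m' \<phi> x)
      = ind (day Y X) (n * m) (n' * m') (F_smash n m m' \<psi> \<phi>) (day_pair Y X n m y x)"
    using natural_family_day_pair[OF Y X] * by (simp add: natural_family_def)
  then show "braid_family X Y m' n' (ind X m m' \<phi> x) (ind Y n n' \<psi> y)
      = ind (day Y X) (m * n) (m' * n') (F_smash m n n' \<phi> \<psi>) (braid_family X Y m n x y)"
    using YX.ind_compose[OF F_smash_F_maps[OF *(2,1)] F_twist_F_maps pair[OF *(4,3)]]
      YX.ind_compose[OF F_twist_F_maps F_smash_F_maps[OF *(1,2)] pair[OF *(4,3)]] F_twist_natural[OF *(2,1)]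
    by simp
qed

lemma equivariant_braid_family:
  assumes X: "FG_set G X" and Y: "FG_set G Y"
  shows "equivariant_family G X Y (day Y X) (braid_family X Y)"
proof -
  interpret YX: FG_set G "day Y X" by (rule FG_set_day[OF Y X])
  show ?thesis
    using equivariant_family_day_pair[OF Y X] day_pair_points[OF Y[THEN FG_set_imp_F_set] X[THEN FG_set_imp_F_set]]
    by (simp add: equivariant_family_def YX.act_ind F_twist_F_maps)
qed

section \<open>R is lax symmetric monoidal\<close>

lemma FG_spaces_simps [simp]:
  "Obj (FG_spaces G) = {X. is_FG_space G X}"
  "Hom (FG_spaces G) X Y = {\<theta> \<in> FG_maps G X Y. is_FG_space G X \<and> is_FG_space G Y}"
  "Ident (FG_spaces G) X = F_ident X"
  "Comp (FG_spaces G) X \<theta> \<xi> = F_compose X \<theta> \<xi>"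
  "Tensor (FG_spaces G) = day"
  "TensorHom (FG_spaces G) X X' Y Y' \<theta> \<xi>
    = day_lift G X Y (day X' Y') (\<lambda>m n x y. day_pair X' Y' m n (\<theta> m x) (\<xi> n y))"
  "Unit (FG_spaces G) = day_unit"
  "Assoc (FG_spaces G) = day_assoc G"
  "LUnit (FG_spaces G) X = day_lift G day_unit X X (left_unit_family X)"
  "RUnit (FG_spaces G) X = day_lift G X day_unit X (right_unit_family X)"
  "Braid (FG_spaces G) X Y = day_lift G X Y (day Y X) (braid_family X Y)"
  by (simp_all add: FG_spaces_def F_ident_def F_compose_def)

lemma abelian_G_groups_simps [simp]:
  "Obj (abelian_G_groups G) = {A. abelian_G_group G A}"
  "Hom (abelian_G_groups G) A B = {f \<in> G_homs G A B. abelian_G_group G A \<and> abelian_G_group G B}"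
  "Ident (abelian_G_groups G) A = (\<lambda>a\<in>carrier A. a)"
  "Comp (abelian_G_groups G) A g f = compose (carrier A) g f"
  "Tensor (abelian_G_groups G) = tensor_G"
  "TensorHom (abelian_G_groups G) A A' B B' f g
    = tensor_lift A B (tensor_G A' B') (\<lambda>a b. pure_tensor A' B' (f a) (g b))"
  "Unit (abelian_G_groups G) = integers_G"
  "Assoc (abelian_G_groups G) = tensor_assoc"
  "LUnit (abelian_G_groups G) A = tensor_lift (integers_G :: ('g, 'a univ) G_group) A A (\<lambda>z a. a [^]\<^bsub>A\<^esub> the_Z z)"
  "RUnit (abelian_G_groups G) A = tensor_lift A (integers_G :: ('g, 'a univ) G_group) A (\<lambda>a z. a [^]\<^bsub>A\<^esub> the_Z z)"
  "Braid (abelian_G_groups G) A B = tensor_lift A B (tensor_G B A) (\<lambda>a b. pure_tensor B A b a)"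
  for G :: "('g, 'x) monoid_scheme" and A B A' B' :: "('g, 'a univ) G_group"
  by (simp_all add: abelian_G_groups_def)

definition R_mult ::
    "('g, 'x) monoid_scheme \<Rightarrow> ('g, 'a univ) G_group \<Rightarrow> ('g, 'a univ) G_group \<Rightarrow> nat \<Rightarrow> 'a univ \<Rightarrow> 'a univ" where
  "R_mult G A B = day_lift G (R_obj A) (R_obj B) (R_obj (tensor_G A B)) (pairing A B)"

lemma R_hom_ident: "R_hom A A (\<lambda>a\<in>carrier A. a) = F_ident (R_obj A)"
proof
  fix n
  have "R_hom A A (\<lambda>a\<in>carrier A. a) n a = a" if "a \<in> powers A n" for a
    by (rule powers_eqI[of _ A n _ A]) (use that in \<open>auto simp: R_hom_apply tuple_powers_iff coord_tuple coord_closed\<close>)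
  then show "R_hom A A (\<lambda>a\<in>carrier A. a) n = F_ident (R_obj A) n"
    by (intro extensionalityI[of _ "powers A n"]) (auto simp: R_hom_def F_ident_def)
qed

lemma R_hom_compose:
  assumes "f \<in> hom A B"
  shows "R_hom A C (compose (carrier A) g f) = F_compose (R_obj A) (R_hom B C g) (R_hom A B f)"
proof
  fix n
  have "R_hom A C (compose (carrier A) g f) n a = R_hom B C g n (R_hom A B f n a)" if a: "a \<in> powers A n" for a
  proof -
    have b: "R_hom A B f n a \<in> powers B n"
      using a assms by (auto simp: R_hom_apply tuple_powers_iff coord_closed hom_def Pi_def)
    show ?thesis
      unfolding R_hom_apply[OF b] unfolding R_hom_apply[OF a]
      by (rule tuple_cong) (simp add: compose_eq coord_closed[OF a] coord_tuple)
  qed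
  then show "R_hom A C (compose (carrier A) g f) n = F_compose (R_obj A) (R_hom B C g) (R_hom A B f) n"
    by (intro extensionalityI[of _ "powers A n"]) (auto simp: R_hom_def F_compose_def compose_def)
qed

lemma coord_R_hom_pairing:
  assumes "comm_group A" "comm_group B" "x \<in> powers A m" "y \<in> powers B n"
    and "0 < i" "i \<le> m" "0 < j" "j \<le> n"
  shows "coord (R_hom (tensor_G A B) C h (m * n) (pairing A B m n x y)) (lex_pos n i j)
       = h (pure_tensor A B (coord x i) (coord y j))"
  using assms by (simp add: R_hom_apply[OF pairing_closed] coord_tuple lex_pos_le coord_pairing)

lemma R_hom_closed: "f \<in> hom A B \<Longrightarrow> a \<in> powers A n \<Longrightarrow> R_hom A B f n a \<in> powers B n"
  by (auto simp: R_hom_apply tuple_powers_iff coord_closed hom_def Pi_def)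

section \<open>Naturality and coherence of the multiplication of R\<close>

locale R_functor = group G for G :: "('g, 'x) monoid_scheme"
begin

lemma FG_set_R: "abelian_G_group G A \<Longrightarrow> FG_set G (R_obj A)"
  by (rule FG_set_R_obj[OF is_group])

lemma comm_group_of: "abelian_G_group G A \<Longrightarrow> comm_group A"
  by (simp add: abelian_G_group_def)

lemma F_set_R: "abelian_G_group G A \<Longrightarrow> F_set (R_obj A)"
  by (rule F_set_R_obj[OF comm_group_of])

lemma tensor_closed: "abelian_G_group G A \<Longrightarrow> abelian_G_group G B \<Longrightarrow> abelian_G_group G (tensor_G A B)"
  by (rule abelian_G_group_tensor_G[OF is_group])

context
  fixes A B :: "('g, 'a univ) G_group"
  assumes A: "abelian_G_group G A" and B: "abelian_G_group G B"
begin

text \<open>The premises common to all facts about \<open>day_lift\<close>: the actions on the two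
  sources and the target, then naturality and equivariance of the family. The local bundles
  \<open>lift\<close>, \<open>lift_l\<close>, \<open>lift_L\<close> and \<open>lift_r\<close> below
  have the same shape.\<close>

lemmas R_mult_lift = FG_set_R[OF A] FG_set_R[OF B] FG_set_R[OF tensor_closed[OF A B]]
  natural_family_pairing[OF comm_group_of[OF A] comm_group_of[OF B]] equivariant_family_pairing[OF A B]

lemma R_mult_F_nat: "R_mult G A B \<in> F_nat (day (R_obj A) (R_obj B)) (R_obj (tensor_G A B))"
  unfolding R_mult_def by (rule day_lift_F_nat[OF R_mult_lift])

lemma R_mult_equivariant: "equivariant G (day (R_obj A) (R_obj B)) (R_obj (tensor_G A B)) (R_mult G A B)"
  unfolding R_mult_def by (rule equivariant_day_lift[OF R_mult_lift])

lemma R_mult_pair: "x \<in> powers A m \<Longrightarrow> y \<in> powers B n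
    \<Longrightarrow> R_mult G A B (m * n) (day_pair (R_obj A) (R_obj B) m n x y) = pairing A B m n x y"
  unfolding R_mult_def using day_lift_pair[OF R_mult_lift] by simp

end

lemma R_hom_FG_maps:
  assumes "abelian_G_group G A" "abelian_G_group G B" "f \<in> G_homs G A B"
  shows "R_hom A B f \<in> FG_maps G (R_obj A) (R_obj B)"
  using assms R_hom_F_nat[OF comm_group_of comm_group_of] R_hom_equivariant[OF assms(1,3)]
  by (auto simp: FG_maps_iff F_set_R G_homs_def)

text \<open>On a generator, the coordinate at \<open>(i, j)\<close> is on both sides the pure tensor
  of \<open>f\<close> of the i-th coordinate of \<open>x\<close> and \<open>g\<close> of the j-th
  coordinate of \<open>y\<close>.\<close>

lemma R_mult_natural:
  assumes A: "abelian_G_group G A" "abelian_G_group G A'" and B: "abelian_G_group G B" "abelian_G_group G B'"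
    and f: "f \<in> G_homs G A A'" and g: "g \<in> G_homs G B B'"
  shows "F_compose (day (R_obj A) (R_obj B)) (R_mult G A' B')
      (day_lift G (R_obj A) (R_obj B) (day (R_obj A') (R_obj B'))
        (\<lambda>m n x y. day_pair (R_obj A') (R_obj B') m n (R_hom A A' f m x) (R_hom B B' g n y)))
    = F_compose (day (R_obj A) (R_obj B))
      (R_hom (tensor_G A B) (tensor_G A' B') (tensor_lift A B (tensor_G A' B') (\<lambda>a b. pure_tensor A' B' (f a) (g b))))
      (R_mult G A B)"
    (is "F_compose _ _ ?l = F_compose _ (R_hom _ _ ?h) _")
proof -
  have fg: "f \<in> hom A A'" "g \<in> hom B B'" using f g by (auto simp: G_homs_def)
  note Rf = R_hom_F_nat[OF comm_group_of[OF A(1)] comm_group_of[OF A(2)] fg(1)] and Rg = R_hom_F_nat[OF comm_group_of[OF B(1)] comm_group_of[OF B(2)] fg(2)]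
  note lift = FG_set_R[OF A(1)] FG_set_R[OF B(1)] FG_set_day[OF FG_set_R[OF A(2)] FG_set_R[OF B(2)]]
    natural_family_day_map[OF F_set_R[OF A(1)] F_set_R[OF B(1)] F_set_R[OF A(2)] F_set_R[OF B(2)] Rf Rg]
    equivariant_family_day_map[OF FG_set_R[OF A(2)] FG_set_R[OF B(2)] Rf Rg R_hom_equivariant[OF A(1) f] R_hom_equivariant[OF B(1) g]]
  have bil: "bilinear_map A B (tensor_G A' B') (\<lambda>a b. pure_tensor A' B' (f a) (g b))"
    using bilinear_tensor_hom[OF comm_group_of[OF A(2)] comm_group_of[OF B(2)] fg] by simp
  note T = comm_group_tensor_G[OF comm_group_of[OF A(2)] comm_group_of[OF B(2)]]
  note h = tensor_lift_hom[OF comm_group_of[OF A(1)] comm_group_of[OF B(1)] T bil]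
  have Rh: "R_hom (tensor_G A B) (tensor_G A' B') ?h \<in> F_nat (R_obj (tensor_G A B)) (R_obj (tensor_G A' B'))"
    using h by (intro R_hom_F_nat comm_group_of tensor_closed A B) simp
  show ?thesis
  proof (rule F_nat_day_eqI[OF F_set_R[OF A(1)] F_set_R[OF B(1)]])
    show "F_compose (day (R_obj A) (R_obj B)) (R_mult G A' B') ?l \<in> F_nat (day (R_obj A) (R_obj B)) (R_obj (tensor_G A' B'))"
      by (rule F_compose_F_nat[OF day_lift_F_nat[OF lift] R_mult_F_nat[OF A(2) B(2)] F_set_day[OF F_set_R[OF A(1)] F_set_R[OF B(1)]]])
    show "F_compose (day (R_obj A) (R_obj B)) (R_hom (tensor_G A B) (tensor_G A' B') ?h) (R_mult G A B)
        \<in> F_nat (day (R_obj A) (R_obj B)) (R_obj (tensor_G A' B'))"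
      by (rule F_compose_F_nat[OF R_mult_F_nat[OF A(1) B(1)] Rh F_set_day[OF F_set_R[OF A(1)] F_set_R[OF B(1)]]])
    fix m n x y assume "x \<in> points (sp (R_obj A) m)" "y \<in> points (sp (R_obj B) n)"
    then have x: "x \<in> powers A m" and y: "y \<in> powers B n" by simp_all
    note p = pairing_closed[OF comm_group_of[OF A(1)] comm_group_of[OF B(1)] x y]
    note xy' = R_hom_closed[OF fg(1) x] R_hom_closed[OF fg(2) y]
    have "pairing A' B' m n (R_hom A A' f m x) (R_hom B B' g n y)
        = R_hom (tensor_G A B) (tensor_G A' B') ?h (m * n) (pairing A B m n x y)"
    proof (rule powers_lex_eqI[OF pairing_closed[OF comm_group_of[OF A(2)] comm_group_of[OF B(2)] xy'] R_hom_closed[OF _ p]])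
      fix i j assume "0 < i" "i \<le> m" "0 < j" "j \<le> n"
      then show "coord (pairing A' B' m n (R_hom A A' f m x) (R_hom B B' g n y)) (lex_pos n i j)
          = coord (R_hom (tensor_G A B) (tensor_G A' B') ?h (m * n) (pairing A B m n x y)) (lex_pos n i j)"
        by (simp add: coord_pairing coord_R_hom_pairing[OF comm_group_of[OF A(1)] comm_group_of[OF B(1)] x y] coord_closed[OF x] coord_closed[OF y]
            tensor_lift_pure[OF comm_group_of[OF A(1)] comm_group_of[OF B(1)] T bil] R_hom_apply[OF x] R_hom_apply[OF y] coord_tuple)
    qed (use h in simp)
    then show "F_compose (day (R_obj A) (R_obj B)) (R_mult G A' B') ?l (m * n) (day_pair (R_obj A) (R_obj B) m n x y)
      = F_compose (day (R_obj A) (R_obj B)) (R_hom (tensor_G A B) (tensor_G A' B') ?h) (R_mult G A B) (m * n) (day_pair (R_obj A) (R_obj B) m n x y)"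
      using x y xy' day_pair_points[OF F_set_R[OF A(1)] F_set_R[OF B(1)], of x m y n]
      by (simp add: day_lift_pair[OF lift] R_mult_pair A B)
  qed
qed

text \<open>At the position of \<open>(i, j, k)\<close> both sides are the right-bracketed pure
  tensor of the three coordinates; \<open>lex_pos_assoc\<close> says that the two bracketings mean
  the same position.\<close>

lemma pairing_assoc:
  assumes A: "comm_group A" and B: "comm_group B" and C: "comm_group C"
    and x: "x \<in> powers A m" and y: "y \<in> powers B n" and w: "w \<in> powers C p"
  shows "R_hom (tensor_G (tensor_G A B) C) (tensor_G A (tensor_G B C)) (tensor_assoc A B C) (m * n * p)
      (pairing (tensor_G A B) C (m * n) p (pairing A B m n x y) w)
    = pairing A (tensor_G B C) m (n * p) x (pairing B C n p y w)" (is "R_hom _ _ _ _ ?l = ?r")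
proof (rule powers_lex_eqI)
  note AB = comm_group_tensor_G[OF A B] and BC = comm_group_tensor_G[OF B C]
  note xy = pairing_closed[OF A B x y] and yw = pairing_closed[OF B C y w]
  show "R_hom (tensor_G (tensor_G A B) C) (tensor_G A (tensor_G B C)) (tensor_assoc A B C) (m * n * p) ?l
      \<in> powers (tensor_G A (tensor_G B C)) (m * n * p)"
    by (rule R_hom_closed[OF tensor_assoc_hom[OF A B C] pairing_closed[OF AB C xy w]])
  show "?r \<in> powers (tensor_G A (tensor_G B C)) (m * n * p)"
    using pairing_closed[OF A BC x yw] by (simp only: mult.assoc)
  fix l k assume l: "0 < l" "l \<le> m * n" and k: "0 < k" "k \<le> p"
  define i j where "i = lex_row n l" and "j = lex_col n l"
  have ij: "0 < i" "i \<le> m" "0 < j" "j \<le> n" and l_eq: "l = lex_pos n i j"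
    using l by (auto simp: i_def j_def lex_row_bounds lex_col_bounds lex_pos_row_col)
  have "coord (R_hom (tensor_G (tensor_G A B) C) (tensor_G A (tensor_G B C)) (tensor_assoc A B C) (m * n * p) ?l) (lex_pos p l k)
      = pure_tensor A (tensor_G B C) (coord x i) (pure_tensor B C (coord y j) (coord w k))"
    unfolding coord_R_hom_pairing[OF AB C xy w l k] unfolding l_eq coord_pairing[OF ij]
    by (rule tensor_assoc_pure[OF A B C coord_closed[OF x ij(1,2)] coord_closed[OF y ij(3,4)] coord_closed[OF w k]])
  also have "\<dots> = coord ?r (lex_pos (n * p) i (lex_pos p j k))"
    using ij k by (simp add: coord_pairing lex_pos_le)
  also have "lex_pos (n * p) i (lex_pos p j k) = lex_pos p l k"
    using ij k by (simp add: l_eq lex_pos_assoc)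
  finally show "coord (R_hom (tensor_G (tensor_G A B) C) (tensor_G A (tensor_G B C)) (tensor_assoc A B C) (m * n * p) ?l) (lex_pos p l k)
      = coord ?r (lex_pos p l k)" .
qed

lemma R_mult_assoc:
  assumes A: "abelian_G_group G A" and B: "abelian_G_group G B" and E: "abelian_G_group G E"
    and P: "P = day (day (R_obj A) (R_obj B)) (R_obj E)"
  shows "F_compose P (R_mult G A (tensor_G B E))
      (F_compose P
        (day_lift G (R_obj A) (day (R_obj B) (R_obj E)) (day (R_obj A) (R_obj (tensor_G B E)))
          (\<lambda>m n x y. day_pair (R_obj A) (R_obj (tensor_G B E)) m n (F_ident (R_obj A) m x) (R_mult G B E n y)))
        (day_assoc G (R_obj A) (R_obj B) (R_obj E)))
    = F_compose P
      (R_hom (tensor_G (tensor_G A B) E) (tensor_G A (tensor_G B E)) (tensor_assoc A B E))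
      (F_compose P (R_mult G (tensor_G A B) E)
        (day_lift G (day (R_obj A) (R_obj B)) (R_obj E) (day (R_obj (tensor_G A B)) (R_obj E))
          (\<lambda>m n x y. day_pair (R_obj (tensor_G A B)) (R_obj E) m n (R_mult G A B m x) (F_ident (R_obj E) n y))))"
    (is "F_compose P _ (F_compose P ?l _) = F_compose P ?h (F_compose P _ ?r)")
proof -
  note AB = tensor_closed[OF A B] and BE = tensor_closed[OF B E]
  note F_set_R = F_set_R[OF A] F_set_R[OF B] F_set_R[OF E] F_set_R[OF AB] F_set_R[OF BE]
  note FG_set_R = FG_set_R[OF A] FG_set_R[OF B] FG_set_R[OF E] FG_set_R[OF AB] FG_set_R[OF BE]
  note dBE = F_set_day[OF F_set_R(2,3)] and dAB = F_set_day[OF F_set_R(1,2)]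
  note lift_l = FG_set_R(1) FG_set_day[OF FG_set_R(2,3)] FG_set_day[OF FG_set_R(1,5)]
    natural_family_day_map[OF F_set_R(1) dBE F_set_R(1,5) F_ident_F_nat[OF F_set_R(1)] R_mult_F_nat[OF B E]]
    equivariant_family_day_map[OF FG_set_R(1,5) F_ident_F_nat[OF F_set_R(1)] R_mult_F_nat[OF B E]
      equivariant_F_ident[OF FG_set_R(1)] R_mult_equivariant[OF B E]]
  note lift_r = FG_set_day[OF FG_set_R(1,2)] FG_set_R(3) FG_set_day[OF FG_set_R(4,3)]
    natural_family_day_map[OF dAB F_set_R(3,4,3) R_mult_F_nat[OF A B] F_ident_F_nat[OF F_set_R(3)]]
    equivariant_family_day_map[OF FG_set_R(4,3) R_mult_F_nat[OF A B] F_ident_F_nat[OF F_set_R(3)]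
      R_mult_equivariant[OF A B] equivariant_F_ident[OF FG_set_R(3)]]
  have FP: "F_set P" unfolding P by (rule F_set_day[OF dAB F_set_R(3)])
  have h: "?h \<in> F_nat (R_obj (tensor_G (tensor_G A B) E)) (R_obj (tensor_G A (tensor_G B E)))"
    by (intro R_hom_F_nat tensor_assoc_hom comm_group_of tensor_closed A B E)
  have "F_compose P (R_mult G A (tensor_G B E)) (F_compose P ?l (day_assoc G (R_obj A) (R_obj B) (R_obj E)))
      \<in> F_nat P (R_obj (tensor_G A (tensor_G B E)))"
    by (intro F_compose_F_nat[OF _ R_mult_F_nat[OF A BE] FP] F_compose_F_nat[OF _ day_lift_F_nat[OF lift_l] FP])
      (simp only: P day_assoc_F_nat[OF FG_set_R(1-3)])
  moreover have "F_compose P ?h (F_compose P (R_mult G (tensor_G A B) E) ?r) \<in> F_nat P (R_obj (tensor_G A (tensor_G B E)))"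
    by (intro F_compose_F_nat[OF _ h FP] F_compose_F_nat[OF _ R_mult_F_nat[OF AB E] FP])
      (simp only: P day_lift_F_nat[OF lift_r])
  ultimately show ?thesis
    unfolding P
  proof (rule F_nat_day3_eqI[OF F_set_R(1-3)])
    fix m n p x y w
    assume xyw: "x \<in> points (sp (R_obj A) m)" "y \<in> points (sp (R_obj B) n)" "w \<in> points (sp (R_obj E) p)"
    then have x: "x \<in> powers A m" and y: "y \<in> powers B n" and w: "w \<in> powers E p" by simp_all
    let ?q = "day_pair (day (R_obj A) (R_obj B)) (R_obj E) (m * n) p (day_pair (R_obj A) (R_obj B) m n x y) w"
    note xy = day_pair_points[OF F_set_R(1,2) xyw(1,2)] and yw = day_pair_points[OF F_set_R(2,3) xyw(2,3)]
    have q: "?q \<in> points (sp (day (day (R_obj A) (R_obj B)) (R_obj E)) (m * n * p))"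
      by (rule day_pair_points[OF dAB F_set_R(3) xy xyw(3)])
    note yw' = pairing_closed[OF comm_group_of[OF B] comm_group_of[OF E] y w] and xy' = pairing_closed[OF comm_group_of[OF A] comm_group_of[OF B] x y]
    have "R_mult G A (tensor_G B E) (m * n * p) (?l (m * n * p) (day_assoc G (R_obj A) (R_obj B) (R_obj E) (m * n * p) ?q))
        = pairing A (tensor_G B E) m (n * p) x (pairing B E n p y w)"
      \<comment> \<open>The level has to be rebracketed as \<open>m * (n * p)\<close> before the
        lift can be evaluated on a pair whose second entry sits at level
        \<open>n * p\<close>.\<close>
      unfolding day_assoc_pair[OF FG_set_R(1-3) xyw] unfolding mult.assoc
      using day_lift_pair[OF lift_l xyw(1) yw] xyw(1) R_mult_pair[OF A BE x yw'] R_mult_pair[OF B E y w] by simp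
    also have "\<dots> = ?h (m * n * p) (pairing (tensor_G A B) E (m * n) p (pairing A B m n x y) w)"
      by (rule pairing_assoc[OF comm_group_of[OF A] comm_group_of[OF B] comm_group_of[OF E] x y w, symmetric])
    also have "pairing (tensor_G A B) E (m * n) p (pairing A B m n x y) w = R_mult G (tensor_G A B) E (m * n * p) (?r (m * n * p) ?q)"
      using day_lift_pair[OF lift_r xy xyw(3)] xyw(3) R_mult_pair[OF AB E xy' w] R_mult_pair[OF A B x y] by simp
    finally show "F_compose (day (day (R_obj A) (R_obj B)) (R_obj E)) (R_mult G A (tensor_G B E))
          (F_compose (day (day (R_obj A) (R_obj B)) (R_obj E)) ?l (day_assoc G (R_obj A) (R_obj B) (R_obj E))) (m * n * p) ?q
        = F_compose (day (day (R_obj A) (R_obj B)) (R_obj E)) ?h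
          (F_compose (day (day (R_obj A) (R_obj B)) (R_obj E)) (R_mult G (tensor_G A B) E) ?r) (m * n * p) ?q"
      using q by simp
  qed
qed

text \<open>On a generator with first entry \<open>i\<close>, the coordinate at
  \<open>(a, b)\<close> is coordinate \<open>b\<close> of \<open>x\<close> if \<open>a = i\<close>
  and neutral otherwise. On one side this is a product over a fibre, on the other a power with
  exponent 1 or 0 read off the basis vector.\<close>

lemma R_left_unit:
  fixes A :: "('g, 'a univ) G_group"
  assumes A: "abelian_G_group G A" and P: "P = day day_unit (R_obj A)"
  shows "day_lift G day_unit (R_obj A) (R_obj A) (left_unit_family (R_obj A))
    = F_compose P
      (R_hom (tensor_G integers_G A) A (tensor_lift (integers_G :: ('g, 'a univ) G_group) A A (\<lambda>z a. a [^]\<^bsub>A\<^esub> the_Z z)))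
      (F_compose P (R_mult G integers_G A)
        (day_lift G day_unit (R_obj A) (day (R_obj integers_G) (R_obj A))
          (\<lambda>m n x y. day_pair (R_obj integers_G) (R_obj A) m n (R_unit m x) (F_ident (R_obj A) n y))))"
    (is "?L = F_compose P (R_hom _ _ ?h) (F_compose P _ ?l)")
proof -
  let ?Z = "integers_G :: ('g, 'a univ) G_group" and ?U = "day_unit :: ('g, 'a univ) FG_space"
  have Z: "abelian_G_group G ?Z" and U: "FG_set G ?U"
    by (rule abelian_G_group_integers_G[OF is_group], rule FG_set_day_unit[OF is_group])
  note FU = FG_set_imp_F_set[OF U]
  interpret A: comm_group A by (rule comm_group_of[OF A])
  have bil: "bilinear_map ?Z A A (\<lambda>z a. a [^]\<^bsub>A\<^esub> the_Z z)"
    by (rule bilinear_int_pow(1)[OF comm_group_of[OF A]])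
  note h = tensor_lift_hom[OF comm_group_of[OF Z] comm_group_of[OF A] comm_group_of[OF A] bil]
  note lift_L = U FG_set_R[OF A] FG_set_R[OF A] natural_left_unit_family[OF F_set_R[OF A]] equivariant_unit_families(1)[OF FG_set_R[OF A]]
  note lift_l = U FG_set_R[OF A] FG_set_day[OF FG_set_R[OF Z] FG_set_R[OF A]]
    natural_family_day_map[OF FU F_set_R[OF A] F_set_R[OF Z] F_set_R[OF A] R_unit_F_nat F_ident_F_nat[OF F_set_R[OF A]]]
    equivariant_family_day_map[OF FG_set_R[OF Z] FG_set_R[OF A] R_unit_F_nat F_ident_F_nat[OF F_set_R[OF A]]
      R_unit_equivariant equivariant_F_ident[OF FG_set_R[OF A]]]
  have FP: "F_set P" unfolding P by (rule F_set_day[OF FU F_set_R[OF A]])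
  have Rh: "R_hom (tensor_G ?Z A) A ?h \<in> F_nat (R_obj (tensor_G ?Z A)) (R_obj A)"
    using h by (intro R_hom_F_nat comm_group_of[OF tensor_closed[OF Z A]] comm_group_of[OF A]) simp
  have "F_compose P (R_hom (tensor_G ?Z A) A ?h) (F_compose P (R_mult G ?Z A) ?l) \<in> F_nat P (R_obj A)"
    by (intro F_compose_F_nat[OF _ Rh FP] F_compose_F_nat[OF _ R_mult_F_nat[OF Z A] FP])
      (simp only: P day_lift_F_nat[OF lift_l])
  with day_lift_F_nat[OF lift_L] show ?thesis
    unfolding P
  proof (rule F_nat_day_eqI[OF FU F_set_R[OF A]])
    fix m n and z x :: "'a univ" assume z: "z \<in> points (sp ?U m)" and x': "x \<in> points (sp (R_obj A) n)"
    from z obtain i where z_eq: "z = Z (int i)" and i: "i \<le> m" by auto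
    from x' have x: "x \<in> powers A n" by simp
    have e: "R_unit m z \<in> powers ?Z m" by (rule R_unit_closed[OF z])
    note q = day_pair_points[OF FU F_set_R[OF A] z x']
    have "left_unit_family (R_obj A) m n z x = R_hom (tensor_G ?Z A) A ?h (m * n) (pairing ?Z A m n (R_unit m z) x)"
    proof (rule powers_lex_eqI)
      show "left_unit_family (R_obj A) m n z x \<in> powers A (m * n)"
        using F_set.ind_closed[OF F_set_R[OF A] lex_pos_left_F_maps[OF i] x'] by (simp add: z_eq)
      show "R_hom (tensor_G ?Z A) A ?h (m * n) (pairing ?Z A m n (R_unit m z) x) \<in> powers A (m * n)"
        using h by (intro R_hom_closed[OF _ pairing_closed[OF comm_group_of[OF Z] comm_group_of[OF A] e x]]) simp
      fix a b assume ab: "0 < a" "a \<le> m" "0 < b" "b \<le> n"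
      \<comment> \<open>Row \<open>i\<close> of the rectangle meets the position
        \<open>(a, b)\<close> once or not at all. For \<open>i = 0\<close> the whole row is the
        basepoint, while \<open>a\<close> is nonzero, so the fibre is empty as claimed.\<close>
      have "{j \<in> {1..n}. (\<lambda>j\<in>{..n}. lex_pos n (nat (the_Z z)) j) j = lex_pos n a b} = (if a = i then {b} else {})"
        using ab i by (auto simp: z_eq Suc_le_eq) (metis lex_pos_eq_iff)+
      then have "coord (left_unit_family (R_obj A) m n z x) (lex_pos n a b) = (if a = i then coord x b else \<one>\<^bsub>A\<^esub>)"
        using ab coord_closed[OF x ab(3,4)] by (simp add: ind_R_obj[OF x] coord_tuple lex_pos_le Pi_def)
      moreover have "coord (R_unit m z) a = Z (if a = i then 1 else 0)"
        using ab i by (simp add: z_eq R_unit_apply coord_tuple)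
      moreover have "Z k \<in> carrier ?Z" for k by (simp add: integers_G_def)
      ultimately show "coord (left_unit_family (R_obj A) m n z x) (lex_pos n a b)
          = coord (R_hom (tensor_G ?Z A) A ?h (m * n) (pairing ?Z A m n (R_unit m z) x)) (lex_pos n a b)"
        using coord_closed[OF x ab(3,4)]
        by (simp add: coord_R_hom_pairing[OF comm_group_of[OF Z] comm_group_of[OF A] e x ab] tensor_lift_pure[OF comm_group_of[OF Z] comm_group_of[OF A] comm_group_of[OF A] bil])
    qed
    then show "?L (m * n) (day_pair ?U (R_obj A) m n z x)
        = F_compose (day ?U (R_obj A)) (R_hom (tensor_G ?Z A) A ?h)
            (F_compose (day ?U (R_obj A)) (R_mult G ?Z A) ?l) (m * n) (day_pair ?U (R_obj A) m n z x)"
      using q day_lift_pair[OF lift_L z x'] day_lift_pair[OF lift_l z x'] R_mult_pair[OF Z A e x] x' by simp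
  qed
qed

lemma R_right_unit:
  fixes A :: "('g, 'a univ) G_group"
  assumes A: "abelian_G_group G A" and P: "P = day (R_obj A) day_unit"
  shows "day_lift G (R_obj A) day_unit (R_obj A) (right_unit_family (R_obj A))
    = F_compose P
      (R_hom (tensor_G A integers_G) A (tensor_lift A (integers_G :: ('g, 'a univ) G_group) A (\<lambda>a z. a [^]\<^bsub>A\<^esub> the_Z z)))
      (F_compose P (R_mult G A integers_G)
        (day_lift G (R_obj A) day_unit (day (R_obj A) (R_obj integers_G))
          (\<lambda>m n x y. day_pair (R_obj A) (R_obj integers_G) m n (F_ident (R_obj A) m x) (R_unit n y))))"
    (is "?L = F_compose P (R_hom _ _ ?h) (F_compose P _ ?l)")
proof -
  let ?Z = "integers_G :: ('g, 'a univ) G_group" and ?U = "day_unit :: ('g, 'a univ) FG_space"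
  have Z: "abelian_G_group G ?Z" and U: "FG_set G ?U"
    by (rule abelian_G_group_integers_G[OF is_group], rule FG_set_day_unit[OF is_group])
  note FU = FG_set_imp_F_set[OF U]
  interpret A: comm_group A by (rule comm_group_of[OF A])
  have bil: "bilinear_map A ?Z A (\<lambda>a z. a [^]\<^bsub>A\<^esub> the_Z z)"
    by (rule bilinear_int_pow(2)[OF comm_group_of[OF A]])
  note h = tensor_lift_hom[OF comm_group_of[OF A] comm_group_of[OF Z] comm_group_of[OF A] bil]
  note lift_L = FG_set_R[OF A] U FG_set_R[OF A] natural_right_unit_family[OF F_set_R[OF A]] equivariant_unit_families(2)[OF FG_set_R[OF A]]
  note lift_l = FG_set_R[OF A] U FG_set_day[OF FG_set_R[OF A] FG_set_R[OF Z]]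
    natural_family_day_map[OF F_set_R[OF A] FU F_set_R[OF A] F_set_R[OF Z] F_ident_F_nat[OF F_set_R[OF A]] R_unit_F_nat]
    equivariant_family_day_map[OF FG_set_R[OF A] FG_set_R[OF Z] F_ident_F_nat[OF F_set_R[OF A]] R_unit_F_nat
      equivariant_F_ident[OF FG_set_R[OF A]] R_unit_equivariant]
  have FP: "F_set P" unfolding P by (rule F_set_day[OF F_set_R[OF A] FU])
  have Rh: "R_hom (tensor_G A ?Z) A ?h \<in> F_nat (R_obj (tensor_G A ?Z)) (R_obj A)"
    using h by (intro R_hom_F_nat comm_group_of[OF tensor_closed[OF A Z]] comm_group_of[OF A]) simp
  have "F_compose P (R_hom (tensor_G A ?Z) A ?h) (F_compose P (R_mult G A ?Z) ?l) \<in> F_nat P (R_obj A)"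
    by (intro F_compose_F_nat[OF _ Rh FP] F_compose_F_nat[OF _ R_mult_F_nat[OF A Z] FP])
      (simp only: P day_lift_F_nat[OF lift_l])
  with day_lift_F_nat[OF lift_L] show ?thesis
    unfolding P
  proof (rule F_nat_day_eqI[OF F_set_R[OF A] FU])
    fix m n and x z :: "'a univ" assume x': "x \<in> points (sp (R_obj A) m)" and z: "z \<in> points (sp ?U n)"
    from z obtain j where z_eq: "z = Z (int j)" and j: "j \<le> n" by auto
    from x' have x: "x \<in> powers A m" by simp
    have e: "R_unit n z \<in> powers ?Z n" by (rule R_unit_closed[OF z])
    note q = day_pair_points[OF F_set_R[OF A] FU x' z]
    have "right_unit_family (R_obj A) m n x z = R_hom (tensor_G A ?Z) A ?h (m * n) (pairing A ?Z m n x (R_unit n z))"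
    proof (rule powers_lex_eqI)
      show "right_unit_family (R_obj A) m n x z \<in> powers A (m * n)"
        using F_set.ind_closed[OF F_set_R[OF A] lex_pos_right_F_maps[OF j] x'] by (simp add: z_eq)
      show "R_hom (tensor_G A ?Z) A ?h (m * n) (pairing A ?Z m n x (R_unit n z)) \<in> powers A (m * n)"
        using h by (intro R_hom_closed[OF _ pairing_closed[OF comm_group_of[OF A] comm_group_of[OF Z] x e]]) simp
      fix a b assume ab: "0 < a" "a \<le> m" "0 < b" "b \<le> n"
      have "{i \<in> {1..m}. (\<lambda>i\<in>{..m}. lex_pos n i (nat (the_Z z))) i = lex_pos n a b} = (if b = j then {a} else {})"
        using ab j by (auto simp: z_eq Suc_le_eq) (metis lex_pos_eq_iff)+
      then have "coord (right_unit_family (R_obj A) m n x z) (lex_pos n a b) = (if b = j then coord x a else \<one>\<^bsub>A\<^esub>)"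
        using ab coord_closed[OF x ab(1,2)] by (simp add: ind_R_obj[OF x] coord_tuple lex_pos_le Pi_def)
      moreover have "coord (R_unit n z) b = Z (if b = j then 1 else 0)"
        using ab j by (simp add: z_eq R_unit_apply coord_tuple)
      moreover have "Z k \<in> carrier ?Z" for k by (simp add: integers_G_def)
      ultimately show "coord (right_unit_family (R_obj A) m n x z) (lex_pos n a b)
          = coord (R_hom (tensor_G A ?Z) A ?h (m * n) (pairing A ?Z m n x (R_unit n z))) (lex_pos n a b)"
        using coord_closed[OF x ab(1,2)]
        by (simp add: coord_R_hom_pairing[OF comm_group_of[OF A] comm_group_of[OF Z] x e ab] tensor_lift_pure[OF comm_group_of[OF A] comm_group_of[OF Z] comm_group_of[OF A] bil])
    qed
    then show "?L (m * n) (day_pair (R_obj A) ?U m n x z)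
        = F_compose (day (R_obj A) ?U) (R_hom (tensor_G A ?Z) A ?h)
            (F_compose (day (R_obj A) ?U) (R_mult G A ?Z) ?l) (m * n) (day_pair (R_obj A) ?U m n x z)"
      using q day_lift_pair[OF lift_L x' z] day_lift_pair[OF lift_l x' z] R_mult_pair[OF A Z x e] x' by simp
  qed
qed

text \<open>The twist carries the entry at \<open>(j, i)\<close> to the position
  \<open>(i, j)\<close>, and the braiding of the tensor product swaps the two factors of that entry;
  on generators both sides therefore agree.\<close>

lemma R_mult_symmetric:
  assumes A: "abelian_G_group G A" and B: "abelian_G_group G B" and P: "P = day (R_obj A) (R_obj B)"
  shows "F_compose P (R_mult G B A) (day_lift G (R_obj A) (R_obj B) (day (R_obj B) (R_obj A)) (braid_family (R_obj A) (R_obj B)))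
    = F_compose P (R_hom (tensor_G A B) (tensor_G B A) (tensor_lift A B (tensor_G B A) (\<lambda>a b. pure_tensor B A b a))) (R_mult G A B)"
    (is "F_compose P _ ?l = F_compose P (R_hom _ _ ?h) _")
proof -
  note FAB = F_set_R[OF A] F_set_R[OF B]
  note lift_l = FG_set_R[OF A] FG_set_R[OF B] FG_set_day[OF FG_set_R[OF B] FG_set_R[OF A]]
    natural_braid_family[OF FAB] equivariant_braid_family[OF FG_set_R[OF A] FG_set_R[OF B]]
  interpret T: comm_group "tensor_G B A" by (rule comm_group_of[OF tensor_closed[OF B A]])
  interpret BA: comm_group "tensor_group B A" by (rule comm_group_tensor_group[OF comm_group_of[OF B] comm_group_of[OF A]])
  have bil: "bilinear_map A B (tensor_G B A) (\<lambda>a b. pure_tensor B A b a)"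
    using bilinear_pure_tensor[OF comm_group_of[OF B] comm_group_of[OF A]] by (simp add: bilinear_map_def)
  note h = tensor_lift_hom[OF comm_group_of[OF A] comm_group_of[OF B] comm_group_of[OF tensor_closed[OF B A]] bil]
  have FP: "F_set P" unfolding P by (rule F_set_day[OF FAB])
  have Rh: "R_hom (tensor_G A B) (tensor_G B A) ?h \<in> F_nat (R_obj (tensor_G A B)) (R_obj (tensor_G B A))"
    using h by (intro R_hom_F_nat comm_group_of tensor_closed A B) simp
  have "F_compose P (R_mult G B A) ?l \<in> F_nat P (R_obj (tensor_G B A))"
    by (intro F_compose_F_nat[OF _ R_mult_F_nat[OF B A] FP]) (simp only: P day_lift_F_nat[OF lift_l])
  moreover have "F_compose P (R_hom (tensor_G A B) (tensor_G B A) ?h) (R_mult G A B) \<in> F_nat P (R_obj (tensor_G B A))"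
    by (intro F_compose_F_nat[OF _ Rh FP]) (simp only: P R_mult_F_nat[OF A B])
  ultimately show ?thesis
    unfolding P
  proof (rule F_nat_day_eqI[OF FAB])
    fix m n x y assume xy: "x \<in> points (sp (R_obj A) m)" "y \<in> points (sp (R_obj B) n)"
    then have x: "x \<in> powers A m" and y: "y \<in> powers B n" by simp_all
    note p = pairing_closed[OF comm_group_of[OF B] comm_group_of[OF A] y x] and q = day_pair_points[OF FAB xy]
    have "R_mult G B A (m * n) (braid_family (R_obj A) (R_obj B) m n x y)
        = ind (R_obj (tensor_G B A)) (n * m) (m * n) (F_twist n m) (pairing B A n m y x)"
      using F_nat_ind[OF R_mult_F_nat[OF B A] F_twist_F_maps day_pair_points[OF FAB(2,1) xy(2,1)]] R_mult_pair[OF B A y x] by simp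
    also have "\<dots> = R_hom (tensor_G A B) (tensor_G B A) ?h (m * n) (pairing A B m n x y)"
    proof (rule powers_lex_eqI)
      show "ind (R_obj (tensor_G B A)) (n * m) (m * n) (F_twist n m) (pairing B A n m y x) \<in> powers (tensor_G B A) (m * n)"
        using F_set.ind_closed[OF F_set_R[OF tensor_closed[OF B A]] F_twist_F_maps] p by simp
      show "R_hom (tensor_G A B) (tensor_G B A) ?h (m * n) (pairing A B m n x y) \<in> powers (tensor_G B A) (m * n)"
        using h by (intro R_hom_closed[OF _ pairing_closed[OF comm_group_of[OF A] comm_group_of[OF B] x y]]) simp
      fix i j assume ij: "0 < i" "i \<le> m" "0 < j" "j \<le> n"
      \<comment> \<open>Injectivity of the twist on nonzero positions: its fibre is one point, so
        the product over the fibre is a single coordinate.\<close>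
      have "k = lex_pos m j i" if k: "k \<in> {1..n * m}" "F_twist n m k = lex_pos n i j" for k
      proof -
        have "0 < k" "k \<le> n * m" using k by auto
        note rc = lex_row_bounds[OF this] lex_col_bounds[OF this] lex_pos_row_col[OF this(1), of m]
        have "lex_pos n i j = lex_pos n (lex_col m k) (lex_row m k)"
          using k F_twist_lex_pos[of "lex_row m k" n "lex_col m k" m] rc by simp
        then show ?thesis
          using lex_pos_eq_iff[OF ij(1,3,4)] rc by auto
      qed
      then have "{k \<in> {1..n * m}. F_twist n m k = lex_pos n i j} = {lex_pos m j i}"
        using ij by (auto simp: F_twist_lex_pos lex_pos_le Suc_le_eq)
      moreover have "pure_tensor B A (coord y j) (coord x i) \<in> carrier (tensor_group B A)"
        by (intro pure_tensor_closed comm_group_of A B coord_closed[OF x ij(1,2)] coord_closed[OF y ij(3,4)])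
      ultimately show "coord (ind (R_obj (tensor_G B A)) (n * m) (m * n) (F_twist n m) (pairing B A n m y x)) (lex_pos n i j)
          = coord (R_hom (tensor_G A B) (tensor_G B A) ?h (m * n) (pairing A B m n x y)) (lex_pos n i j)"
        using ij coord_closed[OF x ij(1,2)] coord_closed[OF y ij(3,4)]
        by (simp add: ind_R_obj[OF p] coord_tuple lex_pos_le coord_pairing Pi_def
            coord_R_hom_pairing[OF comm_group_of[OF A] comm_group_of[OF B] x y] tensor_lift_pure[OF comm_group_of[OF A] comm_group_of[OF B] comm_group_of[OF tensor_closed[OF B A]] bil])
    qed
    finally show "F_compose (day (R_obj A) (R_obj B)) (R_mult G B A) ?l (m * n) (day_pair (R_obj A) (R_obj B) m n x y)
        = F_compose (day (R_obj A) (R_obj B)) (R_hom (tensor_G A B) (tensor_G B A) ?h) (R_mult G A B) (m * n)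
            (day_pair (R_obj A) (R_obj B) m n x y)"
      using q day_lift_pair[OF lift_l xy] R_mult_pair[OF A B x y] by simp
  qed
qed

lemma lax_symmetric_monoidal_R:
  "lax_symmetric_monoidal_functor
    (abelian_G_groups G :: (('g, 'a univ) G_group, 'a univ \<Rightarrow> 'a univ) monoidal_structure)
    (FG_spaces G) R_obj R_hom (R_mult G) R_unit"
proof (intro lax_symmetric_monoidal_functor.intro functor_between.intro lax_symmetric_monoidal_functor_axioms.intro,
    unfold abelian_G_groups_simps FG_spaces_simps mem_Collect_eq, goal_cases)
  \<comment> \<open>Cases 1 to 4 are the functor axioms, 5 and 6 say that the unit and the
    multiplication are maps of the right type, and 7 to 11 are naturality, associativity, the two
    unit laws and symmetry.\<close>
  case (1 A)
  then show ?case by (rule FG_set.is_FG_space[OF FG_set_R])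
next
  case (2 A B f)
  then show ?case by (simp add: R_hom_FG_maps FG_set.is_FG_space[OF FG_set_R])
next
  case (3 A)
  show ?case by (rule R_hom_ident)
next
  case (4 A B C f g)
  then show ?case by (intro R_hom_compose) (simp add: G_homs_def)
next
  case 5
  have Z: "FG_set G (R_obj (integers_G :: ('g, 'a univ) G_group))" and U: "FG_set G (day_unit :: ('g, 'a univ) FG_space)"
    by (rule FG_set_R[OF abelian_G_group_integers_G[OF is_group]], rule FG_set_day_unit[OF is_group])
  then show ?case
    by (simp add: FG_set.is_FG_space FG_maps_iff FG_set_imp_F_set R_unit_F_nat R_unit_equivariant)
next
  case (6 A B)
  then show ?case
    by (simp add: FG_set.is_FG_space[OF FG_set_R] FG_set.is_FG_space[OF FG_set_day] FG_set_R tensor_closed FG_maps_iff F_set_R F_set_day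
        R_mult_F_nat R_mult_equivariant)
next
  case (7 A A' B B' f g)
  then show ?case by (intro R_mult_natural) auto
next
  case (8 A B E P)
  then show ?case by (rule R_mult_assoc)
next
  case (9 A P)
  then show ?case by (rule R_left_unit)
next
  case (10 A P)
  then show ?case by (rule R_right_unit)
next
  case (11 A B P)
  then show ?case by (rule R_mult_symmetric)
qed

end

theorem lemma6p12:
  fixes G :: "('g, 'x) monoid_scheme"
  assumes "group G" and "finite (carrier G)"
  shows "\<exists>\<mu> \<epsilon>. lax_symmetric_monoidal_functor
    (abelian_G_groups G :: (('g, 'a univ) G_group, 'a univ \<Rightarrow> 'a univ) monoidal_structure)
    (FG_spaces G) R_obj R_hom \<mu> \<epsilon>"
  using R_functor.lax_symmetric_monoidal_R[OF R_functor.intro[OF assms(1)]] by blast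

end
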